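(* Let $g$ be the accelerating Kerr-(anti-)de Sitter metric with real parameters $a,\Lambda,\alpha$ and $m\neq0$ (see context). Then the invariant $$Q_2=\frac1{27}\,\frac{I_5I_6-I_7^2}{(I_1^2+I_2^2)^{5/2}}$$ of $g$ equals $$\begin{aligned}Q_2=-\frac{a^2(\alpha r\cos\theta+1)^2\sin^2\theta}{(\alpha r\cos\theta-1)^4(r^2+a^2\cos^2\theta)m^2(a^2\alpha^2+1)}&\Big(\big(\tfrac\Lambda3+\alpha^2\big)r^4-2m\alpha^2r^3+\big(a^2\alpha^2+\tfrac13a^2\Lambda-1\big)r^2+2mr-a^2\Big)\\&\times\Big(1+a^2\big(\tfrac\Lambda3+\alpha^2\big)\cos^2\theta-2\alpha m\cos\theta\Big).\end{aligned}$$
   Context: Accelerating Kerr black hole in (anti-)de Sitter spacetime: in coordinates $(t,r,\theta,\phi)$, signature $(-,+,+,+)$, $$ds^2=\frac1{\Omega^2}\Big\{-\frac{Q}{\rho^2}\big[dt-a\sin^2\theta\,d\phi\big]^2+\frac{\rho^2}{Q}dr^2+\frac{\rho^2}{P}d\theta^2+\frac{P}{\rho^2}\sin^2\theta\big[a\,dt-(r^2+a^2)d\phi\big]^2\Big\},$$ $\Omega=1-\alpha r\cos\theta$, $\rho^2=r^2+a^2\cos^2\theta$, $P=1-2\alpha m\cos\theta+(\alpha^2a^2+\frac13\Lambda a^2)\cos^2\theta$, $Q=(a^2-2mr+r^2)(1-\alpha^2r^2)-\frac13\Lambda(a^2+r^2)r^2$, on the domain where the metric is regular ($\Omega>0$,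 $\rho^2\ne0$, $Q\neq0$, $P>0$, $\sin\theta\neq0$). With $C_{\kappa\lambda\mu\nu}$ the Weyl tensor and $C^*_{\kappa\lambda\mu\nu}=\frac12E_{\kappa\lambda\sigma\tau}C^{\sigma\tau}{}_{\mu\nu}$ its dual ($E$ the Levi-Civita pseudotensor; $Q_2$ does not depend on orientation): $I_1=C_{\kappa\lambda\mu\nu}C^{\kappa\lambda\mu\nu}$, $I_2=C^*_{\kappa\lambda\mu\nu}C^{\kappa\lambda\mu\nu}$, $k_\mu=-\nabla_\mu I_1$, $l_\mu=-\nabla_\mu I_2$, $I_5=k_\mu k^\mu$, $I_6=l_\mu l^\mu$, $I_7=k_\mu l^\mu$. *)

theory Defs
  imports "HOL-Analysis.Analysis"
begin

text \<open>
  Coordinate tensor calculus on a chart of a four-dimensional spacetime. A tensor field is given by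
  its components as a function of the coordinate point \<open>x :: real^4\<close>; components of a metric are
  collected in a matrix.
\<close>

type_synonym point = "real^4"
type_synonym metric = "point \<Rightarrow> real^4^4"

lemma vector_4 [simp]:
  "(vector [a, b, c, d] :: 'a::zero^4) $ 1 = a"
  "(vector [a, b, c, d] :: 'a::zero^4) $ 2 = b"
  "(vector [a, b, c, d] :: 'a::zero^4) $ 3 = c"
  "(vector [a, b, c, d] :: 'a::zero^4) $ 4 = d"
  unfolding vector_def by simp_all

definition pderiv_at :: "4 \<Rightarrow> (point \<Rightarrow> real) \<Rightarrow> point \<Rightarrow> real"
  where "pderiv_at \<mu> f x = deriv (\<lambda>h. f (x + h *\<^sub>R axis \<mu> 1)) 0"

abbreviation inv_metric :: "metric \<Rightarrow> point \<Rightarrow> real^4^4"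
  where "inv_metric g x \<equiv> matrix_inv (g x)"

definition christoffel :: "metric \<Rightarrow> 4 \<Rightarrow> 4 \<Rightarrow> 4 \<Rightarrow> point \<Rightarrow> real"
  \<comment> \<open>\<open>\<Gamma>\<^sup>\<kappa>\<^bsub>\<mu>\<nu>\<^esub>\<close>\<close>
  where "christoffel g \<kappa> \<mu> \<nu> x =
    1/2 * (\<Sum>\<beta>\<in>UNIV. inv_metric g x $ \<kappa> $ \<beta> *
      (pderiv_at \<mu> (\<lambda>y. g y $ \<beta> $ \<nu>) x
       + pderiv_at \<nu> (\<lambda>y. g y $ \<beta> $ \<mu>) x
       - pderiv_at \<beta> (\<lambda>y. g y $ \<mu> $ \<nu>) x))"

definition riemann_up :: "metric \<Rightarrow> 4 \<Rightarrow> 4 \<Rightarrow> 4 \<Rightarrow> 4 \<Rightarrow> point \<Rightarrow> real"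
  \<comment> \<open>\<open>R\<^sup>\<kappa>\<^bsub>\<beta>\<mu>\<nu>\<^esub> = \<partial>\<^sub>\<mu> \<Gamma>\<^sup>\<kappa>\<^bsub>\<nu>\<beta>\<^esub> - \<dots>\<close>; the opposite sign convention changes the sign of the Weyl
    tensor, on which the invariants below depend quadratically\<close>
  where "riemann_up g \<kappa> \<beta> \<mu> \<nu> x =
    pderiv_at \<mu> (christoffel g \<kappa> \<nu> \<beta>) x - pderiv_at \<nu> (christoffel g \<kappa> \<mu> \<beta>) x
    + (\<Sum>\<sigma>\<in>UNIV. christoffel g \<kappa> \<mu> \<sigma> x * christoffel g \<sigma> \<nu> \<beta> x
                - christoffel g \<kappa> \<nu> \<sigma> x * christoffel g \<sigma> \<mu> \<beta> x)"

definition riemann :: "metric \<Rightarrow> 4 \<Rightarrow> 4 \<Rightarrow> 4 \<Rightarrow> 4 \<Rightarrow> point \<Rightarrow> real"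
  where "riemann g \<kappa> \<beta> \<mu> \<nu> x = (\<Sum>\<sigma>\<in>UNIV. g x $ \<kappa> $ \<sigma> * riemann_up g \<sigma> \<beta> \<mu> \<nu> x)"

definition ricci :: "metric \<Rightarrow> 4 \<Rightarrow> 4 \<Rightarrow> point \<Rightarrow> real"
  where "ricci g \<beta> \<nu> x = (\<Sum>\<sigma>\<in>UNIV. riemann_up g \<sigma> \<beta> \<sigma> \<nu> x)"

definition scalar_curvature :: "metric \<Rightarrow> point \<Rightarrow> real"
  where "scalar_curvature g x =
    (\<Sum>\<mu>\<in>UNIV. \<Sum>\<nu>\<in>UNIV. inv_metric g x $ \<mu> $ \<nu> * ricci g \<mu> \<nu> x)"

definition weyl :: "metric \<Rightarrow> 4 \<Rightarrow> 4 \<Rightarrow> 4 \<Rightarrow> 4 \<Rightarrow> point \<Rightarrow> real"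
  where "weyl g \<kappa> \<beta> \<mu> \<nu> x =
    riemann g \<kappa> \<beta> \<mu> \<nu> x
    - 1/2 * (g x $ \<kappa> $ \<mu> * ricci g \<beta> \<nu> x - g x $ \<kappa> $ \<nu> * ricci g \<beta> \<mu> x
             - g x $ \<beta> $ \<mu> * ricci g \<kappa> \<nu> x + g x $ \<beta> $ \<nu> * ricci g \<kappa> \<mu> x)
    + 1/6 * scalar_curvature g x
        * (g x $ \<kappa> $ \<mu> * g x $ \<beta> $ \<nu> - g x $ \<kappa> $ \<nu> * g x $ \<beta> $ \<mu>)"

definition weyl_up2 :: "metric \<Rightarrow> 4 \<Rightarrow> 4 \<Rightarrow> 4 \<Rightarrow> 4 \<Rightarrow> point \<Rightarrow> real"
  \<comment> \<open>\<open>C\<^bsup>\<sigma>\<tau>\<^esup>\<^bsub>\<mu>\<nu>\<^esub>\<close>\<close>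
  where "weyl_up2 g \<sigma> \<tau> \<mu> \<nu> x =
    (\<Sum>\<kappa>\<in>UNIV. \<Sum>\<beta>\<in>UNIV. inv_metric g x $ \<sigma> $ \<kappa> * inv_metric g x $ \<tau> $ \<beta> * weyl g \<kappa> \<beta> \<mu> \<nu> x)"

definition weyl_up4 :: "metric \<Rightarrow> 4 \<Rightarrow> 4 \<Rightarrow> 4 \<Rightarrow> 4 \<Rightarrow> point \<Rightarrow> real"
  \<comment> \<open>\<open>C\<^bsup>\<kappa>\<beta>\<mu>\<nu>\<^esup>\<close>\<close>
  where "weyl_up4 g \<kappa> \<beta> \<mu> \<nu> x =
    (\<Sum>\<sigma>\<in>UNIV. \<Sum>\<tau>\<in>UNIV. inv_metric g x $ \<mu> $ \<sigma> * inv_metric g x $ \<nu> $ \<tau> * weyl_up2 g \<kappa> \<beta> \<sigma> \<tau> x)"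

definition levi_civita_symbol :: "4 \<Rightarrow> 4 \<Rightarrow> 4 \<Rightarrow> 4 \<Rightarrow> real"
  where "levi_civita_symbol \<kappa> \<beta> \<mu> \<nu> =
    (let p = (\<lambda>i. (vector [\<kappa>, \<beta>, \<mu>, \<nu>] :: 4^4) $ i)
     in if p permutes UNIV then of_int (sign p) else 0)"

definition levi_civita :: "real \<Rightarrow> metric \<Rightarrow> 4 \<Rightarrow> 4 \<Rightarrow> 4 \<Rightarrow> 4 \<Rightarrow> point \<Rightarrow> real"
  \<comment> \<open>\<open>ori\<close> is \<open>1\<close> or \<open>-1\<close> according to the orientation of the chart\<close>
  where "levi_civita ori g \<kappa> \<beta> \<mu> \<nu> x = ori * sqrt \<bar>det (g x)\<bar> * levi_civita_symbol \<kappa> \<beta> \<mu> \<nu>"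

definition weyl_dual :: "real \<Rightarrow> metric \<Rightarrow> 4 \<Rightarrow> 4 \<Rightarrow> 4 \<Rightarrow> 4 \<Rightarrow> point \<Rightarrow> real"
  where "weyl_dual ori g \<kappa> \<beta> \<mu> \<nu> x =
    1/2 * (\<Sum>\<sigma>\<in>UNIV. \<Sum>\<tau>\<in>UNIV. levi_civita ori g \<kappa> \<beta> \<sigma> \<tau> x * weyl_up2 g \<sigma> \<tau> \<mu> \<nu> x)"

definition I1 :: "metric \<Rightarrow> point \<Rightarrow> real"
  where "I1 g x = (\<Sum>\<kappa>\<in>UNIV. \<Sum>\<beta>\<in>UNIV. \<Sum>\<mu>\<in>UNIV. \<Sum>\<nu>\<in>UNIV.
    weyl g \<kappa> \<beta> \<mu> \<nu> x * weyl_up4 g \<kappa> \<beta> \<mu> \<nu> x)"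

definition I2 :: "real \<Rightarrow> metric \<Rightarrow> point \<Rightarrow> real"
  where "I2 ori g x = (\<Sum>\<kappa>\<in>UNIV. \<Sum>\<beta>\<in>UNIV. \<Sum>\<mu>\<in>UNIV. \<Sum>\<nu>\<in>UNIV.
    weyl_dual ori g \<kappa> \<beta> \<mu> \<nu> x * weyl_up4 g \<kappa> \<beta> \<mu> \<nu> x)"

text \<open>The covariant derivative of a scalar is its coordinate gradient.\<close>

definition k_form :: "metric \<Rightarrow> 4 \<Rightarrow> point \<Rightarrow> real"
  where "k_form g \<mu> x = - pderiv_at \<mu> (I1 g) x"

definition l_form :: "real \<Rightarrow> metric \<Rightarrow> 4 \<Rightarrow> point \<Rightarrow> real"
  where "l_form ori g \<mu> x = - pderiv_at \<mu> (I2 ori g) x"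

definition I5 :: "metric \<Rightarrow> point \<Rightarrow> real"
  where "I5 g x =
    (\<Sum>\<mu>\<in>UNIV. \<Sum>\<nu>\<in>UNIV. inv_metric g x $ \<mu> $ \<nu> * k_form g \<mu> x * k_form g \<nu> x)"

definition I6 :: "real \<Rightarrow> metric \<Rightarrow> point \<Rightarrow> real"
  where "I6 ori g x =
    (\<Sum>\<mu>\<in>UNIV. \<Sum>\<nu>\<in>UNIV. inv_metric g x $ \<mu> $ \<nu> * l_form ori g \<mu> x * l_form ori g \<nu> x)"

definition I7 :: "real \<Rightarrow> metric \<Rightarrow> point \<Rightarrow> real"
  where "I7 ori g x =
    (\<Sum>\<mu>\<in>UNIV. \<Sum>\<nu>\<in>UNIV. inv_metric g x $ \<mu> $ \<nu> * k_form g \<mu> x * l_form ori g \<nu> x)"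

definition Q2 :: "real \<Rightarrow> metric \<Rightarrow> point \<Rightarrow> real"
  where "Q2 ori g x =
    1/27 * ((I5 g x * I6 ori g x - (I7 ori g x)\<^sup>2) / ((I1 g x)\<^sup>2 + (I2 ori g x)\<^sup>2) powr (5/2))"


text \<open>
  The accelerating Kerr-(anti-)de Sitter metric; the coordinates \<open>t, r, \<theta>, \<phi>\<close> are the components
  \<open>1, 2, 3, 4\<close> of a point.
\<close>

definition conf_factor :: "real \<Rightarrow> real \<Rightarrow> real \<Rightarrow> real"
  where "conf_factor \<alpha> r \<theta> = 1 - \<alpha> * r * cos \<theta>"

definition rho_sq :: "real \<Rightarrow> real \<Rightarrow> real \<Rightarrow> real"
  where "rho_sq a r \<theta> = r\<^sup>2 + a\<^sup>2 * (cos \<theta>)\<^sup>2"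

definition P_fun :: "real \<Rightarrow> real \<Rightarrow> real \<Rightarrow> real \<Rightarrow> real \<Rightarrow> real"
  where "P_fun a \<Lambda> \<alpha> m \<theta> =
    1 - 2 * \<alpha> * m * cos \<theta> + (\<alpha>\<^sup>2 * a\<^sup>2 + 1/3 * \<Lambda> * a\<^sup>2) * (cos \<theta>)\<^sup>2"

definition Q_fun :: "real \<Rightarrow> real \<Rightarrow> real \<Rightarrow> real \<Rightarrow> real \<Rightarrow> real"
  where "Q_fun a \<Lambda> \<alpha> m r =
    (a\<^sup>2 - 2 * m * r + r\<^sup>2) * (1 - \<alpha>\<^sup>2 * r\<^sup>2) - 1/3 * \<Lambda> * (a\<^sup>2 + r\<^sup>2) * r\<^sup>2"

definition acc_kerr_ds :: "real \<Rightarrow> real \<Rightarrow> real \<Rightarrow> real \<Rightarrow> metric"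
  where "acc_kerr_ds a \<Lambda> \<alpha> m x =
    (let r = x $ 2; \<theta> = x $ 3;
         \<Omega> = conf_factor \<alpha> r \<theta>; \<rho>2 = rho_sq a r \<theta>; P = P_fun a \<Lambda> \<alpha> m \<theta>; Q = Q_fun a \<Lambda> \<alpha> m r;
         dr = axis 2 1; d\<theta> = axis 3 1;
         u = vector [1, 0, 0, - a * (sin \<theta>)\<^sup>2];  \<comment> \<open>\<open>dt - a sin\<^sup>2\<theta> d\<phi>\<close>\<close>
         v = vector [a, 0, 0, - (r\<^sup>2 + a\<^sup>2)]        \<comment> \<open>\<open>a dt - (r\<^sup>2 + a\<^sup>2) d\<phi>\<close>\<close>
     in \<chi> \<mu> \<nu>. 1 / \<Omega>\<^sup>2 *
          (- (Q / \<rho>2) * (u $ \<mu> * u $ \<nu>)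
           + \<rho>2 / Q * (dr $ \<mu> * dr $ \<nu>)
           + \<rho>2 / P * (d\<theta> $ \<mu> * d\<theta> $ \<nu>)
           + P / \<rho>2 * (sin \<theta>)\<^sup>2 * (v $ \<mu> * v $ \<nu>)))"

end

theory Submission
  imports Defs
begin

text \<open>
  In the coframe \<open>dt - a sin\<^sup>2\<theta> d\<phi>\<close>, \<open>dr\<close>, \<open>dX\<close>, \<open>a dt - (r\<^sup>2 + a\<^sup>2) d\<phi>\<close> with \<open>X = cos \<theta>\<close> the metric is
  diagonal and its connection is rational in \<open>r\<close> and \<open>X\<close>. Cartan's structure equations show that the
  metric is Einstein with a Weyl tensor of type D, described by the complex scalar
  \<open>\<Xi> + i Y = - m (1 - i \<alpha> a) ((1 - \<alpha> r X) / (r + i a X))\<^sup>3\<close>. Hence \<open>I\<^sub>1\<close> and, up to sign, \<open>I\<^sub>2\<close> are the real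
  and imaginary part of \<open>\<Phi> = 48 (\<Xi> + i Y)\<^sup>2\<close>, so that \<open>I\<^sub>1\<^sup>2 + I\<^sub>2\<^sup>2 = \<bar>\<Phi>\<bar>\<^sup>2\<close>, and the Gram determinant
  \<open>I\<^sub>5 I\<^sub>6 - I\<^sub>7\<^sup>2\<close> of their gradients is \<open>(Im (cnj (\<partial>\<^sub>r \<Phi>) \<partial>\<^sub>X \<Phi>))\<^sup>2\<close> divided by the
  \<open>dr\<^sup>2\<close> and \<open>dX\<^sup>2\<close> coefficients of the metric.
\<close>

section \<open>Curvature in a moving frame\<close>

text \<open>The coframe is left unnormalised on purpose: an orthonormal one would bring in square
  roots of \<open>Q\<close> and \<open>P\<close> and a case split on the sign of \<open>Q\<close>.
  The price is that the norms \<open>h\<close> are functions, so the connection matrices have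
  diagonal entries dh / (2 h) and are skew only after weighting with \<open>h\<close>. The other
  obstacle is size, met by three separations. The curvature is computed for arbitrary values of
  \<open>q\<close>, \<open>p\<close> and their derivatives; the field equations enter afterwards as
  four polynomial identities. Tensors touch the chart only through linear index transforms, so
  contractions become sums over frame components. The gradients are those of a sixth power of one
  complex quotient, whose two partial derivatives share a factor; only the modulus of that factor
  survives in the Gram determinant, so its real and imaginary parts are never expanded.\<close>

definition has_pd :: "(point \<Rightarrow> real) \<Rightarrow> real \<Rightarrow> 4 \<Rightarrow> point \<Rightarrow> bool"
  where "has_pd f D \<mu> x \<longleftrightarrow> ((\<lambda>h. f (x + h *\<^sub>R axis \<mu> 1)) has_real_derivative D) (at 0)"

text \<open>\<open>deriv\<close> is total, so equations for \<open>pderiv_at\<close> do not compose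
  under sums and products. \<open>has_pd\<close> carries existence as well, and this rule converts
  back at the end.\<close>

lemma pderiv_at_eq: "has_pd f D \<mu> x \<Longrightarrow> pderiv_at \<mu> f x = D"
  unfolding has_pd_def pderiv_at_def by (rule DERIV_imp_deriv)

lemma has_pd_unique: "has_pd f D \<mu> x \<Longrightarrow> has_pd f D' \<mu> x \<Longrightarrow> D = D'"
  using pderiv_at_eq by metis

lemma has_pd_const: "has_pd (\<lambda>_. c) 0 \<mu> x"
  unfolding has_pd_def by simp

lemma has_pd_add: "has_pd f D \<mu> x \<Longrightarrow> has_pd g D' \<mu> x \<Longrightarrow> has_pd (\<lambda>y. f y + g y) (D + D') \<mu> x"
  unfolding has_pd_def by (rule DERIV_add)

lemma has_pd_mult:
  "has_pd f D \<mu> x \<Longrightarrow> has_pd g D' \<mu> x \<Longrightarrow> has_pd (\<lambda>y. f y * g y) (D * g x + f x * D') \<mu> x"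
  unfolding has_pd_def by (drule (1) DERIV_mult) (simp add: algebra_simps)

lemma has_pd_sum:
  "(\<And>i. i \<in> I \<Longrightarrow> has_pd (f i) (D i) \<mu> x) \<Longrightarrow> has_pd (\<lambda>y. \<Sum>i\<in>I. f i y) (\<Sum>i\<in>I. D i) \<mu> x"
  unfolding has_pd_def by (rule DERIV_sum)

lemma matrix_add_rdistrib: "(B + C) ** D = B ** D + C ** D"
  for B C :: "'a::semiring_1^'n^'m" and D :: "'a^'k^'n"
  by (simp add: matrix_matrix_mult_def vec_eq_iff distrib_right sum.distrib)

text \<open>Christoffel symbols and invariants agree with their closed forms only on an open set;
  that suffices because a derivative sees only a neighbourhood of \<open>x\<close>.\<close>

lemma has_pd_cong_open:
  assumes "has_pd f D \<mu> x" and "open U" and "x \<in> U" and "\<And>y. y \<in> U \<Longrightarrow> f y = f' y"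
  shows "has_pd f' D \<mu> x"
proof -
  have "((\<lambda>h::real. x + h *\<^sub>R axis \<mu> 1) \<longlongrightarrow> x + 0 *\<^sub>R axis \<mu> 1) (at 0)"
    by (intro tendsto_intros)
  then have "\<forall>\<^sub>F h in at 0. x + h *\<^sub>R axis \<mu> 1 \<in> U"
    using assms(2,3) topological_tendstoD by fastforce
  then have "\<forall>\<^sub>F h in nhds 0. f (x + h *\<^sub>R axis \<mu> 1) = f' (x + h *\<^sub>R axis \<mu> 1)"
    unfolding eventually_at_filter using assms(3,4) by (auto elim!: eventually_mono)
  then show ?thesis
    using assms(1) unfolding has_pd_def by (simp cong: DERIV_cong_ev)
qed

text \<open>Rows of \<open>E\<close> are the coframe forms, columns of \<open>F\<close> the dual
  vectors, \<open>A \<mu>\<close> is the connection matrix along the coordinate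
  \<open>\<mu>\<close>. \<open>dh\<close> and \<open>skew\<close> together are metric compatibility
  for a diagonal, non-constant frame metric, and \<open>torsion\<close> is the first structure
  equation. For \<open>F\<close> only differentiability is asked, since \<open>FE\<close> determines
  its derivative.\<close>

locale moving_frame =
  fixes g :: metric and U :: "point set" and E F :: "point \<Rightarrow> real^4^4" and h :: "4 \<Rightarrow> point \<Rightarrow> real"
    and dE A :: "4 \<Rightarrow> point \<Rightarrow> real^4^4" and ddE dA :: "4 \<Rightarrow> 4 \<Rightarrow> point \<Rightarrow> real^4^4"
  assumes open_U: "open U"
    and metric: "\<And>y \<mu> \<nu>. y \<in> U \<Longrightarrow> g y $ \<mu> $ \<nu> = (\<Sum>a\<in>UNIV. h a y * E y $ a $ \<mu> * E y $ a $ \<nu>)"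
    and FE: "\<And>y. y \<in> U \<Longrightarrow> F y ** E y = mat 1"
    and h_nz: "\<And>y a. y \<in> U \<Longrightarrow> h a y \<noteq> 0"
    and dE: "\<And>y a \<mu> \<nu>. y \<in> U \<Longrightarrow> has_pd (\<lambda>y. E y $ a $ \<nu>) (dE \<mu> y $ a $ \<nu>) \<mu> y"
    and dF: "\<And>y a \<mu> \<kappa>. y \<in> U \<Longrightarrow> \<exists>D. has_pd (\<lambda>y. F y $ \<kappa> $ a) D \<mu> y"
    and ddE: "\<And>y a \<mu> \<nu> \<kappa>. y \<in> U \<Longrightarrow> has_pd (\<lambda>y. dE \<nu> y $ a $ \<kappa>) (ddE \<mu> \<nu> y $ a $ \<kappa>) \<mu> y"
    and ddE_sym: "\<And>y \<mu> \<nu>. y \<in> U \<Longrightarrow> ddE \<mu> \<nu> y = ddE \<nu> \<mu> y"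
    and dA: "\<And>y a b \<mu> \<nu>. y \<in> U \<Longrightarrow> has_pd (\<lambda>y. A \<nu> y $ a $ b) (dA \<mu> \<nu> y $ a $ b) \<mu> y"
    and dh: "\<And>y a \<mu>. y \<in> U \<Longrightarrow> has_pd (h a) (2 * h a y * A \<mu> y $ a $ a) \<mu> y"
    and skew: "\<And>y a b \<mu>. y \<in> U \<Longrightarrow> a \<noteq> b \<Longrightarrow> h a y * A \<mu> y $ a $ b + h b y * A \<mu> y $ b $ a = 0"
    and torsion: "\<And>y a \<mu> \<nu>. y \<in> U \<Longrightarrow>
      (dE \<mu> y + A \<mu> y ** E y) $ a $ \<nu> = (dE \<nu> y + A \<nu> y ** E y) $ a $ \<mu>"
begin

lemma EF: "y \<in> U \<Longrightarrow> E y ** F y = mat 1"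
  using FE matrix_left_right_inverse by blast

lemma E_F_sum: "y \<in> U \<Longrightarrow> (\<Sum>\<mu>\<in>UNIV. E y $ a $ \<mu> * F y $ \<mu> $ b) = (if a = b then 1 else 0)"
  using EF[of y] unfolding matrix_matrix_mult_def mat_def vec_eq_iff by auto

text \<open>The derivative of the coframe with the connection acting on the frame index alone. As
  the full covariant derivative of the coframe vanishes, this is \<open>E\<close> times the
  Christoffel matrix (\<open>E_G\<close>); \<open>torsion\<close> says that it is symmetric in its
  coordinate indices.\<close>

definition Z :: "4 \<Rightarrow> point \<Rightarrow> real^4^4"
  where "Z \<mu> y = dE \<mu> y + A \<mu> y ** E y"

lemma inv_metric_mult:
  assumes "y \<in> U"
  shows "inv_metric g y ** g y = mat 1" and "g y ** inv_metric g y = mat 1"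
proof -
  define H where "H = (\<chi> a b. if a = b then h a y else 0)"
  define H' where "H' = (\<chi> a b. if a = b then 1 / h a y else 0)"
  have HE: "(H ** E y) $ a $ \<nu> = h a y * E y $ a $ \<nu>" for a \<nu>
    by (simp add: H_def matrix_matrix_mult_def if_distrib[of "\<lambda>z. z * _"] cong: if_cong)
  have g: "g y = transpose (E y) ** (H ** E y)"
    unfolding matrix_matrix_mult_def[of "transpose (E y)"]
    by (simp add: vec_eq_iff metric[OF assms] HE transpose_def mult_ac)
  have 1: "H' ** H = mat 1"
    by (simp add: vec_eq_iff matrix_matrix_mult_def H_def H'_def mat_def h_nz[OF assms]
        if_distrib[of "\<lambda>z. z * _"] cong: if_cong)
  have 2: "transpose (F y) ** transpose (E y) = mat 1"
    by (metis EF[OF assms] matrix_transpose_mul transpose_mat)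
  have "(F y ** (H' ** transpose (F y))) ** g y
      = F y ** (H' ** ((transpose (F y) ** transpose (E y)) ** (H ** E y)))"
    by (simp add: g matrix_mul_assoc)
  also have "\<dots> = F y ** ((H' ** H) ** E y)"
    by (simp add: 2 matrix_mul_assoc)
  also have "\<dots> = mat 1"
    by (simp add: 1 FE[OF assms])
  finally have 3: "(F y ** (H' ** transpose (F y))) ** g y = mat 1" .
  then have "g y ** (F y ** (H' ** transpose (F y))) = mat 1"
    using matrix_left_right_inverse by blast
  \<comment> \<open>\<open>matrix_inv\<close> is chosen by \<open>SOME\<close>, so one two-sided
    inverse is enough to pin down its defining property.\<close>
  with 3 show "inv_metric g y ** g y = mat 1" "g y ** inv_metric g y = mat 1"
    using someI[of "\<lambda>A'. g y ** A' = mat 1 \<and> A' ** g y = mat 1"]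
    unfolding matrix_inv_def by blast+
qed

lemma metric_F:
  assumes "y \<in> U"
  shows "(g y ** F y) $ \<mu> $ i = h i y * E y $ i $ \<mu>"
proof -
  have "(g y ** F y) $ \<mu> $ i = (\<Sum>b\<in>UNIV. h b y * E y $ b $ \<mu> * (\<Sum>\<nu>\<in>UNIV. E y $ b $ \<nu> * F y $ \<nu> $ i))"
    unfolding matrix_matrix_mult_def sum_distrib_left
    by (simp add: metric[OF assms] sum_distrib_right) (subst sum.swap, simp add: mult_ac)
  then show ?thesis
    by (simp add: E_F_sum[OF assms] if_distrib cong: if_cong)
qed

lemma inv_metric_E:
  assumes "y \<in> U"
  shows "(\<Sum>\<mu>\<in>UNIV. inv_metric g y $ \<kappa> $ \<mu> * E y $ a $ \<mu>) = F y $ \<kappa> $ a / h a y"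
proof -
  have "h a y * (\<Sum>\<mu>\<in>UNIV. inv_metric g y $ \<kappa> $ \<mu> * E y $ a $ \<mu>)
      = (\<Sum>\<mu>\<in>UNIV. inv_metric g y $ \<kappa> $ \<mu> * (g y ** F y) $ \<mu> $ a)"
    by (simp add: metric_F[OF assms] sum_distrib_left mult_ac)
  also have "\<dots> = (inv_metric g y ** (g y ** F y)) $ \<kappa> $ a"
    by (simp add: matrix_matrix_mult_def)
  also have "\<dots> = F y $ \<kappa> $ a"
    by (simp add: matrix_mul_assoc inv_metric_mult[OF assms])
  finally show ?thesis
    using h_nz[OF assms] by (simp add: field_simps)
qed

text \<open>The two terms of the sum are \<open>\<Gamma>\<^bsub>\<beta>\<mu>\<nu>\<^esub>\<close> and \<open>\<Gamma>\<^bsub>\<nu>\<mu>\<beta>\<^esub>\<close>.\<close>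

lemma has_pd_metric:
  assumes "y \<in> U"
  shows "has_pd (\<lambda>y. g y $ \<beta> $ \<nu>)
    ((\<Sum>a\<in>UNIV. h a y * E y $ a $ \<beta> * Z \<mu> y $ a $ \<nu>)
      + (\<Sum>a\<in>UNIV. h a y * E y $ a $ \<nu> * Z \<mu> y $ a $ \<beta>)) \<mu> y"
proof -
  \<comment> \<open>Metric compatibility: the symmetric part of the matrix
    \<open>h a y * A \<mu> y $ a $ b\<close> is diagonal, with half the derivative of
    \<open>h\<close> on the diagonal. The derivative of \<open>h\<close> thus turns into connection
    terms acting on both coframe factors.\<close>
  have skew_sum: "(\<Sum>a\<in>UNIV. 2 * h a y * A \<mu> y $ a $ a * (E y $ a $ \<beta> * E y $ a $ \<nu>))
    = (\<Sum>a\<in>UNIV. \<Sum>b\<in>UNIV. h a y * A \<mu> y $ a $ b * (E y $ a $ \<beta> * E y $ b $ \<nu> + E y $ a $ \<nu> * E y $ b $ \<beta>))"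
    (is "?L = ?R")
  proof -
    have s: "h a y * A \<mu> y $ a $ b * e + h b y * A \<mu> y $ b $ a * e = (if a = b then 2 * h a y * A \<mu> y $ a $ a else 0) * e" for a b e
      using skew[OF assms, of a b \<mu>] by (cases "a = b") (simp_all flip: distrib_right)
    have "?R = (\<Sum>a\<in>UNIV. \<Sum>b\<in>UNIV. h a y * A \<mu> y $ a $ b * (E y $ a $ \<beta> * E y $ b $ \<nu>))
        + (\<Sum>a\<in>UNIV. \<Sum>b\<in>UNIV. h a y * A \<mu> y $ a $ b * (E y $ a $ \<nu> * E y $ b $ \<beta>))"
      by (simp add: distrib_left sum.distrib)
    also have "(\<Sum>a\<in>UNIV. \<Sum>b\<in>UNIV. h a y * A \<mu> y $ a $ b * (E y $ a $ \<nu> * E y $ b $ \<beta>))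
        = (\<Sum>a\<in>UNIV. \<Sum>b\<in>UNIV. h b y * A \<mu> y $ b $ a * (E y $ a $ \<beta> * E y $ b $ \<nu>))"
      by (subst sum.swap) (simp add: mult_ac)
    also have "(\<Sum>a\<in>UNIV. \<Sum>b\<in>UNIV. h a y * A \<mu> y $ a $ b * (E y $ a $ \<beta> * E y $ b $ \<nu>)) + \<dots>
      = (\<Sum>a\<in>UNIV. \<Sum>b\<in>UNIV. (if a = b then 2 * h a y * A \<mu> y $ a $ a else 0) * (E y $ a $ \<beta> * E y $ b $ \<nu>))"
      unfolding sum.distrib[symmetric] s ..
    also have "\<dots> = ?L"
      by (simp add: if_distrib[of "\<lambda>z. z * _"] cong: if_cong)
    finally show ?thesis ..
  qed
  have "has_pd (\<lambda>y. \<Sum>a\<in>UNIV. h a y * E y $ a $ \<beta> * E y $ a $ \<nu>)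
    (\<Sum>a\<in>UNIV. (2 * h a y * A \<mu> y $ a $ a * E y $ a $ \<beta> + h a y * dE \<mu> y $ a $ \<beta>) * E y $ a $ \<nu>
      + h a y * E y $ a $ \<beta> * dE \<mu> y $ a $ \<nu>) \<mu> y"
    by (intro has_pd_sum has_pd_mult dh dE assms)
  also have "(\<Sum>a\<in>UNIV. (2 * h a y * A \<mu> y $ a $ a * E y $ a $ \<beta> + h a y * dE \<mu> y $ a $ \<beta>) * E y $ a $ \<nu>
      + h a y * E y $ a $ \<beta> * dE \<mu> y $ a $ \<nu>) =
     (\<Sum>a\<in>UNIV. 2 * h a y * A \<mu> y $ a $ a * (E y $ a $ \<beta> * E y $ a $ \<nu>))
      + (\<Sum>a\<in>UNIV. h a y * (dE \<mu> y $ a $ \<beta> * E y $ a $ \<nu> + E y $ a $ \<beta> * dE \<mu> y $ a $ \<nu>))"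
    unfolding sum.distrib[symmetric] by (simp add: algebra_simps)
  also have "\<dots> = (\<Sum>a\<in>UNIV. h a y * E y $ a $ \<beta> * Z \<mu> y $ a $ \<nu>)
      + (\<Sum>a\<in>UNIV. h a y * E y $ a $ \<nu> * Z \<mu> y $ a $ \<beta>)"
    unfolding skew_sum sum.distrib[symmetric]
    by (rule sum.cong)
      (simp_all add: Z_def matrix_matrix_mult_def distrib_left distrib_right sum_distrib_left sum.distrib mult_ac)
  finally show ?thesis
    by (rule has_pd_cong_open[OF _ open_U assms]) (simp add: metric)
qed

text \<open>Uniqueness of the Levi-Civita connection: each metric derivative is a sum of two terms
  \<open>?T\<close>, and their symmetry in the last two indices, which is \<open>torsion\<close>,
  collapses the Koszul combination to twice one term.\<close>

lemma christoffel_eq: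
  assumes "y \<in> U"
  shows "christoffel g \<kappa> \<mu> \<nu> y = (F y ** Z \<mu> y) $ \<kappa> $ \<nu>"
proof -
  let ?T = "\<lambda>\<beta> \<mu> \<nu>. \<Sum>a\<in>UNIV. h a y * E y $ a $ \<beta> * Z \<mu> y $ a $ \<nu>"
  have sym: "?T \<beta> \<mu> \<nu> = ?T \<beta> \<nu> \<mu>" for \<beta> \<mu> \<nu>
    by (intro sum.cong refl arg_cong2[of _ _ _ _ "(*)"]) (simp only: Z_def torsion[OF assms, of \<mu> _ \<nu>])
  have pd: "pderiv_at \<mu> (\<lambda>y. g y $ \<beta> $ \<nu>) y = ?T \<beta> \<mu> \<nu> + ?T \<nu> \<mu> \<beta>" for \<mu> \<beta> \<nu>
    by (rule pderiv_at_eq[OF has_pd_metric[OF assms]])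
  have T: "pderiv_at \<mu> (\<lambda>y. g y $ \<beta> $ \<nu>) y + pderiv_at \<nu> (\<lambda>y. g y $ \<beta> $ \<mu>) y
      - pderiv_at \<beta> (\<lambda>y. g y $ \<mu> $ \<nu>) y = 2 * ?T \<beta> \<mu> \<nu>" for \<beta>
    unfolding pd using sym[of \<beta> \<mu> \<nu>] sym[of \<nu> \<mu> \<beta>] sym[of \<mu> \<nu> \<beta>] by simp
  have "christoffel g \<kappa> \<mu> \<nu> y = (\<Sum>\<beta>\<in>UNIV. inv_metric g y $ \<kappa> $ \<beta> * ?T \<beta> \<mu> \<nu>)"
    unfolding christoffel_def T by (simp add: sum_distrib_left mult.assoc)
  also have "\<dots> = (\<Sum>a\<in>UNIV. h a y * Z \<mu> y $ a $ \<nu> * (\<Sum>\<beta>\<in>UNIV. inv_metric g y $ \<kappa> $ \<beta> * E y $ a $ \<beta>))"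
    unfolding sum_distrib_left by (subst sum.swap) (simp add: mult_ac)
  also have "\<dots> = (F y ** Z \<mu> y) $ \<kappa> $ \<nu>"
    unfolding inv_metric_E[OF assms] using h_nz[OF assms] by (simp add: matrix_matrix_mult_def mult_ac)
  finally show ?thesis .
qed

definition dZ :: "4 \<Rightarrow> 4 \<Rightarrow> point \<Rightarrow> real^4^4"
  where "dZ \<mu> \<nu> y = ddE \<mu> \<nu> y + (dA \<mu> \<nu> y ** E y + A \<nu> y ** dE \<mu> y)"

lemma has_pd_Z: "y \<in> U \<Longrightarrow> has_pd (\<lambda>y. Z \<nu> y $ a $ \<kappa>) (dZ \<mu> \<nu> y $ a $ \<kappa>) \<mu> y"
  unfolding Z_def dZ_def matrix_matrix_mult_def
  by (simp flip: sum.distrib) (intro has_pd_add has_pd_sum has_pd_mult ddE dA dE; assumption)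

text \<open>The components of the curvature two-form dA + A \<and> A, by Cartan's second structure
  equation.\<close>

definition curv :: "4 \<Rightarrow> 4 \<Rightarrow> point \<Rightarrow> real^4^4"
  where "curv \<mu> \<nu> y = dA \<mu> \<nu> y - dA \<nu> \<mu> y + (A \<mu> y ** A \<nu> y - A \<nu> y ** A \<mu> y)"

definition G :: "4 \<Rightarrow> point \<Rightarrow> real^4^4"
  where "G \<mu> y = (\<chi> \<kappa> \<nu>. christoffel g \<kappa> \<mu> \<nu> y)"

lemma G_eq: "y \<in> U \<Longrightarrow> G \<mu> y = F y ** Z \<mu> y"
  by (simp add: G_def vec_eq_iff christoffel_eq)

lemma E_G: "y \<in> U \<Longrightarrow> E y ** G \<mu> y = Z \<mu> y"
  by (simp add: G_eq matrix_mul_assoc EF)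

text \<open>No formula for the derivative of \<open>F\<close> is used. Its existence makes the
  Christoffel symbols differentiable; differentiating \<open>E_G\<close> and comparing by uniqueness
  of derivatives then determines \<open>dG\<close>.\<close>

lemma G_pd:
  assumes "y \<in> U"
  obtains dG where "\<And>\<kappa> \<beta>. has_pd (\<lambda>y. christoffel g \<kappa> \<nu> \<beta> y) (dG $ \<kappa> $ \<beta>) \<mu> y"
    and "dE \<mu> y ** G \<nu> y + E y ** dG = dZ \<mu> \<nu> y"
proof -
  define D where "D \<kappa> a = (SOME D. has_pd (\<lambda>y. F y $ \<kappa> $ a) D \<mu> y)" for \<kappa> a
  have D: "has_pd (\<lambda>y. F y $ \<kappa> $ a) (D \<kappa> a) \<mu> y" for \<kappa> a
    unfolding D_def by (rule someI_ex[OF dF[OF assms]])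
  define dG :: "real^4^4" where "dG = (\<chi> \<kappa> \<beta>. \<Sum>a\<in>UNIV. D \<kappa> a * Z \<nu> y $ a $ \<beta> + F y $ \<kappa> $ a * dZ \<mu> \<nu> y $ a $ \<beta>)"
  have pd: "has_pd (\<lambda>y. christoffel g \<kappa> \<nu> \<beta> y) (dG $ \<kappa> $ \<beta>) \<mu> y" for \<kappa> \<beta>
  proof (rule has_pd_cong_open[OF _ open_U assms])
    show "has_pd (\<lambda>y. \<Sum>a\<in>UNIV. F y $ \<kappa> $ a * Z \<nu> y $ a $ \<beta>) (dG $ \<kappa> $ \<beta>) \<mu> y"
      unfolding dG_def by simp (intro has_pd_sum has_pd_mult D has_pd_Z assms)
  qed (simp add: christoffel_eq matrix_matrix_mult_def)
  have "(dE \<mu> y ** G \<nu> y + E y ** dG) $ a $ \<beta> = dZ \<mu> \<nu> y $ a $ \<beta>" for a \<beta>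
  proof (rule has_pd_unique)
    show "has_pd (\<lambda>y. Z \<nu> y $ a $ \<beta>) (dZ \<mu> \<nu> y $ a $ \<beta>) \<mu> y"
      by (rule has_pd_Z[OF assms])
    have "has_pd (\<lambda>y. \<Sum>\<kappa>\<in>UNIV. E y $ a $ \<kappa> * christoffel g \<kappa> \<nu> \<beta> y)
       (\<Sum>\<kappa>\<in>UNIV. dE \<mu> y $ a $ \<kappa> * christoffel g \<kappa> \<nu> \<beta> y + E y $ a $ \<kappa> * dG $ \<kappa> $ \<beta>) \<mu> y"
      by (intro has_pd_sum has_pd_mult pd dE assms)
    also have "(\<Sum>\<kappa>\<in>UNIV. dE \<mu> y $ a $ \<kappa> * christoffel g \<kappa> \<nu> \<beta> y + E y $ a $ \<kappa> * dG $ \<kappa> $ \<beta>)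
        = (dE \<mu> y ** G \<nu> y + E y ** dG) $ a $ \<beta>"
      by (simp add: G_def matrix_matrix_mult_def sum.distrib)
    finally show "has_pd (\<lambda>y. Z \<nu> y $ a $ \<beta>) ((dE \<mu> y ** G \<nu> y + E y ** dG) $ a $ \<beta>) \<mu> y"
    proof (rule has_pd_cong_open[OF _ open_U assms])
      fix y assume "y \<in> U"
      then show "(\<Sum>\<kappa>\<in>UNIV. E y $ a $ \<kappa> * christoffel g \<kappa> \<nu> \<beta> y) = Z \<nu> y $ a $ \<beta>"
        by (simp add: E_G[symmetric] G_def matrix_matrix_mult_def)
    qed
  qed
  with pd show ?thesis
    by (intro that) (auto simp: vec_eq_iff)
qed

text \<open>Curvature transforms by conjugation under a change of frame: multiplied by
  \<open>E\<close>, the derivatives of \<open>G\<close> and the products \<open>G ** G\<close> have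
  the same \<open>dE ** G\<close> terms, which cancel, and the second derivatives of
  \<open>E\<close> drop out by \<open>ddE_sym\<close>.\<close>

lemma riemann_up_eq:
  assumes "y \<in> U"
  shows "riemann_up g \<kappa> \<beta> \<mu> \<nu> y = (F y ** (curv \<mu> \<nu> y ** E y)) $ \<kappa> $ \<beta>"
proof -
  obtain D1 where D1: "\<And>\<kappa> \<beta>. has_pd (\<lambda>y. christoffel g \<kappa> \<nu> \<beta> y) (D1 $ \<kappa> $ \<beta>) \<mu> y"
    and e1: "dE \<mu> y ** G \<nu> y + E y ** D1 = dZ \<mu> \<nu> y"
    using G_pd[OF assms] by blast
  obtain D2 where D2: "\<And>\<kappa> \<beta>. has_pd (\<lambda>y. christoffel g \<kappa> \<mu> \<beta> y) (D2 $ \<kappa> $ \<beta>) \<nu> y"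
    and e2: "dE \<nu> y ** G \<mu> y + E y ** D2 = dZ \<nu> \<mu> y"
    using G_pd[OF assms] by blast
  let ?R = "D1 - D2 + (G \<mu> y ** G \<nu> y - G \<nu> y ** G \<mu> y)"
  have R: "riemann_up g \<kappa> \<beta> \<mu> \<nu> y = ?R $ \<kappa> $ \<beta>"
    unfolding riemann_up_def pderiv_at_eq[OF D1] pderiv_at_eq[OF D2]
    by (simp add: G_def matrix_matrix_mult_def sum_subtractf)
  have GG: "E y ** (G \<mu> y ** G \<nu> y) = dE \<mu> y ** G \<nu> y + (A \<mu> y ** dE \<nu> y + (A \<mu> y ** A \<nu> y) ** E y)" for \<mu> \<nu>
  proof -
    have "E y ** (G \<mu> y ** G \<nu> y) = (dE \<mu> y + A \<mu> y ** E y) ** G \<nu> y"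
      by (simp add: matrix_mul_assoc E_G[OF assms]) (simp add: Z_def)
    also have "\<dots> = dE \<mu> y ** G \<nu> y + A \<mu> y ** Z \<nu> y"
      by (simp add: matrix_add_rdistrib matrix_mul_assoc[symmetric] E_G[OF assms])
    finally show ?thesis
      by (simp add: Z_def matrix_add_ldistrib matrix_mul_assoc)
  qed
  have sub: "X ** (Y - Y') = X ** Y - X ** Y'" for X Y Y' :: "real^4^4"
    by (simp add: matrix_matrix_mult_def vec_eq_iff right_diff_distrib sum_subtractf)
  have sub': "(Y - Y') ** X = Y ** X - Y' ** X" for X Y Y' :: "real^4^4"
    by (simp add: matrix_matrix_mult_def vec_eq_iff left_diff_distrib sum_subtractf)
  have e: "E y ** D1 = dZ \<mu> \<nu> y - dE \<mu> y ** G \<nu> y" "E y ** D2 = dZ \<nu> \<mu> y - dE \<nu> y ** G \<mu> y"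
    using e1 e2 by (simp_all add: algebra_simps)
  have "E y ** ?R = curv \<mu> \<nu> y ** E y"
    by (simp add: curv_def dZ_def matrix_add_ldistrib matrix_add_rdistrib sub sub' e GG
        ddE_sym[OF assms, of \<mu> \<nu>])
  then have "F y ** (curv \<mu> \<nu> y ** E y) = ?R"
    by (metis matrix_mul_assoc FE[OF assms] matrix_mul_lid)
  then show ?thesis
    using R by simp
qed

end

section \<open>Connection and curvature of the type D frame\<close>

text \<open>
  In the coframe \<open>e\<^sup>1 = dt - a sin\<^sup>2\<theta> d\<phi>\<close>, \<open>e\<^sup>2 = dr\<close>, \<open>e\<^sup>3 = dX\<close>, \<open>e\<^sup>4 = a dt - (r\<^sup>2 + a\<^sup>2) d\<phi>\<close>
  with \<open>X = cos \<theta>\<close> the metric is diagonal and everything is rational in \<open>r\<close> and \<open>X\<close>. The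
  connection coefficients are polynomial in
  \<open>n = 1 / \<rho>\<^sup>2\<close>, \<open>A = - a X n\<close>, \<open>B = r n\<close>, \<open>U = \<alpha> X / \<Omega>\<close>, \<open>V = \<alpha> r / \<Omega>\<close>, in
  \<open>q = Q(r)\<close>, \<open>p = (1 - X\<^sup>2) P(X)\<close> and their first derivatives \<open>q1\<close>, \<open>p1\<close>, and in \<open>1 / q\<close>, \<open>1 / p\<close>.
  The matrix \<open>conn \<dots> c\<close> is the component of the connection form along \<open>e\<^sup>c\<close>; \<open>conn_r\<close> and
  \<open>conn_X\<close> are its derivatives, with \<open>W = \<alpha> / \<Omega>\<close>.
\<close>

definition conn :: "real \<Rightarrow> real \<Rightarrow> real \<Rightarrow> real \<Rightarrow> real \<Rightarrow> real \<Rightarrow> real \<Rightarrow> real \<Rightarrow> real \<Rightarrow> real \<Rightarrow> 4 \<Rightarrow> real^4^4"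
  where "conn a n A B U V q q1 p p1 c =
    (if c = 1 then vector [
      vector [0, - B + U + q1 / (2 * q), - (A * a) + V, 0],
      vector [- (B * q^2 * n^2) + U * q^2 * n^2 + q * q1 * n^2 / 2, 0, 0, B * a * q * p * n^2],
      vector [- (A * a * q * p * n^2) + V * q * p * n^2, 0, 0, A * q * p * n^2],
      vector [0, - (B * a), - (A * q / p), 0]]
     else if c = 2 then vector [
      vector [- B + U + q1 / (2 * q), 0, 0, B * a * p / q],
      vector [0, B + U - q1 / (2 * q), - (A * a) + V, 0],
      vector [0, A * a * p / q - V * p / q, B + U, 0],
      vector [B * a, 0, 0, - B + U]]
     else if c = 3 then vector [
      vector [A * a + V, 0, 0, - A],
      vector [0, - (A * a) + V, - (B * q / p) - U * q / p, 0],
      vector [0, B + U, - (A * a) + V - p1 / (2 * p), 0],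
      vector [- (A * q / p), 0, 0, A * a + V + p1 / (2 * p)]]
     else vector [
      vector [0, B * a * p / q, A, 0],
      vector [B * a * q * p * n^2, 0, 0, - (B * q * p * n^2) - U * q * p * n^2],
      vector [A * q * p * n^2, 0, 0, - (A * a * p^2 * n^2) - V * p^2 * n^2 - p * p1 * n^2 / 2],
      vector [0, B + U, A * a + V + p1 / (2 * p), 0]])"

definition conn_r :: "real \<Rightarrow> real \<Rightarrow> real \<Rightarrow> real \<Rightarrow> real \<Rightarrow> real \<Rightarrow> real \<Rightarrow> real \<Rightarrow> real \<Rightarrow> real \<Rightarrow> real \<Rightarrow> real \<Rightarrow> 4 \<Rightarrow> real^4^4"
  where "conn_r a n A B U V W q q1 q2 p p1 c =
    (if c = 1 then vector [
      vector [0, - (A^2) + B^2 + U^2 + q2 / (2 * q) - q1^2 / (2 * q^2), 2 * A * B * a + U * V + W, 0],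
      vector [- (A^2 * q^2 * n^2) + 5 * B^2 * q^2 * n^2 - 4 * B * U * q^2 * n^2 - 4 * B * q * q1 * n^2 + U^2 * q^2 * n^2 + 2 * U * q * q1 * n^2 + q * q2 * n^2 / 2 + q1^2 * n^2 / 2, 0, 0, A^2 * a * q * p * n^2 - 5 * B^2 * a * q * p * n^2 + B * a * q1 * p * n^2],
      vector [6 * A * B * a * q * p * n^2 - A * a * q1 * p * n^2 - 4 * B * V * q * p * n^2 + U * V * q * p * n^2 + V * q1 * p * n^2 + q * p * n^2 * W, 0, 0, - (6 * A * B * q * p * n^2) + A * q1 * p * n^2],
      vector [0, - (A^2 * a) + B^2 * a, 2 * A * B * q / p - A * q1 / p, 0]]
     else if c = 2 then vector [
      vector [- (A^2) + B^2 + U^2 + q2 / (2 * q) - q1^2 / (2 * q^2), 0, 0, A^2 * a * p / q - B^2 * a * p / q - B * a * q1 * p / q^2],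
      vector [0, A^2 - B^2 + U^2 - q2 / (2 * q) + q1^2 / (2 * q^2), 2 * A * B * a + U * V + W, 0],
      vector [0, - (2 * A * B * a * p / q) - A * a * q1 * p / q^2 - U * V * p / q + V * q1 * p / q^2 - p * W / q, A^2 - B^2 + U^2, 0],
      vector [A^2 * a - B^2 * a, 0, 0, - (A^2) + B^2 + U^2]]
     else if c = 3 then vector [
      vector [- (2 * A * B * a) + U * V + W, 0, 0, 2 * A * B],
      vector [0, 2 * A * B * a + U * V + W, - (A^2 * q / p) + B^2 * q / p - B * q1 / p - U^2 * q / p - U * q1 / p, 0],
      vector [0, A^2 - B^2 + U^2, 2 * A * B * a + U * V + W, 0],
      vector [2 * A * B * q / p - A * q1 / p, 0, 0, - (2 * A * B * a) + U * V + W]]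
     else vector [
      vector [0, A^2 * a * p / q - B^2 * a * p / q - B * a * q1 * p / q^2, - (2 * A * B), 0],
      vector [A^2 * a * q * p * n^2 - 5 * B^2 * a * q * p * n^2 + B * a * q1 * p * n^2, 0, 0, - (A^2 * q * p * n^2) + 5 * B^2 * q * p * n^2 + 4 * B * U * q * p * n^2 - B * q1 * p * n^2 - U^2 * q * p * n^2 - U * q1 * p * n^2],
      vector [- (6 * A * B * q * p * n^2) + A * q1 * p * n^2, 0, 0, 6 * A * B * a * p^2 * n^2 + 4 * B * V * p^2 * n^2 + 2 * B * p * p1 * n^2 - U * V * p^2 * n^2 - p^2 * n^2 * W],
      vector [0, A^2 - B^2 + U^2, - (2 * A * B * a) + U * V + W, 0]])"

definition conn_X :: "real \<Rightarrow> real \<Rightarrow> real \<Rightarrow> real \<Rightarrow> real \<Rightarrow> real \<Rightarrow> real \<Rightarrow> real \<Rightarrow> real \<Rightarrow> real \<Rightarrow> real \<Rightarrow> real \<Rightarrow> 4 \<Rightarrow> real^4^4"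
  where "conn_X a n A B U V W q q1 p p1 p2 c =
    (if c = 1 then vector [
      vector [0, - (2 * A * B * a) + U * V + W, - (A^2 * a^2) + B^2 * a^2 + V^2, 0],
      vector [- (6 * A * B * a * q^2 * n^2) + 4 * A * U * a * q^2 * n^2 + 2 * A * a * q * q1 * n^2 + U * V * q^2 * n^2 + q^2 * n^2 * W, 0, 0, 6 * A * B * a^2 * q * p * n^2 + B * a * q * p1 * n^2],
      vector [- (5 * A^2 * a^2 * q * p * n^2) + 4 * A * V * a * q * p * n^2 - A * a * q * p1 * n^2 + B^2 * a^2 * q * p * n^2 + V^2 * q * p * n^2 + V * q * p1 * n^2, 0, 0, 5 * A^2 * a * q * p * n^2 + A * q * p1 * n^2 - B^2 * a * q * p * n^2],
      vector [0, - (2 * A * B * a^2), - (A^2 * a * q / p) + A * q * p1 / p^2 + B^2 * a * q / p, 0]]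
     else if c = 2 then vector [
      vector [- (2 * A * B * a) + U * V + W, 0, 0, 2 * A * B * a^2 * p / q + B * a * p1 / q],
      vector [0, 2 * A * B * a + U * V + W, - (A^2 * a^2) + B^2 * a^2 + V^2, 0],
      vector [0, A^2 * a^2 * p / q + A * a * p1 / q - B^2 * a^2 * p / q - V^2 * p / q - V * p1 / q, 2 * A * B * a + U * V + W, 0],
      vector [2 * A * B * a^2, 0, 0, - (2 * A * B * a) + U * V + W]]
     else if c = 3 then vector [
      vector [A^2 * a^2 - B^2 * a^2 + V^2, 0, 0, - (A^2 * a) + B^2 * a],
      vector [0, - (A^2 * a^2) + B^2 * a^2 + V^2, - (2 * A * B * a * q / p) + B * q * p1 / p^2 - U * V * q / p + U * q * p1 / p^2 - q * W / p, 0],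
      vector [0, 2 * A * B * a + U * V + W, - (A^2 * a^2) + B^2 * a^2 + V^2 - p2 / (2 * p) + p1^2 / (2 * p^2), 0],
      vector [- (A^2 * a * q / p) + A * q * p1 / p^2 + B^2 * a * q / p, 0, 0, A^2 * a^2 - B^2 * a^2 + V^2 + p2 / (2 * p) - p1^2 / (2 * p^2)]]
     else vector [
      vector [0, 2 * A * B * a^2 * p / q + B * a * p1 / q, A^2 * a - B^2 * a, 0],
      vector [6 * A * B * a^2 * q * p * n^2 + B * a * q * p1 * n^2, 0, 0, - (6 * A * B * a * q * p * n^2) - 4 * A * U * a * q * p * n^2 - B * q * p1 * n^2 - U * V * q * p * n^2 - U * q * p1 * n^2 - q * p * n^2 * W],
      vector [5 * A^2 * a * q * p * n^2 + A * q * p1 * n^2 - B^2 * a * q * p * n^2, 0, 0, - (5 * A^2 * a^2 * p^2 * n^2) - 4 * A * V * a * p^2 * n^2 - 4 * A * a * p * p1 * n^2 + B^2 * a^2 * p^2 * n^2 - V^2 * p^2 * n^2 - 2 * V * p * p1 * n^2 - p * p2 * n^2 / 2 - p1^2 * n^2 / 2],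
      vector [0, 2 * A * B * a + U * V + W, A^2 * a^2 - B^2 * a^2 + V^2 + p2 / (2 * p) - p1^2 / (2 * p^2), 0]])"

text \<open>The components of \<open>de\<^sup>1\<close>; \<open>struct4\<close> gives those of
  \<open>de\<^sup>4\<close>, and dr, dX are closed. They follow from d\<phi> = (a
  \<open>e\<^sup>1\<close> - \<open>e\<^sup>4\<close>) / \<open>\<rho>\<^sup>2\<close>.\<close>

definition struct1 :: "real \<Rightarrow> real \<Rightarrow> 4 \<Rightarrow> 4 \<Rightarrow> real"
  where "struct1 a A c d =
    (if c = 1 \<and> d = 3 then 2 * a * A else if c = 3 \<and> d = 1 then - 2 * a * A
     else if c = 3 \<and> d = 4 then 2 * A else if c = 4 \<and> d = 3 then - 2 * A else 0)"

definition struct4 :: "real \<Rightarrow> real \<Rightarrow> 4 \<Rightarrow> 4 \<Rightarrow> real"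
  where "struct4 a B c d =
    (if c = 2 \<and> d = 1 then - 2 * a * B else if c = 1 \<and> d = 2 then 2 * a * B
     else if c = 2 \<and> d = 4 then 2 * B else if c = 4 \<and> d = 2 then - 2 * B else 0)"

text \<open>The last two terms come from \<open>de\<^sup>1\<close> and \<open>de\<^sup>4\<close>.\<close>

definition frame_curv :: "real \<Rightarrow> real \<Rightarrow> real \<Rightarrow> (4 \<Rightarrow> real^4^4) \<Rightarrow> (4 \<Rightarrow> 4 \<Rightarrow> real^4^4) \<Rightarrow> 4 \<Rightarrow> 4 \<Rightarrow> real^4^4"
  where "frame_curv a A B \<gamma> D c d = D c d - D d c + \<gamma> c ** \<gamma> d - \<gamma> d ** \<gamma> c
    + struct1 a A c d *\<^sub>R \<gamma> 1 + struct4 a B c d *\<^sub>R \<gamma> 4"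

text \<open>Here \<open>x\<close>, \<open>y\<close>, \<open>k\<close> stand for X /
  \<open>\<rho>\<^sup>2\<close>, r / \<open>\<rho>\<^sup>2\<close> and \<alpha>
  \<open>\<rho>\<^sup>2\<close> / \<Omega>. The quantities \<open>A\<close>, \<open>B\<close>,
  \<open>U\<close>, \<open>V\<close>, \<open>W\<close> of the connection are not independent; in
  these parameters relations such as \<open>U * y = V * x\<close> hold identically, so the curvature
  components reduce to field identities without side conditions. The values of \<open>q\<close>,
  \<open>p\<close> and their derivatives stay free.\<close>

locale frame_point =
  fixes a n x y k q q1 q2 p p1 p2 :: real
  assumes q: "q \<noteq> 0" and p: "p \<noteq> 0"
begin

abbreviation "A \<equiv> - (a * x)"
abbreviation "U \<equiv> k * x"
abbreviation "V \<equiv> k * y"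
abbreviation "W \<equiv> k * (y^2 + a^2 * x^2)"

definition "\<gamma> = conn a n A y U V q q1 p p1"
definition "D\<gamma> c d = (if c = 2 then conn_r a n A y U V W q q1 q2 p p1 d
  else if c = 3 then conn_X a n A y U V W q q1 p p1 p2 d else 0)"

abbreviation "K \<equiv> frame_curv a A y \<gamma> D\<gamma>"

definition "S = 4 * A * y * (a^2 * p - q) + A * q1 + a * y * p1"
definition "E12 = - (2 * A^2 * a^2 * p) + 2 * A^2 * q + 4 * A * V * a * p + 6 * y^2 * a^2 * p - 6 * y^2 * q
  + 4 * y * U * q + 4 * y * q1 - 2 * U^2 * q - 2 * U * q1 - 2 * V^2 * p - q2"
definition "E13 = 2 * A^2 * a^2 * p - 2 * A^2 * q + A * a * p1 - 2 * y^2 * a^2 * p + 2 * y^2 * q - y * q1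
  - 2 * U^2 * q - U * q1 - 2 * V^2 * p - V * p1"
definition "E34 = 6 * A^2 * a^2 * p - 6 * A^2 * q + 4 * A * V * a * p + 4 * A * a * p1 - 2 * y^2 * a^2 * p
  + 2 * y^2 * q + 4 * y * U * q + 2 * U^2 * q + 2 * V^2 * p + 2 * V * p1 + p2"

lemmas K_unfold = frame_curv_def \<gamma>_def D\<gamma>_def struct1_def struct4_def S_def E12_def E13_def E34_def

lemma K_12:
  "K 1 2 = vector [
    vector [0, E12 / (2 * q), 0, 0],
    vector [n^2 * q * E12 / 2, 0, 0, 0],
    vector [0, 0, 0, - (n^2 * p * S)],
    vector [0, 0, S / p, 0]]"
  using q p
  by (simp add: vec_eq_iff forall_4 matrix_matrix_mult_def sum_4 K_unfold conn_def conn_r_def conn_X_def;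
      simp add: field_simps power2_eq_square)

lemma K_13:
  "K 1 3 = vector [
    vector [0, 0, E13 / (2 * p), 0],
    vector [0, 0, 0, - (n^2 * q * S / 2)],
    vector [n^2 * q * E13 / 2, 0, 0, 0],
    vector [0, S / (2 * p), 0, 0]]"
  using q p
  by (simp add: vec_eq_iff forall_4 matrix_matrix_mult_def sum_4 K_unfold conn_def conn_r_def conn_X_def;
      simp add: field_simps power2_eq_square)

lemma K_14:
  "K 1 4 = vector [
    vector [0, 0, 0, n^2 * p * E13 / 2],
    vector [0, 0, n^2 * q * S / 2, 0],
    vector [0, - (n^2 * p * S / 2), 0, 0],
    vector [n^2 * q * E13 / 2, 0, 0, 0]]"
  using q p
  by (simp add: vec_eq_iff forall_4 matrix_matrix_mult_def sum_4 K_unfold conn_def conn_r_def conn_X_def;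
      simp add: field_simps power2_eq_square)

lemma K_23:
  "K 2 3 = vector [
    vector [0, 0, 0, - (S / (2 * q))],
    vector [0, 0, E13 / (2 * p), 0],
    vector [0, - (E13 / (2 * q)), 0, 0],
    vector [- (S / (2 * p)), 0, 0, 0]]"
  using q p
  by (simp add: vec_eq_iff forall_4 matrix_matrix_mult_def sum_4 K_unfold conn_def conn_r_def conn_X_def;
      simp add: field_simps power2_eq_square)

lemma K_24:
  "K 2 4 = vector [
    vector [0, 0, S / (2 * q), 0],
    vector [0, 0, 0, n^2 * p * E13 / 2],
    vector [n^2 * p * S / 2, 0, 0, 0],
    vector [0, - (E13 / (2 * q)), 0, 0]]"
  using q p
  by (simp add: vec_eq_iff forall_4 matrix_matrix_mult_def sum_4 K_unfold conn_def conn_r_def conn_X_def;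
      simp add: field_simps power2_eq_square)

lemma K_34:
  "K 3 4 = vector [
    vector [0, S / q, 0, 0],
    vector [n^2 * q * S, 0, 0, 0],
    vector [0, 0, 0, - (n^2 * p * E34 / 2)],
    vector [0, 0, E34 / (2 * p), 0]]"
  using q p
  by (simp add: vec_eq_iff forall_4 matrix_matrix_mult_def sum_4 K_unfold conn_def conn_r_def conn_X_def;
      simp add: field_simps power2_eq_square)

end

section \<open>The Levi-Civita symbol\<close>

lemma det_4:
  "det (M::'a::comm_ring_1^4^4) =
      M$1$1 * (M$2$2 * (M$3$3 * M$4$4 - M$3$4 * M$4$3) - M$2$3 * (M$3$2 * M$4$4 - M$3$4 * M$4$2)
        + M$2$4 * (M$3$2 * M$4$3 - M$3$3 * M$4$2))
    - M$1$2 * (M$2$1 * (M$3$3 * M$4$4 - M$3$4 * M$4$3) - M$2$3 * (M$3$1 * M$4$4 - M$3$4 * M$4$1)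
        + M$2$4 * (M$3$1 * M$4$3 - M$3$3 * M$4$1))
    + M$1$3 * (M$2$1 * (M$3$2 * M$4$4 - M$3$4 * M$4$2) - M$2$2 * (M$3$1 * M$4$4 - M$3$4 * M$4$1)
        + M$2$4 * (M$3$1 * M$4$2 - M$3$2 * M$4$1))
    - M$1$4 * (M$2$1 * (M$3$2 * M$4$3 - M$3$3 * M$4$2) - M$2$2 * (M$3$1 * M$4$3 - M$3$3 * M$4$1)
        + M$2$3 * (M$3$1 * M$4$2 - M$3$2 * M$4$1))"
proof -
  have f1234: "finite {2::4, 3, 4}" "1 \<notin> {2::4, 3, 4}"
    by auto
  have f234: "finite {3::4, 4}" "2 \<notin> {3::4, 4}"
    by auto
  have f34: "finite {4::4}" "3 \<notin> {4::4}"
    by auto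
  show ?thesis
    unfolding det_def UNIV_4
    unfolding sum_over_permutations_insert[OF f1234]
    unfolding sum_over_permutations_insert[OF f234]
    unfolding sum_over_permutations_insert[OF f34]
    unfolding permutes_sing
    by (simp add: sign_swap_id permutation_swap_id permutation_compose sign_compose sign_id swap_id_eq)
      (simp add: algebra_simps)
qed

definition select_rows :: "4 \<Rightarrow> 4 \<Rightarrow> 4 \<Rightarrow> 4 \<Rightarrow> real^4^4"
  where "select_rows \<kappa> \<beta> \<mu> \<nu> = vector [axis \<kappa> 1, axis \<beta> 1, axis \<mu> 1, axis \<nu> 1]"

text \<open>A permutation of the indices permutes the rows of the identity matrix, with determinant
  its sign; otherwise an index is repeated and two rows coincide.\<close>

lemma levi_civita_symbol_eq_det: "levi_civita_symbol \<kappa> \<beta> \<mu> \<nu> = det (select_rows \<kappa> \<beta> \<mu> \<nu>)"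
proof -
  define f where "f i = (vector [\<kappa>, \<beta>, \<mu>, \<nu>] :: 4^4) $ i" for i
  have sel: "select_rows \<kappa> \<beta> \<mu> \<nu> = (\<chi> i. (mat 1 :: real^4^4) $ f i)"
    by (auto simp: select_rows_def f_def vec_eq_iff forall_4[of "\<lambda>i. \<forall>j. _ i j"] axis_def mat_def)
  show ?thesis
  proof (cases "f permutes UNIV")
    case True
    then show ?thesis
      unfolding sel by (subst det_permute_rows) (simp_all add: levi_civita_symbol_def f_def[symmetric])
  next
    case False
    have "\<not> inj f"
    proof
      assume "inj f"
      then have "bij f"
        by (simp add: bij_def finite_UNIV_inj_surj)
      with False bij_imp_permutes[of f UNIV] show False
        by simp
    qed
    then obtain i j where "i \<noteq> j" "f i = f j"
      by (auto simp: inj_on_def)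
    then have "det (select_rows \<kappa> \<beta> \<mu> \<nu>) = 0"
      unfolding sel by (intro det_identical_rows[of i j]) (simp_all add: row_def)
    then show ?thesis
      using False by (simp add: levi_civita_symbol_def f_def[abs_def])
  qed
qed

lemma levi_civita_symbol_explicit:
  fixes \<kappa> \<beta> \<mu> \<nu> :: 4
  shows "levi_civita_symbol \<kappa> \<beta> \<mu> \<nu> = (
    if \<kappa> = 1 then (if \<beta> = 2 then (if \<mu> = 3 \<and> \<nu> = 4 then 1 else if \<mu> = 4 \<and> \<nu> = 3 then -1 else 0)
      else if \<beta> = 3 then (if \<mu> = 4 \<and> \<nu> = 2 then 1 else if \<mu> = 2 \<and> \<nu> = 4 then -1 else 0)
      else if \<beta> = 4 then (if \<mu> = 2 \<and> \<nu> = 3 then 1 else if \<mu> = 3 \<and> \<nu> = 2 then -1 else 0) else 0)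
    else if \<kappa> = 2 then (if \<beta> = 1 then (if \<mu> = 4 \<and> \<nu> = 3 then 1 else if \<mu> = 3 \<and> \<nu> = 4 then -1 else 0)
      else if \<beta> = 3 then (if \<mu> = 1 \<and> \<nu> = 4 then 1 else if \<mu> = 4 \<and> \<nu> = 1 then -1 else 0)
      else if \<beta> = 4 then (if \<mu> = 3 \<and> \<nu> = 1 then 1 else if \<mu> = 1 \<and> \<nu> = 3 then -1 else 0) else 0)
    else if \<kappa> = 3 then (if \<beta> = 1 then (if \<mu> = 2 \<and> \<nu> = 4 then 1 else if \<mu> = 4 \<and> \<nu> = 2 then -1 else 0)
      else if \<beta> = 2 then (if \<mu> = 4 \<and> \<nu> = 1 then 1 else if \<mu> = 1 \<and> \<nu> = 4 then -1 else 0)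
      else if \<beta> = 4 then (if \<mu> = 1 \<and> \<nu> = 2 then 1 else if \<mu> = 2 \<and> \<nu> = 1 then -1 else 0) else 0)
    else (if \<beta> = 1 then (if \<mu> = 3 \<and> \<nu> = 2 then 1 else if \<mu> = 2 \<and> \<nu> = 3 then -1 else 0)
      else if \<beta> = 2 then (if \<mu> = 1 \<and> \<nu> = 3 then 1 else if \<mu> = 3 \<and> \<nu> = 1 then -1 else 0)
      else if \<beta> = 3 then (if \<mu> = 2 \<and> \<nu> = 1 then 1 else if \<mu> = 1 \<and> \<nu> = 2 then -1 else 0) else 0))"
  using exhaust_4[of \<kappa>] exhaust_4[of \<beta>] exhaust_4[of \<mu>] exhaust_4[of \<nu>]
  by (elim disjE; simp add: levi_civita_symbol_eq_det det_4 select_rows_def axis_def)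

text \<open>By multilinearity the sum is the determinant of the matrix whose rows are four columns
  of \<open>M\<close>, and that matrix factors through \<open>select_rows\<close>. With
  \<open>M\<close> the coframe this is the transformation law of the volume form.\<close>

lemma sum_levi_civita_symbol:
  fixes M :: "real^4^4"
  shows "(\<Sum>a\<in>UNIV. \<Sum>b\<in>UNIV. \<Sum>c\<in>UNIV. \<Sum>d\<in>UNIV.
      M $ a $ \<kappa> * M $ b $ \<beta> * M $ c $ \<mu> * M $ d $ \<nu> * levi_civita_symbol a b c d)
    = det M * levi_civita_symbol \<kappa> \<beta> \<mu> \<nu>"
proof -
  have "(\<Sum>a\<in>UNIV. \<Sum>b\<in>UNIV. \<Sum>c\<in>UNIV. \<Sum>d\<in>UNIV. u a * v b * w c * z d * levi_civita_symbol a b c d)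
      = det (vector [vec_lambda u, vec_lambda v, vec_lambda w, vec_lambda z])" for u v w z :: "4 \<Rightarrow> real"
    by (simp add: sum_4 levi_civita_symbol_explicit det_4 algebra_simps)
  from this[of "\<lambda>a. M $ a $ \<kappa>" "\<lambda>a. M $ a $ \<beta>" "\<lambda>a. M $ a $ \<mu>" "\<lambda>a. M $ a $ \<nu>"]
  have "(\<Sum>a\<in>UNIV. \<Sum>b\<in>UNIV. \<Sum>c\<in>UNIV. \<Sum>d\<in>UNIV.
      M $ a $ \<kappa> * M $ b $ \<beta> * M $ c $ \<mu> * M $ d $ \<nu> * levi_civita_symbol a b c d)
    = det (vector [\<chi> a. M $ a $ \<kappa>, \<chi> a. M $ a $ \<beta>, \<chi> a. M $ a $ \<mu>, \<chi> a. M $ a $ \<nu>])" .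
  also have "vector [\<chi> a. M $ a $ \<kappa>, \<chi> a. M $ a $ \<beta>, \<chi> a. M $ a $ \<mu>, \<chi> a. M $ a $ \<nu>]
      = select_rows \<kappa> \<beta> \<mu> \<nu> ** transpose M"
    by (simp add: vec_eq_iff forall_4[of "\<lambda>i. \<forall>j. _ i j"] select_rows_def matrix_matrix_mult_def transpose_def axis_def
        if_distrib[of "\<lambda>z. z * _"] cong: if_cong)
  finally show ?thesis
    by (simp add: det_mul levi_civita_symbol_eq_det)
qed

section \<open>The Weyl tensor in the frame\<close>

text \<open>The metric coefficients in the frame, with \<open>w\<close> = 1 / \<Omega>. Passing from
  d\<theta> to dX absorbs the sine into \<open>p\<close>, and the product of the four entries is
  \<open>- (w^8)\<close>, free of \<open>n\<close>, \<open>q\<close> and \<open>p\<close>.\<close>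

definition frame_norm :: "real \<Rightarrow> real \<Rightarrow> real \<Rightarrow> real \<Rightarrow> 4 \<Rightarrow> real"
  where "frame_norm n w q p c = (if c = 1 then - (w^2 * n * q) else if c = 2 then w^2 / (n * q)
    else if c = 3 then w^2 / (n * p) else w^2 * n * p)"

text \<open>The eigenvalue pattern of type D. Every index has one partner in its own block and two
  in the other, so -2 + 1 + 1 = 0 makes the tensor below trace-free.\<close>

definition block_weight :: "4 \<Rightarrow> 4 \<Rightarrow> real"
  where "block_weight a b = (if a \<in> {1, 2} \<longleftrightarrow> b \<in> {1, 2} then - 2 else 1)"

text \<open>
  Weyl tensor of Petrov type D with \<open>\<Xi> + i Y\<close> the complex Weyl scalar \<open>\<Psi>\<^sub>2\<close> (up to sign conventions); \<open>w^4\<close> is the volume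
  density of the frame.
\<close>

definition type_D_weyl :: "(4 \<Rightarrow> real) \<Rightarrow> real \<Rightarrow> real \<Rightarrow> real \<Rightarrow> 4 \<Rightarrow> 4 \<Rightarrow> 4 \<Rightarrow> 4 \<Rightarrow> real"
  where "type_D_weyl h w \<Xi> Y a b c d = block_weight a b *
    (\<Xi> * h a * h b * (of_bool (a = c \<and> b = d) - of_bool (a = d \<and> b = c))
      - Y * w^4 * levi_civita_symbol a b c d)"

context frame_point
begin

lemma K_antisym: "K d c = - K c d"
proof -
  have "struct1 a A d c = - struct1 a A c d" "struct4 a y d c = - struct4 a y c d"
    by (auto simp: struct1_def struct4_def)
  then show ?thesis
    by (simp add: frame_curv_def)
qed

lemma K_self: "K c c = 0"
  by (auto simp: frame_curv_def struct1_def struct4_def)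

text \<open>The hypotheses prescribe curvature \<open>l - 2 * \<Xi>\<close> on the two block planes
  and \<open>l + \<Xi>\<close> on the mixed ones, that is, constant curvature \<open>l\<close> plus
  \<open>\<Xi>\<close> times the block weight; \<open>S\<close> supplies the \<open>Y\<close>
  part.\<close>

lemma frame_riemann:
  fixes w \<Xi> Y l :: real
  assumes w: "w \<noteq> 0" and n: "n \<noteq> 0"
    and S: "n * S = - 2 * Y * w^2"
    and E12: "n * E12 = 2 * w^2 * (l - 2 * \<Xi>)"
    and E13: "n * E13 = 2 * w^2 * (l + \<Xi>)"
    and E34: "n * E34 = - 2 * w^2 * (l - 2 * \<Xi>)"
  shows "frame_norm n w q p i * K c d $ i $ j = type_D_weyl (frame_norm n w q p) w \<Xi> Y i j c d
    + l * frame_norm n w q p i * frame_norm n w q p j * (of_bool (i = c \<and> j = d) - of_bool (i = d \<and> j = c))"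
proof -
  have e: "S = - 2 * Y * w^2 / n" "E12 = 2 * w^2 * (l - 2 * \<Xi>) / n"
    "E13 = 2 * w^2 * (l + \<Xi>) / n" "E34 = - 2 * w^2 * (l - 2 * \<Xi>) / n"
    using assms by (simp_all add: field_simps)
  have K21: "K 2 1 = - K 1 2" and K31: "K 3 1 = - K 1 3" and K41: "K 4 1 = - K 1 4"
    and K32: "K 3 2 = - K 2 3" and K42: "K 4 2 = - K 2 4" and K43: "K 4 3 = - K 3 4"
    by (rule K_antisym)+
  let ?P = "\<lambda>c d. \<forall>i j. frame_norm n w q p i * K c d $ i $ j = type_D_weyl (frame_norm n w q p) w \<Xi> Y i j c d
    + l * frame_norm n w q p i * frame_norm n w q p j * (of_bool (i = c \<and> j = d) - of_bool (i = d \<and> j = c))"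
  note defs = frame_norm_def type_D_weyl_def block_weight_def levi_civita_symbol_explicit
  have P11: "?P 1 1"
    unfolding forall_4 K_self by (simp add: defs)
  have P12: "?P 1 2"
    unfolding forall_4 K_12 e using n p q w
    by (simp add: defs) (simp add: field_simps power2_eq_square power4_eq_xxxx)?
  have P13: "?P 1 3"
    unfolding forall_4 K_13 e using n p q w
    by (simp add: defs) (simp add: field_simps power2_eq_square power4_eq_xxxx)?
  have P14: "?P 1 4"
    unfolding forall_4 K_14 e using n p q w
    by (simp add: defs) (simp add: field_simps power2_eq_square power4_eq_xxxx)?
  have P21: "?P 2 1"
    unfolding forall_4 K21 K_12 e using n p q w
    by (simp add: defs) (simp add: field_simps power2_eq_square power4_eq_xxxx)?
  have P22: "?P 2 2"
    unfolding forall_4 K_self by (simp add: defs)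
  have P23: "?P 2 3"
    unfolding forall_4 K_23 e using n p q w
    by (simp add: defs) (simp add: field_simps power2_eq_square power4_eq_xxxx)?
  have P24: "?P 2 4"
    unfolding forall_4 K_24 e using n p q w
    by (simp add: defs) (simp add: field_simps power2_eq_square power4_eq_xxxx)?
  have P31: "?P 3 1"
    unfolding forall_4 K31 K_13 e using n p q w
    by (simp add: defs) (simp add: field_simps power2_eq_square power4_eq_xxxx)?
  have P32: "?P 3 2"
    unfolding forall_4 K32 K_23 e using n p q w
    by (simp add: defs) (simp add: field_simps power2_eq_square power4_eq_xxxx)?
  have P33: "?P 3 3"
    unfolding forall_4 K_self by (simp add: defs)
  have P34: "?P 3 4"
    unfolding forall_4 K_34 e using n p q w
    by (simp add: defs) (simp add: field_simps power2_eq_square power4_eq_xxxx)?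
  have P41: "?P 4 1"
    unfolding forall_4 K41 K_14 e using n p q w
    by (simp add: defs) (simp add: field_simps power2_eq_square power4_eq_xxxx)?
  have P42: "?P 4 2"
    unfolding forall_4 K42 K_24 e using n p q w
    by (simp add: defs) (simp add: field_simps power2_eq_square power4_eq_xxxx)?
  have P43: "?P 4 3"
    unfolding forall_4 K43 K_34 e using n p q w
    by (simp add: defs) (simp add: field_simps power2_eq_square power4_eq_xxxx)?
  have P44: "?P 4 4"
    unfolding forall_4 K_self by (simp add: defs)
  have "?P c d"
    using exhaust_4[of c] exhaust_4[of d]
    by (elim disjE; simp only: P11 P12 P13 P14 P21 P22 P23 P24 P31 P32 P33 P34 P41 P42 P43 P44 simp_thms)
  then show ?thesis
    by blast
qed

end

section \<open>Derivatives of the connection\<close>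

lemma neq_4: "(2::4) \<noteq> 1" "(3::4) \<noteq> 1" "(4::4) \<noteq> 1" "(3::4) \<noteq> 2" "(4::4) \<noteq> 2" "(4::4) \<noteq> 3"
  by simp_all

text \<open>The hypotheses form a closed system: \<open>B\<close> + i \<open>A\<close> is 1 / (r + i
  a X), whose r-derivative is minus its square, \<open>n\<close> is its squared modulus, and
  \<open>U\<close>, \<open>V\<close> are minus the logarithmic derivatives of \<Omega> in r and X.
  In the X direction the chain rule adds a factor i a.\<close>

lemma conn_has_derivative_r:
  fixes n A B U V q q1 :: "real \<Rightarrow> real"
  assumes "(n has_real_derivative - 2 * B r * n r) (at r)"
    and "(A has_real_derivative - 2 * A r * B r) (at r)"
    and "(B has_real_derivative (A r)^2 - (B r)^2) (at r)"
    and "(U has_real_derivative (U r)^2) (at r)"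
    and "(V has_real_derivative U r * V r + W) (at r)"
    and "(q has_real_derivative q1 r) (at r)"
    and "(q1 has_real_derivative q2) (at r)"
    and "q r \<noteq> 0" and "p \<noteq> 0"
  shows "((\<lambda>r. conn a (n r) (A r) (B r) (U r) (V r) (q r) (q1 r) p p1 c $ i $ j) has_real_derivative
    conn_r a (n r) (A r) (B r) (U r) (V r) W (q r) (q1 r) q2 p p1 c $ i $ j) (at r)"
  by (insert exhaust_4[of c] exhaust_4[of i] exhaust_4[of j]; elim disjE;
      simp only: conn_def conn_r_def vector_4 neq_4 if_True if_False simp_thms;
      (rule DERIV_cong, (rule assms derivative_intros no_zero_divisors power_not_zero zero_neq_numeral[symmetric])+,
        use assms(8,9) in \<open>simp add: field_simps power2_eq_square\<close>))

lemma conn_has_derivative_X: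
  fixes n A B U V p p1 :: "real \<Rightarrow> real"
  assumes "(n has_real_derivative 2 * a * A X * n X) (at X)"
    and "(A has_real_derivative a * ((A X)^2 - (B X)^2)) (at X)"
    and "(B has_real_derivative 2 * a * A X * B X) (at X)"
    and "(U has_real_derivative U X * V X + W) (at X)"
    and "(V has_real_derivative (V X)^2) (at X)"
    and "(p has_real_derivative p1 X) (at X)"
    and "(p1 has_real_derivative p2) (at X)"
    and "p X \<noteq> 0" and "q \<noteq> 0"
  shows "((\<lambda>X. conn a (n X) (A X) (B X) (U X) (V X) q q1 (p X) (p1 X) c $ i $ j) has_real_derivative
    conn_X a (n X) (A X) (B X) (U X) (V X) W q q1 (p X) (p1 X) p2 c $ i $ j) (at X)"
  by (insert exhaust_4[of c] exhaust_4[of i] exhaust_4[of j]; elim disjE;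
      simp only: conn_def conn_X_def vector_4 neq_4 if_True if_False simp_thms;
      (rule DERIV_cong, (rule assms derivative_intros no_zero_divisors power_not_zero zero_neq_numeral[symmetric])+,
        use assms(8,9) in \<open>simp add: field_simps power2_eq_square\<close>))

section \<open>Scalar functions of the accelerating Kerr-(anti-)de Sitter metric\<close>

locale acc_kerr =
  fixes a \<Lambda> \<alpha> m :: real
begin

definition "n r X = 1 / (r^2 + a^2 * X^2)"
definition "w r X = 1 / (1 - \<alpha> * r * X)"
definition "A r X = - (a * (X * n r X))"
definition "B r X = r * n r X"
definition "U r X = \<alpha> * X * w r X"
definition "V r X = \<alpha> * r * w r X"
definition "W r X = \<alpha> * w r X"
definition "q r = Q_fun a \<Lambda> \<alpha> m r"
definition "q1 r = (2 * r - 2 * m) * (1 - \<alpha>^2 * r^2) - 2 * \<alpha>^2 * r * (a^2 - 2 * m * r + r^2)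
  - \<Lambda> / 3 * (2 * a^2 * r + 4 * r^3)"
definition "q2 r = 2 * (1 - \<alpha>^2 * r^2) - 4 * \<alpha>^2 * r * (2 * r - 2 * m) - 2 * \<alpha>^2 * (a^2 - 2 * m * r + r^2)
  - \<Lambda> / 3 * (2 * a^2 + 12 * r^2)"
definition "P X = 1 - 2 * \<alpha> * m * X + (\<alpha>^2 * a^2 + 1/3 * \<Lambda> * a^2) * X^2"
definition "P1 X = - 2 * \<alpha> * m + 2 * (\<alpha>^2 * a^2 + 1/3 * \<Lambda> * a^2) * X"
definition "p X = (1 - X^2) * P X"
definition "p1 X = (1 - X^2) * P1 X - 2 * X * P X"
definition "p2 X = (1 - X^2) * (2 * (\<alpha>^2 * a^2 + 1/3 * \<Lambda> * a^2)) - 4 * X * P1 X - 2 * P X"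

text \<open>\<open>\<Xi> + i Y = - m (1 - i \<alpha> a) (\<Omega> / (r + i a X))\<^sup>3\<close>\<close>

definition "\<Xi> r X = - m * (1 - \<alpha> * r * X)^3 * n r X ^ 3
  * (r^3 - 3 * a^2 * r * X^2 + \<alpha> * a * (a^3 * X^3 - 3 * a * r^2 * X))"
definition "Y r X = - m * (1 - \<alpha> * r * X)^3 * n r X ^ 3
  * (a^3 * X^3 - 3 * a * r^2 * X - \<alpha> * a * (r^3 - 3 * a^2 * r * X^2))"

text \<open>The field equations. The explicit polynomials \<open>Q_fun\<close> and \<open>P\<close>
  make the four curvature scalars those of an Einstein metric with \<open>l\<close> = \<Lambda> / 3
  and Weyl scalar \<open>\<Xi>\<close> + i \<open>Y\<close>.\<close>

lemma on_shell:
  assumes "r^2 + a^2 * X^2 \<noteq> 0" and "1 - \<alpha> * r * X \<noteq> 0"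
  shows "n r X * (4 * A r X * B r X * (a^2 * p X - q r) + A r X * q1 r + a * B r X * p1 X) = - 2 * Y r X * w r X ^ 2"
      (is ?S)
    and "n r X * (- (2 * A r X ^2 * a^2 * p X) + 2 * A r X^2 * q r + 4 * A r X * V r X * a * p X + 6 * B r X^2 * a^2 * p X
       - 6 * B r X^2 * q r + 4 * B r X * U r X * q r + 4 * B r X * q1 r - 2 * U r X^2 * q r - 2 * U r X * q1 r
       - 2 * V r X^2 * p X - q2 r) = 2 * w r X ^ 2 * (\<Lambda> / 3 - 2 * \<Xi> r X)" (is ?E12)
    and "n r X * (2 * A r X^2 * a^2 * p X - 2 * A r X^2 * q r + A r X * a * p1 X - 2 * B r X^2 * a^2 * p X + 2 * B r X^2 * q r
       - B r X * q1 r - 2 * U r X^2 * q r - U r X * q1 r - 2 * V r X^2 * p X - V r X * p1 X)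
      = 2 * w r X ^ 2 * (\<Lambda> / 3 + \<Xi> r X)" (is ?E13)
    and "n r X * (6 * A r X^2 * a^2 * p X - 6 * A r X^2 * q r + 4 * A r X * V r X * a * p X + 4 * A r X * a * p1 X
       - 2 * B r X^2 * a^2 * p X + 2 * B r X^2 * q r + 4 * B r X * U r X * q r + 2 * U r X^2 * q r + 2 * V r X^2 * p X
       + 2 * V r X * p1 X + p2 X) = - 2 * w r X ^ 2 * (\<Lambda> / 3 - 2 * \<Xi> r X)" (is ?E34)
proof -
  define D Om where D: "D = r^2 + a^2 * X^2" and Om: "Om = 1 - \<alpha> * r * X"
  have nz: "D \<noteq> 0" "Om \<noteq> 0"
    using assms by (simp_all add: D Om)
  note c = n_def w_def A_def B_def U_def V_def \<Xi>_def Y_def D[symmetric] Om[symmetric]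
  note f = q_def q1_def q2_def P_def P1_def p_def p1_def p2_def Q_fun_def D Om
  \<comment> \<open>Each equation is first proved with denominators cleared, as a polynomial
    identity in r and X; the fractional form then follows with \<open>D\<close>, \<open>Om\<close>
    and the values of \<open>q\<close>, \<open>p\<close> kept as atoms.\<close>
  have "4 * a * X * r * (q r - a^2 * p X) + D * (a * r * p1 X - a * X * q1 r)
      = 2 * m * Om * (a^3 * X^3 - 3 * a * r^2 * X - \<alpha> * a * (r^3 - 3 * a^2 * r * X^2))"
    unfolding f by algebra
  with nz show ?S
    unfolding c by (simp add: divide_simps power2_eq_square power3_eq_cube) algebra
  have "Om^2 * (2 * a^2 * X^2 * q r - 2 * a^4 * X^2 * p X + 6 * r^2 * a^2 * p X - 6 * r^2 * q r)
      + D * Om * (4 * r * \<alpha> * X * q r - 4 * a^2 * \<alpha> * X * r * p X) + 4 * D * Om^2 * r * q1 r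
      - 2 * \<alpha>^2 * D^2 * (X^2 * q r + r^2 * p X) - 2 * \<alpha> * X * D^2 * Om * q1 r - D^2 * Om^2 * q2 r
    = 4 * m * Om^3 * (r^3 - 3 * a^2 * r * X^2 + \<alpha> * a * (a^3 * X^3 - 3 * a * r^2 * X)) + 2 * \<Lambda> / 3 * D^3"
    unfolding f by algebra
  with nz show ?E12
    unfolding c by (simp add: divide_simps power2_eq_square power3_eq_cube) algebra
  have "Om^2 * (2 * a^4 * X^2 * p X - 2 * a^2 * X^2 * q r - 2 * r^2 * a^2 * p X + 2 * r^2 * q r)
      - D * Om^2 * (a^2 * X * p1 X + r * q1 r) - 2 * \<alpha>^2 * D^2 * (X^2 * q r + r^2 * p X)
      - \<alpha> * D^2 * Om * (X * q1 r + r * p1 X)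
    = 2 * \<Lambda> / 3 * D^3 - 2 * m * Om^3 * (r^3 - 3 * a^2 * r * X^2 + \<alpha> * a * (a^3 * X^3 - 3 * a * r^2 * X))"
    unfolding f by algebra
  with nz show ?E13
    unfolding c by (simp add: divide_simps power2_eq_square power3_eq_cube) algebra
  have "Om^2 * (6 * a^4 * X^2 * p X - 6 * a^2 * X^2 * q r - 2 * r^2 * a^2 * p X + 2 * r^2 * q r)
      + 4 * D * Om * r * \<alpha> * X * (q r - a^2 * p X) - 4 * a^2 * X * D * Om^2 * p1 X
      + 2 * \<alpha>^2 * D^2 * (X^2 * q r + r^2 * p X) + 2 * \<alpha> * r * D^2 * Om * p1 X + D^2 * Om^2 * p2 X
    = - (4 * m * Om^3 * (r^3 - 3 * a^2 * r * X^2 + \<alpha> * a * (a^3 * X^3 - 3 * a * r^2 * X)) + 2 * \<Lambda> / 3 * D^3)"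
    unfolding f by algebra
  with nz show ?E34
    unfolding c by (simp add: divide_simps power2_eq_square power3_eq_cube) algebra
qed

end

lemma has_pd_r_theta:
  assumes "((\<lambda>r. f r (y $ 3)) has_real_derivative fr) (at (y $ 2))"
    and "((\<lambda>\<theta>. f (y $ 2) \<theta>) has_real_derivative f\<theta>) (at (y $ 3))"
  shows "has_pd (\<lambda>y. f (y $ 2) (y $ 3)) (if \<mu> = 2 then fr else if \<mu> = 3 then f\<theta> else 0) \<mu> y"
proof -
  have c: "\<mu> = 1 \<or> \<mu> = 2 \<or> \<mu> = 3 \<or> \<mu> = 4"
    by (rule exhaust_4)
  have "((\<lambda>h. f (y $ 2 + h) (y $ 3)) has_real_derivative fr) (at 0)"
    using assms(1) DERIV_at_within_shift[of "\<lambda>r. f r (y $ 3)" fr "y $ 2" 0 UNIV] by (simp add: add.commute)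
  moreover have "((\<lambda>h. f (y $ 2) (y $ 3 + h)) has_real_derivative f\<theta>) (at 0)"
    using assms(2) DERIV_at_within_shift[of "f (y $ 2)" f\<theta> "y $ 3" 0 UNIV] by (simp add: add.commute)
  ultimately show ?thesis
    using c unfolding has_pd_def by (elim disjE) (simp_all add: axis_def)
qed

lemma has_pd_r_cos:
  assumes "((\<lambda>r. f r (cos (y $ 3))) has_real_derivative fr) (at (y $ 2))"
    and "((\<lambda>X. f (y $ 2) X) has_real_derivative fX) (at (cos (y $ 3)))"
  shows "has_pd (\<lambda>y. f (y $ 2) (cos (y $ 3))) (if \<mu> = 2 then fr else if \<mu> = 3 then - sin (y $ 3) * fX else 0) \<mu> y"
  using has_pd_r_theta[of "\<lambda>r \<theta>. f r (cos \<theta>)", OF assms(1) DERIV_chain2[OF assms(2) DERIV_cos], of \<mu>]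
  unfolding mult.commute[of fX] .

section \<open>Coframe, connection form and first structure equation on the chart\<close>

context acc_kerr
begin

lemma base_derivs:
  assumes "r^2 + a^2 * X^2 \<noteq> 0" and "1 - \<alpha> * r * X \<noteq> 0"
  shows "((\<lambda>r. n r X) has_real_derivative - 2 * B r X * n r X) (at r)"
    and "((\<lambda>r. A r X) has_real_derivative - 2 * A r X * B r X) (at r)"
    and "((\<lambda>r. B r X) has_real_derivative (A r X)^2 - (B r X)^2) (at r)"
    and "((\<lambda>r. w r X) has_real_derivative U r X * w r X) (at r)"
    and "((\<lambda>r. U r X) has_real_derivative (U r X)^2) (at r)"
    and "((\<lambda>r. V r X) has_real_derivative U r X * V r X + W r X) (at r)"
    and "(q has_real_derivative q1 r) (at r)"
    and "(q1 has_real_derivative q2 r) (at r)"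
    and "((\<lambda>X. n r X) has_real_derivative 2 * a * A r X * n r X) (at X)"
    and "((\<lambda>X. A r X) has_real_derivative a * ((A r X)^2 - (B r X)^2)) (at X)"
    and "((\<lambda>X. B r X) has_real_derivative 2 * a * A r X * B r X) (at X)"
    and "((\<lambda>X. w r X) has_real_derivative V r X * w r X) (at X)"
    and "((\<lambda>X. U r X) has_real_derivative U r X * V r X + W r X) (at X)"
    and "((\<lambda>X. V r X) has_real_derivative (V r X)^2) (at X)"
    and "(p has_real_derivative p1 X) (at X)"
    and "(p1 has_real_derivative p2 X) (at X)"
proof -
  have nz: "r^2 + a^2 * X^2 \<noteq> 0" "1 - \<alpha> * r * X \<noteq> 0"
    using assms by auto
  have nr: "((\<lambda>r. n r X) has_real_derivative - 2 * B r X * n r X) (at r)"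
    unfolding n_def B_def
    by (rule DERIV_cong, (rule derivative_intros nz)+, simp add: nz power2_eq_square[of a])
  have nX: "((\<lambda>X. n r X) has_real_derivative 2 * a * A r X * n r X) (at X)"
    unfolding n_def A_def
    by (rule DERIV_cong, (rule derivative_intros nz)+, simp add: nz power2_eq_square[of a])
  have n_eq: "n r X = (A r X)^2 + (B r X)^2"
    unfolding A_def B_def n_def using nz by (simp add: field_simps) algebra
  have wr: "((\<lambda>r. w r X) has_real_derivative U r X * w r X) (at r)"
    unfolding w_def U_def
    by (rule DERIV_cong, (rule derivative_intros nz)+, simp add: nz power2_eq_square[of a])
  have wX: "((\<lambda>X. w r X) has_real_derivative V r X * w r X) (at X)"
    unfolding w_def V_def
    by (rule DERIV_cong, (rule derivative_intros nz)+, simp add: nz power2_eq_square[of a])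
  show "((\<lambda>r. n r X) has_real_derivative - 2 * B r X * n r X) (at r)"
    and "((\<lambda>X. n r X) has_real_derivative 2 * a * A r X * n r X) (at X)"
    and "((\<lambda>r. w r X) has_real_derivative U r X * w r X) (at r)"
    and "((\<lambda>X. w r X) has_real_derivative V r X * w r X) (at X)"
    by (fact nr nX wr wX)+
  show "((\<lambda>r. A r X) has_real_derivative - 2 * A r X * B r X) (at r)"
    unfolding A_def by (rule derivative_eq_intros nr refl)+ (simp add: algebra_simps)
  show "((\<lambda>r. B r X) has_real_derivative (A r X)^2 - (B r X)^2) (at r)"
    unfolding B_def[abs_def]
    by (rule derivative_eq_intros nr refl)+ (use n_eq in \<open>simp add: B_def algebra_simps power2_eq_square\<close>)
  show "((\<lambda>r. U r X) has_real_derivative (U r X)^2) (at r)"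
    unfolding U_def[abs_def] by (rule derivative_eq_intros wr refl)+ (simp add: U_def power2_eq_square)
  show "((\<lambda>r. V r X) has_real_derivative U r X * V r X + W r X) (at r)"
    unfolding V_def[abs_def] W_def by (rule derivative_eq_intros wr refl)+ (simp add: algebra_simps)
  show "((\<lambda>X. A r X) has_real_derivative a * ((A r X)^2 - (B r X)^2)) (at X)"
    unfolding A_def[abs_def]
    by (rule derivative_eq_intros nX refl)+ (use n_eq[unfolded A_def] in \<open>simp only: A_def; algebra\<close>)
  show "((\<lambda>X. B r X) has_real_derivative 2 * a * A r X * B r X) (at X)"
    unfolding B_def by (rule derivative_eq_intros nX refl)+ (simp add: algebra_simps)
  show "((\<lambda>X. U r X) has_real_derivative U r X * V r X + W r X) (at X)"
    unfolding U_def[abs_def] W_def by (rule derivative_eq_intros wX refl)+ (simp add: algebra_simps)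
  show "((\<lambda>X. V r X) has_real_derivative (V r X)^2) (at X)"
    unfolding V_def[abs_def] by (rule derivative_eq_intros wX refl)+ (simp add: V_def power2_eq_square)
  show "(q has_real_derivative q1 r) (at r)"
    unfolding q_def Q_fun_def q1_def by (rule derivative_eq_intros refl)+ (simp add: field_simps power2_eq_square power3_eq_cube)
  show "(q1 has_real_derivative q2 r) (at r)"
    unfolding q1_def q2_def by (rule derivative_eq_intros refl)+ (simp add: field_simps power2_eq_square power3_eq_cube)
  show "(p has_real_derivative p1 X) (at X)"
    unfolding p_def P_def p1_def P1_def by (rule derivative_eq_intros refl)+ (simp add: field_simps power2_eq_square power3_eq_cube)
  show "(p1 has_real_derivative p2 X) (at X)"
    unfolding p1_def p2_def P_def P1_def by (rule derivative_eq_intros refl)+ (simp add: field_simps power2_eq_square power3_eq_cube)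
qed

text \<open>Inequations make the set open, as \<open>moving_frame\<close> requires, and leave the
  sign of \<open>Q\<close> free, so both sides of a horizon are covered.\<close>

definition dom :: "point set"
  where "dom = {y. 1 - \<alpha> * y $ 2 * cos (y $ 3) \<noteq> 0 \<and> (y $ 2)^2 + a^2 * (cos (y $ 3))^2 \<noteq> 0
    \<and> q (y $ 2) \<noteq> 0 \<and> P (cos (y $ 3)) \<noteq> 0 \<and> sin (y $ 3) \<noteq> 0}"

definition E :: "point \<Rightarrow> real^4^4"
  where "E y = vector [vector [1, 0, 0, - a * (sin (y $ 3))^2], vector [0, 1, 0, 0],
    vector [0, 0, - sin (y $ 3), 0], vector [a, 0, 0, - ((y $ 2)^2 + a^2)]]"

definition F :: "point \<Rightarrow> real^4^4"
  where "F y = (let s = sin (y $ 3); N = n (y $ 2) (cos (y $ 3)) in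
    vector [vector [1 + a^2 * s^2 * N, 0, 0, - a * s^2 * N], vector [0, 1, 0, 0],
      vector [0, 0, - 1 / s, 0], vector [a * N, 0, 0, - N]])"

definition h :: "4 \<Rightarrow> point \<Rightarrow> real"
  where "h c y = frame_norm (n (y $ 2) (cos (y $ 3))) (w (y $ 2) (cos (y $ 3))) (q (y $ 2)) (p (cos (y $ 3))) c"

definition dE :: "4 \<Rightarrow> point \<Rightarrow> real^4^4"
  where "dE \<mu> y = (if \<mu> = 2 then vector [0, 0, 0, vector [0, 0, 0, - 2 * y $ 2]]
    else if \<mu> = 3 then vector [vector [0, 0, 0, - 2 * a * sin (y $ 3) * cos (y $ 3)], 0,
      vector [0, 0, - cos (y $ 3), 0], 0] else 0)"

definition ddE :: "4 \<Rightarrow> 4 \<Rightarrow> point \<Rightarrow> real^4^4"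
  where "ddE \<mu> \<nu> y = (if \<mu> = 2 \<and> \<nu> = 2 then vector [0, 0, 0, vector [0, 0, 0, - 2]]
    else if \<mu> = 3 \<and> \<nu> = 3 then vector [vector [0, 0, 0, - 2 * a * ((cos (y $ 3))^2 - (sin (y $ 3))^2)], 0,
      vector [0, 0, sin (y $ 3), 0], 0] else 0)"

definition conn_at :: "real \<Rightarrow> real \<Rightarrow> 4 \<Rightarrow> real^4^4"
  where "conn_at r X = conn a (n r X) (A r X) (B r X) (U r X) (V r X) (q r) (q1 r) (p X) (p1 X)"

definition conn_r_at :: "real \<Rightarrow> real \<Rightarrow> 4 \<Rightarrow> real^4^4"
  where "conn_r_at r X = conn_r a (n r X) (A r X) (B r X) (U r X) (V r X) (W r X) (q r) (q1 r) (q2 r) (p X) (p1 X)"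

definition conn_X_at :: "real \<Rightarrow> real \<Rightarrow> 4 \<Rightarrow> real^4^4"
  where "conn_X_at r X = conn_X a (n r X) (A r X) (B r X) (U r X) (V r X) (W r X) (q r) (q1 r) (p X) (p1 X) (p2 X)"

definition \<omega> :: "4 \<Rightarrow> point \<Rightarrow> real^4^4"
  where "\<omega> \<mu> y = (\<Sum>c\<in>UNIV. E y $ c $ \<mu> *\<^sub>R conn_at (y $ 2) (cos (y $ 3)) c)"

definition d\<omega> :: "4 \<Rightarrow> 4 \<Rightarrow> point \<Rightarrow> real^4^4"
  where "d\<omega> \<mu> \<nu> y = (\<Sum>c\<in>UNIV. dE \<mu> y $ c $ \<nu> *\<^sub>R conn_at (y $ 2) (cos (y $ 3)) c
    + E y $ c $ \<nu> *\<^sub>R (if \<mu> = 2 then conn_r_at (y $ 2) (cos (y $ 3)) c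
        else if \<mu> = 3 then - sin (y $ 3) *\<^sub>R conn_X_at (y $ 2) (cos (y $ 3)) c else 0))"

lemma domD:
  assumes "y \<in> dom"
  shows "1 - \<alpha> * y $ 2 * cos (y $ 3) \<noteq> 0" "(y $ 2)^2 + a^2 * (cos (y $ 3))^2 \<noteq> 0"
    "q (y $ 2) \<noteq> 0" "P (cos (y $ 3)) \<noteq> 0" "sin (y $ 3) \<noteq> 0" "p (cos (y $ 3)) \<noteq> 0"
    "n (y $ 2) (cos (y $ 3)) \<noteq> 0" "w (y $ 2) (cos (y $ 3)) \<noteq> 0"
    "n (y $ 2) (cos (y $ 3)) * ((y $ 2)^2 + a^2 * (cos (y $ 3))^2) = 1"
    "p (cos (y $ 3)) = (sin (y $ 3))^2 * P (cos (y $ 3))"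
  using assms by (auto simp: dom_def p_def n_def w_def sin_squared_eq[symmetric])

lemma open_dom: "open dom"
  unfolding dom_def q_def Q_fun_def P_def
  by (intro open_Collect_conj open_Collect_neq continuous_intros)

lemma has_pd_E: "has_pd (\<lambda>y. E y $ c $ \<nu>) (dE \<mu> y $ c $ \<nu>) \<mu> y"
proof -
  have "has_pd (\<lambda>y. - (a * (sin (y $ 3))^2)) (if \<mu> = 2 then 0 else if \<mu> = 3 then - (2 * a * sin (y $ 3) * cos (y $ 3)) else 0) \<mu> y"
    by (rule has_pd_r_theta) (auto intro!: derivative_eq_intros)
  moreover have "has_pd (\<lambda>y. - sin (y $ 3)) (if \<mu> = 2 then 0 else if \<mu> = 3 then - cos (y $ 3) else 0) \<mu> y"
    by (rule has_pd_r_theta) (auto intro!: derivative_eq_intros)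
  moreover have "has_pd (\<lambda>y. - ((y $ 2)^2) - a^2) (if \<mu> = 2 then - (2 * y $ 2) else if \<mu> = 3 then 0 else 0) \<mu> y"
    by (rule has_pd_r_theta) (auto intro!: derivative_eq_intros)
  ultimately have "\<forall>c \<nu>. has_pd (\<lambda>y. E y $ c $ \<nu>) (dE \<mu> y $ c $ \<nu>) \<mu> y"
    unfolding forall_4 E_def dE_def
    by (cases "\<mu> = 2"; cases "\<mu> = 3"; simp add: has_pd_const)
  then show ?thesis by blast
qed

lemma has_pd_dE: "has_pd (\<lambda>y. dE \<nu> y $ c $ \<kappa>) (ddE \<mu> \<nu> y $ c $ \<kappa>) \<mu> y"
proof -
  have "has_pd (\<lambda>y. - (2 * a * sin (y $ 3) * cos (y $ 3)))
      (if \<mu> = 2 then 0 else if \<mu> = 3 then - (2 * a * ((cos (y $ 3))^2 - (sin (y $ 3))^2)) else 0) \<mu> y"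
    by (rule has_pd_r_theta) (auto intro!: derivative_eq_intros simp: algebra_simps power2_eq_square)
  moreover have "has_pd (\<lambda>y. - cos (y $ 3)) (if \<mu> = 2 then 0 else if \<mu> = 3 then sin (y $ 3) else 0) \<mu> y"
    by (rule has_pd_r_theta) (auto intro!: derivative_eq_intros)
  moreover have "has_pd (\<lambda>y. - (2 * y $ 2)) (if \<mu> = 2 then - 2 else if \<mu> = 3 then 0 else 0) \<mu> y"
    by (rule has_pd_r_theta) (auto intro!: derivative_eq_intros)
  ultimately have "\<forall>\<nu> c \<kappa>. has_pd (\<lambda>y. dE \<nu> y $ c $ \<kappa>) (ddE \<mu> \<nu> y $ c $ \<kappa>) \<mu> y"
    unfolding forall_4 ddE_def dE_def
    by (cases "\<mu> = 2"; cases "\<mu> = 3"; simp add: has_pd_const)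
  then show ?thesis by blast
qed

lemma differentiable_F:
  assumes "y \<in> dom"
  shows "\<exists>D. has_pd (\<lambda>y. F y $ \<kappa> $ c) D \<mu> y"
proof -
  note nz = domD[OF assms]
  note d = base_derivs(1,9)[OF nz(2,1)]
  have n: "has_pd (\<lambda>y. n (y $ 2) (cos (y $ 3))) (if \<mu> = 2 then - 2 * B (y $ 2) (cos (y $ 3)) * n (y $ 2) (cos (y $ 3))
      else if \<mu> = 3 then - sin (y $ 3) * (2 * a * A (y $ 2) (cos (y $ 3)) * n (y $ 2) (cos (y $ 3))) else 0) \<mu> y" (is "has_pd _ ?n' _ _")
    by (rule has_pd_r_cos) (rule d)+
  have s: "has_pd (\<lambda>y. (sin (y $ 3))^2) (if \<mu> = 2 then 0 else if \<mu> = 3 then 2 * sin (y $ 3) * cos (y $ 3) else 0) \<mu> y"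
    (is "has_pd _ ?s' _ _")
    by (rule has_pd_r_theta) (auto intro!: derivative_eq_intros)
  have i: "has_pd (\<lambda>y. - 1 / sin (y $ 3)) (if \<mu> = 2 then 0 else if \<mu> = 3 then cos (y $ 3) / (sin (y $ 3))^2 else 0) \<mu> y"
    (is "has_pd _ ?i' _ _")
    by (rule has_pd_r_theta) (use nz in \<open>auto intro!: derivative_eq_intros simp: power2_eq_square\<close>)
  note sn = has_pd_mult[OF s n]
  have "\<forall>\<kappa> c. \<exists>D. has_pd (\<lambda>y. F y $ \<kappa> $ c) D \<mu> y"
    unfolding forall_4 F_def Let_def vector_4 mult.assoc
    by (intro conjI; rule exI; (rule has_pd_const i has_pd_mult[OF has_pd_const sn] has_pd_mult[OF has_pd_const n]
      has_pd_add[OF has_pd_const has_pd_mult[OF has_pd_const sn]] has_pd_mult[OF has_pd_const[of "-1"] n, simplified]))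
  then show ?thesis by blast
qed

lemma F_mult_E:
  assumes "y \<in> dom"
  shows "F y ** E y = mat 1"
proof -
  define s X N where "s = sin (y $ 3)" and "X = cos (y $ 3)" and "N = n (y $ 2) (cos (y $ 3))"
  have "s \<noteq> 0" "N * ((y $ 2)^2 + a^2 * X^2) = 1" "X^2 = 1 - s^2"
    using domD[OF assms] by (auto simp: s_def X_def N_def cos_squared_eq)
  then have "N * ((y $ 2)^2 + a^2 - a^2 * s^2) = 1" "s \<noteq> 0"
    by (auto simp: algebra_simps)
  then show ?thesis
    unfolding F_def Let_def E_def s_def[symmetric] N_def[symmetric]
    by (simp add: vec_eq_iff forall_4 matrix_matrix_mult_def sum_4 mat_def; algebra)
qed

lemma metric_frame:
  assumes "y \<in> dom"
  shows "acc_kerr_ds a \<Lambda> \<alpha> m y $ \<mu> $ \<nu> = (\<Sum>c\<in>UNIV. h c y * E y $ c $ \<mu> * E y $ c $ \<nu>)"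
proof -
  define s X Om D where "s = sin (y $ 3)" and "X = cos (y $ 3)" and "Om = conf_factor \<alpha> (y $ 2) (y $ 3)"
    and "D = rho_sq a (y $ 2) (y $ 3)"
  have n: "n (y $ 2) X = 1 / D" and w: "w (y $ 2) X = 1 / Om" and P: "P_fun a \<Lambda> \<alpha> m (y $ 3) = P X"
    and q: "Q_fun a \<Lambda> \<alpha> m (y $ 2) = q (y $ 2)" and p: "p X = s^2 * P X"
    by (simp_all add: n_def w_def P_def q_def X_def D_def Om_def rho_sq_def conf_factor_def P_fun_def p_def s_def
      sin_squared_eq)
  have nz: "s \<noteq> 0" "Om \<noteq> 0" "D \<noteq> 0" "q (y $ 2) \<noteq> 0" "P X \<noteq> 0"
    using assms by (auto simp: dom_def s_def X_def Om_def D_def rho_sq_def conf_factor_def)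
  have "\<forall>\<mu> \<nu>. acc_kerr_ds a \<Lambda> \<alpha> m y $ \<mu> $ \<nu> = (\<Sum>c\<in>UNIV. h c y * E y $ c $ \<mu> * E y $ c $ \<nu>)"
    unfolding forall_4 sum_4 acc_kerr_ds_def Let_def h_def frame_norm_def E_def s_def[symmetric] X_def[symmetric]
      Om_def[symmetric] D_def[symmetric] n w p P q
    using nz by (simp add: axis_def) (simp add: field_simps power2_eq_square)
  then show ?thesis
    by blast
qed

lemma has_pd_conn:
  assumes "y \<in> dom"
  shows "has_pd (\<lambda>y. conn_at (y $ 2) (cos (y $ 3)) c $ i $ j)
    ((if \<mu> = 2 then conn_r_at (y $ 2) (cos (y $ 3)) c
        else if \<mu> = 3 then - sin (y $ 3) *\<^sub>R conn_X_at (y $ 2) (cos (y $ 3)) c else 0) $ i $ j) \<mu> y"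
proof -
  note nz = domD[OF assms]
  note d = base_derivs[OF nz(2,1)]
  have "has_pd (\<lambda>y. conn_at (y $ 2) (cos (y $ 3)) c $ i $ j)
    (if \<mu> = 2 then conn_r_at (y $ 2) (cos (y $ 3)) c $ i $ j
     else if \<mu> = 3 then - sin (y $ 3) * conn_X_at (y $ 2) (cos (y $ 3)) c $ i $ j else 0) \<mu> y"
    unfolding conn_at_def conn_r_at_def conn_X_at_def
    by (rule has_pd_r_cos, rule conn_has_derivative_r, (rule d nz)+, rule conn_has_derivative_X, (rule d nz)+)
  then show ?thesis
    by (auto split: if_splits)
qed

lemma has_pd_\<omega>:
  assumes "y \<in> dom"
  shows "has_pd (\<lambda>y. \<omega> \<nu> y $ i $ j) (d\<omega> \<mu> \<nu> y $ i $ j) \<mu> y"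
  unfolding \<omega>_def d\<omega>_def sum_component vector_scaleR_component vector_add_component real_scaleR_def
  by (intro has_pd_sum has_pd_mult has_pd_E has_pd_conn[OF assms])

lemma \<omega>_component: "\<omega> \<mu> y $ i $ j = (\<Sum>c\<in>UNIV. E y $ c $ \<mu> * conn_at (y $ 2) (cos (y $ 3)) c $ i $ j)"
  unfolding \<omega>_def sum_component vector_scaleR_component real_scaleR_def ..

lemma has_pd_h:
  assumes "y \<in> dom"
  shows "has_pd (h c) (2 * h c y * \<omega> \<mu> y $ c $ c) \<mu> y"
proof -
  note nz = domD[OF assms]
  note d = base_derivs[OF nz(2,1)]
  let ?r = "y $ 2" and ?X = "cos (y $ 3)"
  have r: "((\<lambda>r. frame_norm (n r ?X) (w r ?X) (q r) (p ?X) c) has_real_derivative 2 * h c y * conn_at ?r ?X 2 $ c $ c) (at ?r)"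
    unfolding h_def frame_norm_def conn_at_def conn_def
    by (insert exhaust_4[of c]; elim disjE; simp only: vector_4 neq_4 if_True if_False simp_thms;
      (rule DERIV_cong, (rule d nz derivative_intros no_zero_divisors power_not_zero)+,
        use nz in \<open>simp add: field_simps power2_eq_square\<close>))
  have X: "((\<lambda>X. frame_norm (n ?r X) (w ?r X) (q ?r) (p X) c) has_real_derivative 2 * h c y * conn_at ?r ?X 3 $ c $ c) (at ?X)"
    unfolding h_def frame_norm_def conn_at_def conn_def
    by (insert exhaust_4[of c]; elim disjE; simp only: vector_4 neq_4 if_True if_False simp_thms;
      (rule DERIV_cong, (rule d nz derivative_intros no_zero_divisors power_not_zero)+,
        use nz in \<open>simp add: field_simps power2_eq_square\<close>))
  have "(if \<mu> = 2 then 2 * h c y * conn_at ?r ?X 2 $ c $ c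
      else if \<mu> = 3 then - sin (y $ 3) * (2 * h c y * conn_at ?r ?X 3 $ c $ c) else 0) = 2 * h c y * \<omega> \<mu> y $ c $ c"
    by (insert exhaust_4[of c] exhaust_4[of \<mu>]; elim disjE; simp add: \<omega>_component sum_4 E_def conn_at_def conn_def)
  with has_pd_r_cos[OF r X, of \<mu>] show ?thesis
    unfolding h_def[abs_def] by simp
qed

lemma conn_skew:
  assumes "y \<in> dom" and "i \<noteq> j"
  shows "h i y * conn_at (y $ 2) (cos (y $ 3)) c $ i $ j + h j y * conn_at (y $ 2) (cos (y $ 3)) c $ j $ i = 0"
proof -
  note nz = domD[OF assms(1)]
  show ?thesis
    unfolding h_def frame_norm_def conn_at_def conn_def
    by (insert assms(2) exhaust_4[of c] exhaust_4[of i] exhaust_4[of j]; elim disjE;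
      simp only: vector_4 neq_4 if_True if_False simp_thms;
      (use nz in \<open>simp add: field_simps power2_eq_square\<close>))
qed

lemma \<omega>_skew:
  assumes "y \<in> dom" and "i \<noteq> j"
  shows "h i y * \<omega> \<mu> y $ i $ j + h j y * \<omega> \<mu> y $ j $ i = 0"
proof -
  have "h i y * \<omega> \<mu> y $ i $ j + h j y * \<omega> \<mu> y $ j $ i
    = (\<Sum>c\<in>UNIV. E y $ c $ \<mu> * (h i y * conn_at (y $ 2) (cos (y $ 3)) c $ i $ j
        + h j y * conn_at (y $ 2) (cos (y $ 3)) c $ j $ i))"
    unfolding \<omega>_component sum_distrib_left sum.distrib[symmetric] by (simp add: algebra_simps)
  then show ?thesis
    by (simp add: conn_skew[OF assms])
qed

definition struct :: "point \<Rightarrow> 4 \<Rightarrow> 4 \<Rightarrow> 4 \<Rightarrow> real"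
  where "struct y i b c = (if i = 1 then struct1 a (A (y $ 2) (cos (y $ 3))) b c
    else if i = 4 then struct4 a (B (y $ 2) (cos (y $ 3))) b c else 0)"

text \<open>Vanishing torsion in a frame that is not closed: the antisymmetric part of the
  connection coefficients equals the structure coefficients, while \<open>U\<close>,
  \<open>V\<close> and the logarithmic derivatives of \<open>q\<close>, \<open>p\<close>
  cancel.\<close>

lemma conn_torsion:
  "conn_at (y $ 2) (cos (y $ 3)) c $ i $ b - conn_at (y $ 2) (cos (y $ 3)) b $ i $ c = struct y i b c"
  unfolding conn_at_def conn_def struct_def struct1_def struct4_def
  by (insert exhaust_4[of c] exhaust_4[of i] exhaust_4[of b]; elim disjE;
      simp only: vector_4 neq_4 neq_4[symmetric] if_True if_False simp_thms; simp)

lemma structure_equation: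
  assumes "y \<in> dom"
  shows "dE \<mu> y $ i $ \<nu> - dE \<nu> y $ i $ \<mu> = (\<Sum>b\<in>UNIV. \<Sum>c\<in>UNIV. E y $ b $ \<mu> * E y $ c $ \<nu> * struct y i b c)"
proof -
  define s X N r where "s = sin (y $ 3)" and "X = cos (y $ 3)" and "N = n (y $ 2) X" and "r = y $ 2"
  have A: "A r X = - (a * (X * N))" and B: "B r X = r * N"
    by (simp_all add: A_def B_def N_def r_def)
  have "N * (r^2 + a^2 * X^2) = 1" "X^2 = 1 - s^2"
    using domD[OF assms] by (auto simp: s_def X_def N_def r_def cos_squared_eq)
  then have e: "N * (r^2 + a^2 - a^2 * s^2) = 1"
    by (auto simp: algebra_simps)
  have "\<forall>i \<mu> \<nu>. dE \<mu> y $ i $ \<nu> - dE \<nu> y $ i $ \<mu>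
      = (\<Sum>b\<in>UNIV. \<Sum>c\<in>UNIV. E y $ b $ \<mu> * E y $ c $ \<nu> * struct y i b c)"
    unfolding forall_4 sum_4 dE_def E_def struct_def struct1_def struct4_def s_def[symmetric] X_def[symmetric]
      r_def[symmetric] A B
    by (simp; use e in algebra)
  then show ?thesis
    by blast
qed

lemma \<omega>_torsion:
  assumes "y \<in> dom"
  shows "(dE \<mu> y + \<omega> \<mu> y ** E y) $ i $ \<nu> = (dE \<nu> y + \<omega> \<nu> y ** E y) $ i $ \<mu>"
proof -
  let ?\<gamma> = "\<lambda>c. conn_at (y $ 2) (cos (y $ 3)) c"
  have "(\<omega> \<mu> y ** E y) $ i $ \<nu> = (\<Sum>b\<in>UNIV. \<Sum>c\<in>UNIV. E y $ c $ \<mu> * E y $ b $ \<nu> * ?\<gamma> c $ i $ b)" for \<mu> \<nu>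
    by (simp add: matrix_matrix_mult_def \<omega>_component sum_distrib_left sum_distrib_right mult_ac)
  then have "(\<omega> \<mu> y ** E y) $ i $ \<nu> - (\<omega> \<nu> y ** E y) $ i $ \<mu>
    = (\<Sum>b\<in>UNIV. \<Sum>c\<in>UNIV. E y $ c $ \<mu> * E y $ b $ \<nu> * ?\<gamma> c $ i $ b)
      - (\<Sum>c\<in>UNIV. \<Sum>b\<in>UNIV. E y $ b $ \<nu> * E y $ c $ \<mu> * ?\<gamma> b $ i $ c)"
    by simp
  also have "\<dots> = (\<Sum>b\<in>UNIV. \<Sum>c\<in>UNIV. E y $ c $ \<mu> * E y $ b $ \<nu> * (?\<gamma> c $ i $ b - ?\<gamma> b $ i $ c))"
    by (subst (2) sum.swap) (simp add: sum_subtractf[symmetric] algebra_simps)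
  also have "\<dots> = (\<Sum>b\<in>UNIV. \<Sum>c\<in>UNIV. E y $ b $ \<nu> * E y $ c $ \<mu> * struct y i b c)"
    by (simp add: conn_torsion mult_ac)
  also have "\<dots> = dE \<nu> y $ i $ \<mu> - dE \<mu> y $ i $ \<nu>"
    by (rule structure_equation[OF assms, symmetric])
  finally show ?thesis
    by simp
qed

sublocale moving_frame "acc_kerr_ds a \<Lambda> \<alpha> m" dom E F h dE \<omega> ddE d\<omega>
proof
  show "h c y \<noteq> 0" if "y \<in> dom" for c y
    using domD[OF that] by (simp add: h_def frame_norm_def)
  show "ddE \<mu> \<nu> y = ddE \<nu> \<mu> y" for \<mu> \<nu> y
    by (auto simp: ddE_def)
qed (rule open_dom has_pd_E has_pd_dE
  | (rule metric_frame F_mult_E differentiable_F has_pd_\<omega> has_pd_h \<omega>_skew \<omega>_torsion; assumption))+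

end

section \<open>Tensors given by their frame components\<close>

text \<open>Turns one frame index into a coordinate index; nesting treats tensors of any rank. Sums
  over coordinate indices are pushed inwards by linearity instead of being expanded.\<close>

definition tr :: "(4 \<Rightarrow> 4 \<Rightarrow> real) \<Rightarrow> (4 \<Rightarrow> real) \<Rightarrow> 4 \<Rightarrow> real"
  where "tr M f \<kappa> = (\<Sum>i\<in>UNIV. M i \<kappa> * f i)"

lemma sum_mult_tr: "(\<Sum>\<beta>\<in>S. c \<beta> * tr M (f \<beta>) \<kappa>) = tr M (\<lambda>i. \<Sum>\<beta>\<in>S. c \<beta> * f \<beta> i) \<kappa>"
  unfolding tr_def sum_distrib_left by (subst sum.swap) (simp add: mult_ac)

lemma sum_tr_mult: "(\<Sum>\<beta>\<in>S. tr M (f \<beta>) \<kappa> * c \<beta>) = tr M (\<lambda>i. \<Sum>\<beta>\<in>S. f \<beta> i * c \<beta>) \<kappa>"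
  unfolding tr_def sum_distrib_left sum_distrib_right by (subst sum.swap) (simp add: mult_ac)

lemma sum_tr: "(\<Sum>\<beta>\<in>S. tr M (f \<beta>) \<kappa>) = tr M (\<lambda>i. \<Sum>\<beta>\<in>S. f \<beta> i) \<kappa>"
  using sum_mult_tr[of "\<lambda>_. 1" M f \<kappa> S] by simp

lemma tr_diff: "tr M (\<lambda>i. f i - f' i) \<kappa> = tr M f \<kappa> - tr M f' \<kappa>"
  unfolding tr_def by (simp add: right_diff_distrib sum_subtractf)

lemma tr_add: "tr M (\<lambda>i. f i + f' i) \<kappa> = tr M f \<kappa> + tr M f' \<kappa>"
  unfolding tr_def by (simp add: distrib_left sum.distrib)

lemma tr_mult: "tr M (\<lambda>i. c * f i) \<kappa> = c * tr M f \<kappa>"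
  unfolding tr_def sum_distrib_left by (simp add: mult_ac)

lemma tr_delta: "tr M (\<lambda>c. k * of_bool (j = c)) \<kappa> = M j \<kappa> * k"
  unfolding tr_def by (simp add: of_bool_def if_distrib cong: if_cong)

lemma tr_delta_conj:
  "tr M (\<lambda>c. k * of_bool (Q \<and> j = c)) \<kappa> = M j \<kappa> * k * of_bool Q"
  "tr M (\<lambda>c. k * of_bool (j = c \<and> Q)) \<kappa> = M j \<kappa> * k * of_bool Q"
  using tr_delta[of M "k * of_bool Q" j \<kappa>] by (simp_all add: of_bool_conj mult_ac)

locale dual_frames =
  fixes M N :: "4 \<Rightarrow> 4 \<Rightarrow> real" and \<eta> :: "4 \<Rightarrow> real"
  assumes dual: "(\<Sum>\<kappa>\<in>UNIV. M i \<kappa> * N j \<kappa>) = of_bool (i = j) / \<eta> j"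
begin

lemma contract1: "(\<Sum>\<kappa>\<in>UNIV. tr M f \<kappa> * tr N f' \<kappa>) = (\<Sum>i\<in>UNIV. f i * f' i / \<eta> i)"
proof -
  have "(\<Sum>\<kappa>\<in>UNIV. tr M f \<kappa> * tr N f' \<kappa>) = (\<Sum>\<kappa>\<in>UNIV. \<Sum>i\<in>UNIV. \<Sum>j\<in>UNIV. f i * f' j * (M i \<kappa> * N j \<kappa>))"
    unfolding tr_def sum_product by (simp add: mult_ac)
  also have "\<dots> = (\<Sum>i\<in>UNIV. \<Sum>j\<in>UNIV. \<Sum>\<kappa>\<in>UNIV. f i * f' j * (M i \<kappa> * N j \<kappa>))"
    by (subst sum.swap, rule sum.cong, rule refl, subst sum.swap, rule refl)
  also have "\<dots> = (\<Sum>i\<in>UNIV. \<Sum>j\<in>UNIV. f i * f' j * (of_bool (i = j) / \<eta> j))"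
    unfolding sum_distrib_left[symmetric] dual ..
  also have "\<dots> = (\<Sum>i\<in>UNIV. \<Sum>j\<in>UNIV. if i = j then f i * f' i / \<eta> i else 0)"
    by (intro sum.cong refl) simp
  also have "\<dots> = (\<Sum>i\<in>UNIV. f i * f' i / \<eta> i)"
    by simp
  finally show ?thesis .
qed

lemma contract2:
  "(\<Sum>\<kappa>\<in>UNIV. \<Sum>\<beta>\<in>UNIV. tr M (\<lambda>i. tr M (f i) \<beta>) \<kappa> * tr N (\<lambda>i. tr N (f' i) \<beta>) \<kappa>)
    = (\<Sum>i\<in>UNIV. \<Sum>j\<in>UNIV. f i j * f' i j / (\<eta> i * \<eta> j))"
proof -
  have "(\<Sum>\<kappa>\<in>UNIV. \<Sum>\<beta>\<in>UNIV. tr M (\<lambda>i. tr M (f i) \<beta>) \<kappa> * tr N (\<lambda>i. tr N (f' i) \<beta>) \<kappa>)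
      = (\<Sum>\<beta>\<in>UNIV. \<Sum>i\<in>UNIV. tr M (f i) \<beta> * tr N (f' i) \<beta> / \<eta> i)"
    by (subst sum.swap) (simp only: contract1)
  also have "\<dots> = (\<Sum>i\<in>UNIV. (\<Sum>j\<in>UNIV. f i j * f' i j / \<eta> j) / \<eta> i)"
    by (subst sum.swap) (simp only: contract1 sum_divide_distrib[symmetric])
  finally show ?thesis
    by (simp add: sum_divide_distrib mult_ac)
qed

text \<open>Two indices at a time: with the sums over the last two coordinate indices moved outside,
  \<open>contract2\<close> applies to the outer pair, and after moving them back it applies to the
  inner pair.\<close>

lemma contract4:
  "(\<Sum>\<kappa>\<in>UNIV. \<Sum>\<beta>\<in>UNIV. \<Sum>\<mu>\<in>UNIV. \<Sum>\<nu>\<in>UNIV.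
      tr M (\<lambda>i. tr M (\<lambda>j. tr M (\<lambda>k. tr M (f i j k) \<nu>) \<mu>) \<beta>) \<kappa>
      * tr N (\<lambda>i. tr N (\<lambda>j. tr N (\<lambda>k. tr N (f' i j k) \<nu>) \<mu>) \<beta>) \<kappa>)
    = (\<Sum>i\<in>UNIV. \<Sum>j\<in>UNIV. \<Sum>k\<in>UNIV. \<Sum>l\<in>UNIV. f i j k l * f' i j k l / (\<eta> i * \<eta> j * \<eta> k * \<eta> l))"
proof -
  have "(\<Sum>\<kappa>\<in>UNIV. \<Sum>\<beta>\<in>UNIV. \<Sum>\<mu>\<in>UNIV. \<Sum>\<nu>\<in>UNIV.
      tr M (\<lambda>i. tr M (\<lambda>j. tr M (\<lambda>k. tr M (f i j k) \<nu>) \<mu>) \<beta>) \<kappa>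
      * tr N (\<lambda>i. tr N (\<lambda>j. tr N (\<lambda>k. tr N (f' i j k) \<nu>) \<mu>) \<beta>) \<kappa>)
    = (\<Sum>\<mu>\<in>UNIV. \<Sum>\<nu>\<in>UNIV. \<Sum>\<kappa>\<in>UNIV. \<Sum>\<beta>\<in>UNIV.
      tr M (\<lambda>i. tr M (\<lambda>j. tr M (\<lambda>k. tr M (f i j k) \<nu>) \<mu>) \<beta>) \<kappa>
      * tr N (\<lambda>i. tr N (\<lambda>j. tr N (\<lambda>k. tr N (f' i j k) \<nu>) \<mu>) \<beta>) \<kappa>)" (is "_ = ?R")
    unfolding sum.cartesian_product by (rule sum.reindex_bij_witness[of _
      "\<lambda>(\<mu>, \<nu>, \<kappa>, \<beta>). (\<kappa>, \<beta>, \<mu>, \<nu>)" "\<lambda>(\<kappa>, \<beta>, \<mu>, \<nu>). (\<mu>, \<nu>, \<kappa>, \<beta>)"]) auto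
  also have "?R = (\<Sum>\<mu>\<in>UNIV. \<Sum>\<nu>\<in>UNIV. \<Sum>i\<in>UNIV. \<Sum>j\<in>UNIV.
      tr M (\<lambda>k. tr M (f i j k) \<nu>) \<mu> * tr N (\<lambda>k. tr N (f' i j k) \<nu>) \<mu> / (\<eta> i * \<eta> j))"
    unfolding contract2 ..
  also have "\<dots> = (\<Sum>i\<in>UNIV. \<Sum>j\<in>UNIV. \<Sum>\<mu>\<in>UNIV. \<Sum>\<nu>\<in>UNIV.
      tr M (\<lambda>k. tr M (f i j k) \<nu>) \<mu> * tr N (\<lambda>k. tr N (f' i j k) \<nu>) \<mu> / (\<eta> i * \<eta> j))"
    unfolding sum.cartesian_product by (rule sum.reindex_bij_witness[of _
      "\<lambda>(\<mu>, \<nu>, \<kappa>, \<beta>). (\<kappa>, \<beta>, \<mu>, \<nu>)" "\<lambda>(\<kappa>, \<beta>, \<mu>, \<nu>). (\<mu>, \<nu>, \<kappa>, \<beta>)"]) auto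
  also have "\<dots> = (\<Sum>i\<in>UNIV. \<Sum>j\<in>UNIV. (\<Sum>k\<in>UNIV. \<Sum>l\<in>UNIV. f i j k l * f' i j k l / (\<eta> k * \<eta> l)) / (\<eta> i * \<eta> j))"
    unfolding sum_divide_distrib[symmetric] contract2 ..
  finally show ?thesis
    by (simp add: sum_divide_distrib mult_ac)
qed

end

section \<open>Weyl tensor and its contractions through frame components\<close>

context moving_frame
begin

abbreviation "TE y \<equiv> tr (\<lambda>i \<kappa>. E y $ i $ \<kappa>)"
abbreviation "TF y \<equiv> tr (\<lambda>i \<kappa>. F y $ \<kappa> $ i / h i y)"

lemma dual_frames: "y \<in> U \<Longrightarrow> dual_frames (\<lambda>i \<kappa>. E y $ i $ \<kappa>) (\<lambda>i \<kappa>. F y $ \<kappa> $ i / h i y) (\<lambda>i. h i y)"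
  by standard (simp add: E_F_sum sum_divide_distrib[symmetric])

lemma raise: "y \<in> U \<Longrightarrow> (\<Sum>\<kappa>\<in>UNIV. inv_metric g y $ \<sigma> $ \<kappa> * TE y f \<kappa>) = TF y f \<sigma>"
  unfolding tr_def sum_distrib_left
  by (subst sum.swap) (simp add: inv_metric_E sum_distrib_right[symmetric] mult.assoc[symmetric])

lemma metric_E: "y \<in> U \<Longrightarrow> g y $ \<mu> $ \<nu> = TE y (\<lambda>i. h i y * E y $ i $ \<nu>) \<mu>"
  by (simp add: tr_def metric mult_ac)

lemma riemann_frame:
  assumes "y \<in> U"
    and "\<And>i j. curv \<mu> \<nu> y $ i $ j = (\<Sum>b\<in>UNIV. \<Sum>c\<in>UNIV. E y $ b $ \<mu> * E y $ c $ \<nu> * K b c $ i $ j)"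
  shows "riemann g \<kappa> \<beta> \<mu> \<nu> y = TE y (\<lambda>i. TE y (\<lambda>j. TE y (\<lambda>b. TE y (\<lambda>c. h i y * K b c $ i $ j) \<nu>) \<mu>) \<beta>) \<kappa>"
proof -
  have "riemann g \<kappa> \<beta> \<mu> \<nu> y = ((g y ** F y) ** (curv \<mu> \<nu> y ** E y)) $ \<kappa> $ \<beta>"
    unfolding riemann_def riemann_up_eq[OF assms(1)]
    by (simp add: matrix_mul_assoc[symmetric]) (simp add: matrix_matrix_mult_def[of "g y"])
  also have "\<dots> = (\<Sum>i\<in>UNIV. \<Sum>j\<in>UNIV. h i y * E y $ i $ \<kappa> * (curv \<mu> \<nu> y $ i $ j * E y $ j $ \<beta>))"
    unfolding matrix_matrix_mult_def[of "g y ** F y"] by (simp add: metric_F[OF assms(1)])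
      (simp add: matrix_matrix_mult_def sum_distrib_left)
  finally show ?thesis
    by (simp add: assms(2) tr_def sum_distrib_left sum_distrib_right mult_ac)
qed

lemma ricci_frame:
  assumes "y \<in> U"
    and "\<And>\<mu> \<nu> i j. curv \<mu> \<nu> y $ i $ j = (\<Sum>b\<in>UNIV. \<Sum>c\<in>UNIV. E y $ b $ \<mu> * E y $ c $ \<nu> * K b c $ i $ j)"
  shows "ricci g \<beta> \<nu> y = TE y (\<lambda>j. TE y (\<lambda>c. \<Sum>i\<in>UNIV. K i c $ i $ j) \<nu>) \<beta>"
proof -
  have "ricci g \<beta> \<nu> y = (\<Sum>\<sigma>\<in>UNIV. \<Sum>i\<in>UNIV. \<Sum>j\<in>UNIV. \<Sum>b\<in>UNIV. \<Sum>c\<in>UNIV.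
      F y $ \<sigma> $ i * E y $ b $ \<sigma> * (E y $ c $ \<nu> * K b c $ i $ j * E y $ j $ \<beta>))"
    unfolding ricci_def riemann_up_eq[OF assms(1)] matrix_matrix_mult_def
    by (simp add: assms(2) sum_distrib_left sum_distrib_right mult_ac)
  also have "\<dots> = (\<Sum>i\<in>UNIV. \<Sum>j\<in>UNIV. \<Sum>b\<in>UNIV. \<Sum>c\<in>UNIV. \<Sum>\<sigma>\<in>UNIV.
      F y $ \<sigma> $ i * E y $ b $ \<sigma> * (E y $ c $ \<nu> * K b c $ i $ j * E y $ j $ \<beta>))"
    unfolding sum.cartesian_product by (rule sum.reindex_bij_witness[of _
      "\<lambda>(i, j, b, c, \<sigma>). (\<sigma>, i, j, b, c)" "\<lambda>(\<sigma>, i, j, b, c). (i, j, b, c, \<sigma>)"]) auto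
  also have "\<dots> = (\<Sum>i\<in>UNIV. \<Sum>j\<in>UNIV. \<Sum>c\<in>UNIV. E y $ c $ \<nu> * K i c $ i $ j * E y $ j $ \<beta>)"
  proof -
    have d: "(\<Sum>\<sigma>\<in>UNIV. F y $ \<sigma> $ i * E y $ b $ \<sigma>) = of_bool (i = b)" for i b
      using E_F_sum[OF assms(1), of b i] by (auto simp: mult.commute)
    have ob: "(\<Sum>b\<in>UNIV. \<Sum>c\<in>UNIV. of_bool (i = b) * f b c) = (\<Sum>c\<in>UNIV. f i c)" for i :: 4 and f :: "4 \<Rightarrow> 4 \<Rightarrow> real"
      unfolding sum_distrib_left[symmetric] by (simp add: of_bool_def if_distrib[of "\<lambda>z. z * _"] cong: if_cong)
    have dz: "(\<Sum>\<sigma>\<in>UNIV. F y $ \<sigma> $ i * E y $ b $ \<sigma> * z) = of_bool (i = b) * z" for i b z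
      unfolding sum_distrib_right[symmetric] d ..
    show ?thesis
      unfolding dz ob ..
  qed
  also have "\<dots> = (\<Sum>j\<in>UNIV. \<Sum>c\<in>UNIV. \<Sum>i\<in>UNIV. E y $ c $ \<nu> * K i c $ i $ j * E y $ j $ \<beta>)"
    unfolding sum.cartesian_product by (rule sum.reindex_bij_witness[of _
      "\<lambda>(j, c, i). (i, j, c)" "\<lambda>(i, j, c). (j, c, i)"]) auto
  finally show ?thesis
    by (simp add: tr_def sum_distrib_left mult_ac)
qed

text \<open>For an Einstein metric with \<open>Ric = 3 l g\<close> the Weyl tensor is the part \<open>t\<close> of the curvature.\<close>

lemma weyl_frame:
  assumes y: "y \<in> U"
    and K: "\<And>\<mu> \<nu> i j. curv \<mu> \<nu> y $ i $ j = (\<Sum>b\<in>UNIV. \<Sum>c\<in>UNIV. E y $ b $ \<mu> * E y $ c $ \<nu> * K b c $ i $ j)"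
    and t: "\<And>i j b c. h i y * K b c $ i $ j = t i j b c
      + l * h i y * h j y * (of_bool (i = b \<and> j = c) - of_bool (i = c \<and> j = b))"
    and trace: "\<And>j c. (\<Sum>i\<in>UNIV. t i j i c / h i y) = 0"
  shows "weyl g \<kappa> \<beta> \<mu> \<nu> y = TE y (\<lambda>i. TE y (\<lambda>j. TE y (\<lambda>b. TE y (t i j b) \<nu>) \<mu>) \<beta>) \<kappa>"
proof -
  have K': "K i c $ i $ j = t i j i c / h i y + l * h j y * (of_bool (j = c) - of_bool (i = c \<and> j = i))" for i j c
    using t[of i i c j] h_nz[OF y, of i] by (simp add: field_simps)
  have Kt: "(\<Sum>i\<in>UNIV. K i c $ i $ j) = 3 * l * h j y * of_bool (j = c)" for j c
  proof -
    have "(\<Sum>i\<in>UNIV. of_bool (j = c) - of_bool (i = c \<and> j = i) :: real) = 3 * of_bool (j = c)"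
      using exhaust_4[of j] exhaust_4[of c] by (auto simp: sum_4)
    then show ?thesis
      unfolding K' sum.distrib trace sum_distrib_left[symmetric] by simp
  qed
  have ricci: "ricci g \<beta> \<nu> y = 3 * l * g y $ \<beta> $ \<nu>" for \<beta> \<nu>
    unfolding ricci_frame[OF y K] Kt tr_delta metric_E[OF y] tr_mult[symmetric] by (simp add: mult_ac)
  have sym: "g y $ \<mu> $ \<nu> = g y $ \<nu> $ \<mu>" for \<mu> \<nu>
    by (simp add: metric[OF y] mult_ac)
  have "(\<Sum>\<mu>\<in>UNIV. \<Sum>\<nu>\<in>UNIV. inv_metric g y $ \<mu> $ \<nu> * g y $ \<mu> $ \<nu>) = (\<Sum>\<mu>\<in>UNIV. (inv_metric g y ** g y) $ \<mu> $ \<mu>)"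
    by (subst sym) (simp add: matrix_matrix_mult_def)
  then have "(\<Sum>\<mu>\<in>UNIV. \<Sum>\<nu>\<in>UNIV. inv_metric g y $ \<mu> $ \<nu> * g y $ \<mu> $ \<nu>) = 4"
    unfolding inv_metric_mult[OF y] by (simp add: mat_def)
  moreover have "scalar_curvature g y = 3 * l * (\<Sum>\<mu>\<in>UNIV. \<Sum>\<nu>\<in>UNIV. inv_metric g y $ \<mu> $ \<nu> * g y $ \<mu> $ \<nu>)"
    unfolding scalar_curvature_def ricci by (simp only: sum_distrib_left mult_ac)
  ultimately have scalar: "scalar_curvature g y = 12 * l"
    by simp
  have gg: "TE y (\<lambda>i. TE y (\<lambda>j. TE y (\<lambda>b. TE y (\<lambda>c. h i y * h j y * of_bool (i = b \<and> j = c)) \<nu>) \<mu>) \<beta>) \<kappa>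
      = g y $ \<kappa> $ \<mu> * g y $ \<beta> $ \<nu>"
    and gg': "TE y (\<lambda>i. TE y (\<lambda>j. TE y (\<lambda>b. TE y (\<lambda>c. h i y * h j y * of_bool (i = c \<and> j = b)) \<nu>) \<mu>) \<beta>) \<kappa>
      = g y $ \<kappa> $ \<nu> * g y $ \<beta> $ \<mu>"
    unfolding tr_delta_conj tr_delta by (simp_all add: tr_def metric[OF y] sum_product sum_distrib_left mult_ac)
  have "riemann g \<kappa> \<beta> \<mu> \<nu> y = TE y (\<lambda>i. TE y (\<lambda>j. TE y (\<lambda>b. TE y (\<lambda>c. t i j b c
      + (l * (h i y * h j y * of_bool (i = b \<and> j = c)) - l * (h i y * h j y * of_bool (i = c \<and> j = b)))) \<nu>) \<mu>) \<beta>) \<kappa>"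
    unfolding riemann_frame[OF y K] t by (simp add: right_diff_distrib mult.assoc)
  also have "\<dots> = TE y (\<lambda>i. TE y (\<lambda>j. TE y (\<lambda>b. TE y (t i j b) \<nu>) \<mu>) \<beta>) \<kappa>
      + (l * (g y $ \<kappa> $ \<mu> * g y $ \<beta> $ \<nu>) - l * (g y $ \<kappa> $ \<nu> * g y $ \<beta> $ \<mu>))"
    unfolding tr_add tr_diff tr_mult[of _ l] gg gg' ..
  \<comment> \<open>The Ricci terms contribute -3 \<open>l\<close> and the scalar term +2
    \<open>l\<close> times the antisymmetrised product of metrics, which cancels the constant
    curvature part.\<close>
  finally show ?thesis
    unfolding weyl_def ricci scalar by (simp add: algebra_simps)
qed

lemma weyl_up2_frame:
  assumes y: "y \<in> U"
    and weyl: "\<And>\<kappa> \<beta> \<mu> \<nu>. weyl g \<kappa> \<beta> \<mu> \<nu> y = TE y (\<lambda>i. TE y (\<lambda>j. TE y (\<lambda>b. TE y (t i j b) \<nu>) \<mu>) \<beta>) \<kappa>"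
  shows "weyl_up2 g \<sigma> \<tau> \<mu> \<nu> y = TF y (\<lambda>i. TF y (\<lambda>j. TE y (\<lambda>b. TE y (t i j b) \<nu>) \<mu>) \<tau>) \<sigma>"
  unfolding weyl_up2_def weyl mult.assoc sum_distrib_left[symmetric] sum_mult_tr raise[OF y] ..

lemma weyl_up4_frame:
  assumes y: "y \<in> U"
    and weyl: "\<And>\<kappa> \<beta> \<mu> \<nu>. weyl g \<kappa> \<beta> \<mu> \<nu> y = TE y (\<lambda>i. TE y (\<lambda>j. TE y (\<lambda>b. TE y (t i j b) \<nu>) \<mu>) \<beta>) \<kappa>"
  shows "weyl_up4 g \<kappa> \<beta> \<mu> \<nu> y = TF y (\<lambda>i. TF y (\<lambda>j. TF y (\<lambda>b. TF y (t i j b) \<nu>) \<mu>) \<beta>) \<kappa>"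
  unfolding weyl_up4_def weyl_up2_frame[OF y weyl] mult.assoc sum_distrib_left[symmetric] sum_mult_tr raise[OF y] ..

lemma I1_frame:
  assumes y: "y \<in> U"
    and weyl: "\<And>\<kappa> \<beta> \<mu> \<nu>. weyl g \<kappa> \<beta> \<mu> \<nu> y = TE y (\<lambda>i. TE y (\<lambda>j. TE y (\<lambda>b. TE y (t i j b) \<nu>) \<mu>) \<beta>) \<kappa>"
  shows "I1 g y = (\<Sum>i\<in>UNIV. \<Sum>j\<in>UNIV. \<Sum>k\<in>UNIV. \<Sum>l\<in>UNIV.
    t i j k l * t i j k l / (h i y * h j y * h k y * h l y))"
  unfolding I1_def weyl_up4_frame[OF y weyl] weyl by (rule dual_frames.contract4[OF dual_frames[OF y]])

lemma det_metric:
  assumes "y \<in> U"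
  shows "det (g y) = (\<Prod>c\<in>UNIV. h c y) * (det (E y))^2"
proof -
  define H where "H = (\<chi> a b. if a = b then h a y else 0)"
  have HE: "(H ** E y) $ a $ \<nu> = h a y * E y $ a $ \<nu>" for a \<nu>
    by (simp add: H_def matrix_matrix_mult_def if_distrib[of "\<lambda>z. z * _"] cong: if_cong)
  have "g y = Finite_Cartesian_Product.transpose (E y) ** (H ** E y)"
    unfolding matrix_matrix_mult_def[of "Finite_Cartesian_Product.transpose (E y)"]
    by (simp add: vec_eq_iff metric[OF assms] HE Finite_Cartesian_Product.transpose_def mult_ac)
  moreover have "det H = (\<Prod>c\<in>UNIV. h c y)"
    by (subst det_diagonal) (simp_all add: H_def)
  ultimately show ?thesis
    by (simp add: det_mul power2_eq_square)
qed

text \<open>The density in the chart is \<open>v\<close> times the absolute value of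
  \<open>det (E y)\<close>, while the symbol transforms with the determinant itself; the sign left
  over compares the orientations of frame and chart.\<close>

lemma levi_civita_frame:
  assumes y: "y \<in> U" and vol: "(\<Prod>c\<in>UNIV. h c y) = - (v^2)" and "v > 0"
  shows "levi_civita ori g \<kappa> \<beta> \<mu> \<nu> y = TE y (\<lambda>i. TE y (\<lambda>j. TE y (\<lambda>b. TE y
    (\<lambda>c. ori * sgn (det (E y)) * v * levi_civita_symbol i j b c) \<nu>) \<mu>) \<beta>) \<kappa>"
proof -
  have "sqrt \<bar>det (g y)\<bar> = v * \<bar>det (E y)\<bar>"
    using \<open>v > 0\<close> by (simp add: det_metric[OF y] vol abs_mult real_sqrt_mult)
  then have "levi_civita ori g \<kappa> \<beta> \<mu> \<nu> y = ori * sgn (det (E y)) * v * (det (E y) * levi_civita_symbol \<kappa> \<beta> \<mu> \<nu>)"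
    by (simp add: levi_civita_def abs_sgn mult_ac)
  also have "det (E y) * levi_civita_symbol \<kappa> \<beta> \<mu> \<nu>
      = TE y (\<lambda>i. TE y (\<lambda>j. TE y (\<lambda>b. TE y (levi_civita_symbol i j b) \<nu>) \<mu>) \<beta>) \<kappa>"
    unfolding sum_levi_civita_symbol[symmetric] tr_def by (simp add: sum_distrib_left mult_ac)
  finally show ?thesis
    by (simp add: tr_mult)
qed

lemma weyl_dual_frame:
  assumes y: "y \<in> U"
    and weyl: "\<And>\<kappa> \<beta> \<mu> \<nu>. weyl g \<kappa> \<beta> \<mu> \<nu> y = TE y (\<lambda>i. TE y (\<lambda>j. TE y (\<lambda>b. TE y (t i j b) \<nu>) \<mu>) \<beta>) \<kappa>"
    and lc: "\<And>\<kappa> \<beta> \<mu> \<nu>. levi_civita ori g \<kappa> \<beta> \<mu> \<nu> y = TE y (\<lambda>i. TE y (\<lambda>j. TE y (\<lambda>b. TE y (e i j b) \<nu>) \<mu>) \<beta>) \<kappa>"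
  shows "weyl_dual ori g \<kappa> \<beta> \<mu> \<nu> y = TE y (\<lambda>i. TE y (\<lambda>j. TE y (\<lambda>k. TE y (\<lambda>l.
    1/2 * (\<Sum>b\<in>UNIV. \<Sum>c\<in>UNIV. e i j b c / (h b y * h c y) * t b c k l)) \<nu>) \<mu>) \<beta>) \<kappa>"
proof -
  have pull: "(\<Sum>\<sigma>\<in>UNIV. \<Sum>\<tau>\<in>UNIV. TE y (\<lambda>i. TE y (\<lambda>j. f i j \<sigma> \<tau>) \<beta>) \<kappa> * u \<sigma> \<tau>)
      = TE y (\<lambda>i. TE y (\<lambda>j. \<Sum>\<sigma>\<in>UNIV. \<Sum>\<tau>\<in>UNIV. f i j \<sigma> \<tau> * u \<sigma> \<tau>) \<beta>) \<kappa>"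
    for f :: "4 \<Rightarrow> 4 \<Rightarrow> 4 \<Rightarrow> 4 \<Rightarrow> real" and u
    unfolding sum_tr_mult sum_tr ..
  have "weyl_dual ori g \<kappa> \<beta> \<mu> \<nu> y = 1/2 * TE y (\<lambda>i. TE y (\<lambda>j. \<Sum>\<sigma>\<in>UNIV. \<Sum>\<tau>\<in>UNIV.
      TE y (\<lambda>b. TE y (e i j b) \<tau>) \<sigma> * TF y (\<lambda>i. TF y (\<lambda>j. TE y (\<lambda>b. TE y (t i j b) \<nu>) \<mu>) \<tau>) \<sigma>) \<beta>) \<kappa>"
    unfolding weyl_dual_def weyl_up2_frame[OF y weyl] lc pull ..
  also have "\<dots> = 1/2 * TE y (\<lambda>i. TE y (\<lambda>j. \<Sum>b\<in>UNIV. \<Sum>c\<in>UNIV. e i j b c / (h b y * h c y) *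
      TE y (\<lambda>k. TE y (t b c k) \<nu>) \<mu>) \<beta>) \<kappa>"
    unfolding dual_frames.contract2[OF dual_frames[OF y]] by simp
  also have "\<dots> = TE y (\<lambda>i. TE y (\<lambda>j. TE y (\<lambda>k. TE y (\<lambda>l.
    1/2 * (\<Sum>b\<in>UNIV. \<Sum>c\<in>UNIV. e i j b c / (h b y * h c y) * t b c k l)) \<nu>) \<mu>) \<beta>) \<kappa>"
    unfolding sum_mult_tr sum_tr tr_mult ..
  finally show ?thesis .
qed

lemma I2_frame:
  assumes y: "y \<in> U"
    and weyl: "\<And>\<kappa> \<beta> \<mu> \<nu>. weyl g \<kappa> \<beta> \<mu> \<nu> y = TE y (\<lambda>i. TE y (\<lambda>j. TE y (\<lambda>b. TE y (t i j b) \<nu>) \<mu>) \<beta>) \<kappa>"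
    and lc: "\<And>\<kappa> \<beta> \<mu> \<nu>. levi_civita ori g \<kappa> \<beta> \<mu> \<nu> y = TE y (\<lambda>i. TE y (\<lambda>j. TE y (\<lambda>b. TE y (e i j b) \<nu>) \<mu>) \<beta>) \<kappa>"
    and dual: "\<And>i j k l. 1/2 * (\<Sum>b\<in>UNIV. \<Sum>c\<in>UNIV. e i j b c / (h b y * h c y) * t b c k l) = t' i j k l"
  shows "I2 ori g y = (\<Sum>i\<in>UNIV. \<Sum>j\<in>UNIV. \<Sum>k\<in>UNIV. \<Sum>l\<in>UNIV.
    t' i j k l * t i j k l / (h i y * h j y * h k y * h l y))"
  unfolding I2_def weyl_up4_frame[OF y weyl] weyl_dual_frame[OF y weyl lc] dual
  by (rule dual_frames.contract4[OF dual_frames[OF y]])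

end

section \<open>Curvature invariants\<close>

lemma type_D_trace:
  assumes "\<And>c. h c \<noteq> 0"
  shows "(\<Sum>i\<in>UNIV. type_D_weyl h w \<Xi> Y i j i c / h i) = 0"
  using assms exhaust_4[of j] exhaust_4[of c]
  by (elim disjE; simp add: sum_4 type_D_weyl_def block_weight_def levi_civita_symbol_explicit)

text \<open>The negative case is recorded through the swapped symbol, so that the duality argument
  has to treat even permutations only.\<close>

lemma levi_civita_symbol_values:
  "levi_civita_symbol i j k l = 0 \<or> levi_civita_symbol i j k l = 1
    \<or> levi_civita_symbol i j k l = - 1 \<and> levi_civita_symbol i j l k = 1"
  by (insert exhaust_4[of i] exhaust_4[of j] exhaust_4[of k] exhaust_4[of l]; elim disjE;
    simp add: levi_civita_symbol_explicit)

lemma levi_civita_symbol_antisym: "levi_civita_symbol i j k l = - levi_civita_symbol j i k l"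
  by (insert exhaust_4[of i] exhaust_4[of j] exhaust_4[of k] exhaust_4[of l]; elim disjE;
    simp add: levi_civita_symbol_explicit)

lemma levi_civita_symbol_repeated: "levi_civita_symbol i i k l = 0"
  using levi_civita_symbol_antisym[of i i k l] by simp

text \<open>The pairs \<open>i j\<close> and \<open>b c\<close> span complementary planes, and
  duality exchanges the two. The complement of a block plane is a block plane and that of a mixed
  plane is mixed, so the weights agree.\<close>

lemma levi_civita_complement:
  assumes "levi_civita_symbol i j b c = 1"
  shows "levi_civita_symbol b c k l = of_bool (i = k \<and> j = l) - of_bool (i = l \<and> j = k)"
    and "levi_civita_symbol i j k l = of_bool (b = k \<and> c = l) - of_bool (b = l \<and> c = k)"
    and "block_weight i j = block_weight b c"
proof -
  have "(\<forall>k l. levi_civita_symbol b c k l = of_bool (i = k \<and> j = l) - of_bool (i = l \<and> j = k))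
    \<and> (\<forall>k l. levi_civita_symbol i j k l = of_bool (b = k \<and> c = l) - of_bool (b = l \<and> c = k))
    \<and> block_weight i j = block_weight b c"
    by (insert assms exhaust_4[of i] exhaust_4[of j] exhaust_4[of b] exhaust_4[of c]; elim disjE;
      hypsubst; simp add: levi_civita_symbol_explicit forall_4 block_weight_def)
  then show "levi_civita_symbol b c k l = of_bool (i = k \<and> j = l) - of_bool (i = l \<and> j = k)"
    "levi_civita_symbol i j k l = of_bool (b = k \<and> c = l) - of_bool (b = l \<and> c = k)"
    "block_weight i j = block_weight b c"
    by blast+
qed

lemma frame_norm_product:
  assumes nz: "n \<noteq> 0" "w \<noteq> 0" "q \<noteq> 0" "p \<noteq> 0" and "levi_civita_symbol i j k l \<noteq> 0"
  shows "frame_norm n w q p i * frame_norm n w q p j * frame_norm n w q p k * frame_norm n w q p l = - (w^8)"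
proof -
  let ?h = "frame_norm n w q p"
  have "?h i * ?h j * ?h k * ?h l = ?h 1 * ?h 2 * ?h 3 * ?h 4"
    by (insert assms(5) exhaust_4[of i] exhaust_4[of j] exhaust_4[of k] exhaust_4[of l]; elim disjE;
      hypsubst; simp add: levi_civita_symbol_explicit)
  then show ?thesis
    using nz by (simp add: frame_norm_def field_simps eval_nat_numeral)
qed

text \<open>The dual of the Weyl tensor corresponds to multiplication of \<open>\<Xi> + i Y\<close> by \<open>- i\<close>.\<close>

lemma type_D_dual:
  assumes nz: "n \<noteq> 0" "w \<noteq> 0" "q \<noteq> 0" "p \<noteq> 0"
  shows "1/2 * (\<Sum>b\<in>UNIV. \<Sum>c\<in>UNIV. \<eta> * w^4 * levi_civita_symbol i j b c
      / (frame_norm n w q p b * frame_norm n w q p c) * type_D_weyl (frame_norm n w q p) w \<Xi> Y b c k l)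
    = \<eta> * type_D_weyl (frame_norm n w q p) w Y (- \<Xi>) i j k l"
proof -
  let ?h = "frame_norm n w q p" and ?T = "type_D_weyl (frame_norm n w q p) w"
  have self: "?T \<Xi> Y c c k l = 0" for c \<Xi> Y
    by (auto simp: type_D_weyl_def levi_civita_symbol_repeated)
  have compl: "levi_civita_symbol i j b c * w^4 / (?h b * ?h c) * ?T \<Xi> Y b c k l = ?T Y (- \<Xi>) i j k l"
    if lc: "levi_civita_symbol i j b c = 1" for b c
  proof -
    have "?h i * ?h j * ?h b * ?h c = - (w^8)"
      using lc by (intro frame_norm_product[OF nz]) simp
    moreover have "?h b * ?h c \<noteq> 0"
      using nz by (simp add: frame_norm_def)
    \<comment> \<open>Dualising interchanges the delta and the symbol. The negative product of the
      four norms, due to the Lorentzian signature, gives one of the two terms a sign, so the dual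
      squares to -1.\<close>
    moreover have "1 * w^4 / (hb * hc) * (\<kappa> * (\<Xi> * hb * hc * D - Y * w^4 * D'))
        = \<kappa> * (Y * hi * hj * D' - - \<Xi> * w^4 * D)"
      if "hi * hj * hb * hc = - (w^8)" "hb * hc \<noteq> 0" for hi hj hb hc \<kappa> D D' :: real
    proof -
      have "w^4 * (\<kappa> * (\<Xi> * hb * hc * D - Y * w^4 * D')) = \<kappa> * (Y * hi * hj * D' - - \<Xi> * w^4 * D) * (hb * hc)"
        using that(1) by algebra
      then show ?thesis
        using that(2) by (simp add: divide_simps)
    qed
    ultimately show ?thesis
      unfolding lc unfolding type_D_weyl_def levi_civita_complement[OF lc] by blast
  qed
  \<comment> \<open>For \<open>i\<close> different from \<open>j\<close> exactly the two orderings
    of the complementary pair contribute, with equal values, which cancels the factor 1/2.\<close>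
  have summand: "\<eta> * w^4 * levi_civita_symbol i j b c / (?h b * ?h c) * ?T \<Xi> Y b c k l
      = \<eta> * ?T Y (- \<Xi>) i j k l * (levi_civita_symbol i j b c)^2" for b c
  proof -
    have antisym: "?T \<Xi> Y c b k l = - ?T \<Xi> Y b c k l"
    proof -
      have weight: "block_weight c b = block_weight b c"
        by (auto simp: block_weight_def)
      have delta: "of_bool (c = k \<and> b = l) - of_bool (c = l \<and> b = k)
          = - (of_bool (b = k \<and> c = l) - of_bool (b = l \<and> c = k) :: real)"
        by (simp add: conj_commute)
      have "x * (\<Xi> * hc * hb * - D - Y * w^4 * - e) = - (x * (\<Xi> * hb * hc * D - Y * w^4 * e))" for x hb hc D e :: real
        by algebra
      then show ?thesis
        unfolding type_D_weyl_def levi_civita_symbol_antisym[of c b k l] weight delta .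
    qed
    consider "levi_civita_symbol i j b c = 0" | "levi_civita_symbol i j b c = 1" | "levi_civita_symbol i j c b = 1"
      "levi_civita_symbol i j b c = -1"
      using levi_civita_symbol_values[of i j b c] by blast
    then show ?thesis
    proof cases
      case 2
      then show ?thesis
        using arg_cong[OF compl[OF 2], of "\<lambda>z. \<eta> * z"] by (simp add: mult_ac)
    next
      case 3
      then show ?thesis
        using arg_cong[OF compl[OF 3(1)], of "\<lambda>z. \<eta> * z"] by (simp add: antisym mult_ac)
    qed simp
  qed
  show ?thesis
  proof (cases "i = j")
    case True
    then show ?thesis
      by (simp add: self levi_civita_symbol_repeated)
  next
    case False
    have "(\<Sum>b\<in>UNIV. \<Sum>c\<in>UNIV. (levi_civita_symbol i j b c)^2) = 2"
      using False exhaust_4[of i] exhaust_4[of j] by (elim disjE; simp add: sum_4 levi_civita_symbol_explicit)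
    then show ?thesis
      unfolding summand sum_distrib_left[symmetric] by simp
  qed
qed

lemma levi_civita_symbol_repeated': "levi_civita_symbol i j i j = 0" "levi_civita_symbol i j j i = 0"
  by (insert exhaust_4[of i] exhaust_4[of j]; elim disjE; simp add: levi_civita_symbol_explicit)+

text \<open>Delta and symbol are never both nonzero, so mixed terms vanish; the negative product of
  the norms gives the \<open>Y\<close> term its sign. The constant counts squared weights: 4 ordered
  pairs in a block with weight 4 and 8 mixed pairs with weight 1 make 24, doubled by the two
  orderings of the second pair.\<close>

lemma type_D_product:
  assumes nz: "n \<noteq> 0" "w \<noteq> 0" "q \<noteq> 0" "p \<noteq> 0"
  defines "h \<equiv> frame_norm n w q p"
  shows "(\<Sum>i\<in>UNIV. \<Sum>j\<in>UNIV. \<Sum>k\<in>UNIV. \<Sum>l\<in>UNIV.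
      type_D_weyl h w \<Xi>' Y' i j k l * type_D_weyl h w \<Xi> Y i j k l / (h i * h j * h k * h l))
    = 48 * (\<Xi>' * \<Xi> - Y' * Y)"
proof -
  have vol: "h i * h j * h k * h l = - (w^8)" if "levi_civita_symbol i j k l \<noteq> 0" for i j k l
    unfolding h_def by (rule frame_norm_product[OF nz that])
  have hnz: "h c \<noteq> 0" for c
    using nz by (simp add: h_def frame_norm_def)
  have "type_D_weyl h w \<Xi>' Y' i j k l * type_D_weyl h w \<Xi> Y i j k l / (h i * h j * h k * h l)
    = (block_weight i j)^2 * (\<Xi>' * \<Xi> * (of_bool (i = k \<and> j = l) - of_bool (i = l \<and> j = k))^2
      - Y' * Y * (levi_civita_symbol i j k l)^2)" for i j k l
  proof -
    define D :: real where "D = of_bool (i = k \<and> j = l) - of_bool (i = l \<and> j = k)"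
    define e where "e = levi_civita_symbol i j k l"
    have D: "D = 0 \<or> h k * h l = h i * h j"
      by (auto simp: D_def mult.commute)
    have De: "D = 0 \<or> e = 0"
      by (auto simp: D_def e_def levi_civita_symbol_repeated')
    have e: "e = 0 \<or> (h i * h j) * (h k * h l) = - (w^4 * w^4)"
      using vol[of i j k l] by (auto simp: e_def mult.assoc simp flip: power_add)
    have "(c * (\<Xi>' * hi * hj * D - Y' * w^4 * e)) * (c * (\<Xi> * hi * hj * D - Y * w^4 * e)) / ((hi * hj) * (hk * hl))
        = c^2 * (\<Xi>' * \<Xi> * D^2 - Y' * Y * e^2)"
      if h: "D = 0 \<or> hk * hl = hi * hj" "e = 0 \<or> (hi * hj) * (hk * hl) = - (w^4 * w^4)" "hi * hj \<noteq> 0"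
      for c hi hj hk hl :: real
    proof -
      consider "D = 0" "e = 0" | "e = 0" "hk * hl = hi * hj" | "D = 0" "(hi * hj) * (hk * hl) = - (w^4 * w^4)"
        using De h by blast
      then show ?thesis
      proof cases
        case 2
        then show ?thesis
          unfolding 2 using h(3) by (simp add: field_simps power2_eq_square)
      next
        case 3
        then show ?thesis
          unfolding 3(2) using nz by (simp add: 3(1) field_simps power2_eq_square)
      qed simp
    qed
    from this[OF D e] hnz show ?thesis
      by (simp add: type_D_weyl_def D_def e_def mult.assoc)
  qed
  then show ?thesis
    by (simp add: sum_4 block_weight_def levi_civita_symbol_explicit)
qed

section \<open>Type D Weyl tensor and quadratic invariants of the metric\<close>

context acc_kerr
begin

definition D\<gamma> :: "real \<Rightarrow> real \<Rightarrow> 4 \<Rightarrow> 4 \<Rightarrow> real^4^4"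
  where "D\<gamma> r X c d = (if c = 2 then conn_r_at r X d else if c = 3 then conn_X_at r X d else 0)"

definition K :: "real \<Rightarrow> real \<Rightarrow> 4 \<Rightarrow> 4 \<Rightarrow> real^4^4"
  where "K r X = frame_curv a (A r X) (B r X) (conn_at r X) (D\<gamma> r X)"

lemma K_type_D:
  assumes "y \<in> dom"
  defines "r \<equiv> y $ 2" and "X \<equiv> cos (y $ 3)"
  shows "h i y * K r X b c $ i $ j = type_D_weyl (\<lambda>i. h i y) (w r X) (\<Xi> r X) (Y r X) i j b c
    + \<Lambda> / 3 * h i y * h j y * (of_bool (i = b \<and> j = c) - of_bool (i = c \<and> j = b))"
proof -
  note nz = domD[OF assms(1), folded r_def X_def]
  interpret fp: frame_point a "n r X" "X * n r X" "r * n r X" "\<alpha> * w r X / n r X" "q r" "q1 r" "q2 r" "p X" "p1 X" "p2 X"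
    by standard (fact nz)+
  have "(r * n r X)^2 + a^2 * (X * n r X)^2 = n r X"
    using nz(9) by algebra
  then have eqs: "\<alpha> * w r X / n r X * (X * n r X) = U r X" "\<alpha> * w r X / n r X * (r * n r X) = V r X"
    "\<alpha> * w r X / n r X * ((r * n r X)^2 + a^2 * (X * n r X)^2) = W r X"
    using nz(7) by (simp_all add: U_def V_def W_def)
  have AB: "- (a * (X * n r X)) = A r X" "r * n r X = B r X"
    by (simp_all add: A_def B_def)
  have K: "frame_curv a (- (a * (X * n r X))) (r * n r X) fp.\<gamma> fp.D\<gamma> = K r X"
    unfolding fp.\<gamma>_def[abs_def] fp.D\<gamma>_def[abs_def] eqs unfolding AB K_def conn_at_def D\<gamma>_def conn_r_at_def conn_X_at_def ..
  have "frame_norm (n r X) (w r X) (q r) (p X) i * K r X b c $ i $ j =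
      type_D_weyl (frame_norm (n r X) (w r X) (q r) (p X)) (w r X) (\<Xi> r X) (Y r X) i j b c
    + \<Lambda> / 3 * frame_norm (n r X) (w r X) (q r) (p X) i * frame_norm (n r X) (w r X) (q r) (p X) j
      * (of_bool (i = b \<and> j = c) - of_bool (i = c \<and> j = b))"
    unfolding K[symmetric]
    by (rule fp.frame_riemann[OF nz(8,7)]; unfold fp.S_def fp.E12_def fp.E13_def fp.E34_def eqs; unfold AB;
      rule on_shell[OF nz(2,1)])
  then show ?thesis
    unfolding h_def[abs_def] r_def X_def .
qed

text \<open>The exterior derivative of a form with frame coefficients differentiates both the
  coefficients and the coframe. The second part, rewritten by \<open>structure_equation\<close>,
  yields the structure terms of \<open>frame_curv\<close>.\<close>

lemma curv_K:
  assumes "y \<in> dom"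
  shows "curv \<mu> \<nu> y $ i $ j = (\<Sum>b\<in>UNIV. \<Sum>c\<in>UNIV. E y $ b $ \<mu> * E y $ c $ \<nu> * K (y $ 2) (cos (y $ 3)) b c $ i $ j)"
proof -
  define \<gamma> D e where "\<gamma> = conn_at (y $ 2) (cos (y $ 3))" and "D = D\<gamma> (y $ 2) (cos (y $ 3))" and "e = (\<lambda>b \<mu>. E y $ b $ \<mu>)"
  have pd: "(if \<mu> = 2 then conn_r_at (y $ 2) (cos (y $ 3)) c
      else if \<mu> = 3 then - sin (y $ 3) *\<^sub>R conn_X_at (y $ 2) (cos (y $ 3)) c else 0) $ i $ j
    = (\<Sum>b\<in>UNIV. e b \<mu> * D b c $ i $ j)" for \<mu> c
    by (insert exhaust_4[of \<mu>]; elim disjE; simp add: e_def D_def D\<gamma>_def E_def sum_4)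
  have d\<omega>: "d\<omega> \<mu> \<nu> y $ i $ j = (\<Sum>c\<in>UNIV. dE \<mu> y $ c $ \<nu> * \<gamma> c $ i $ j) + (\<Sum>b\<in>UNIV. \<Sum>c\<in>UNIV. e b \<mu> * e c \<nu> * D b c $ i $ j)" for \<mu> \<nu>
  proof -
    have "(\<Sum>c\<in>UNIV. E y $ c $ \<nu> * (\<Sum>b\<in>UNIV. e b \<mu> * D b c $ i $ j)) = (\<Sum>b\<in>UNIV. \<Sum>c\<in>UNIV. e b \<mu> * e c \<nu> * D b c $ i $ j)"
      unfolding sum_distrib_left by (subst sum.swap) (simp add: e_def mult_ac)
    then show ?thesis
      unfolding d\<omega>_def sum_component vector_add_component vector_scaleR_component real_scaleR_def pd sum.distrib
      by (simp add: \<gamma>_def)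
  qed
  have \<omega>\<omega>: "(\<omega> \<mu> y ** \<omega> \<nu> y) $ i $ j = (\<Sum>b\<in>UNIV. \<Sum>c\<in>UNIV. e b \<mu> * e c \<nu> * (\<gamma> b ** \<gamma> c) $ i $ j)" for \<mu> \<nu>
  proof -
    have "(\<omega> \<mu> y ** \<omega> \<nu> y) $ i $ j = (\<Sum>k\<in>UNIV. \<Sum>b\<in>UNIV. \<Sum>c\<in>UNIV. e b \<mu> * e c \<nu> * (\<gamma> b $ i $ k * \<gamma> c $ k $ j))"
      unfolding matrix_matrix_mult_def by (simp add: \<omega>_component sum_product \<gamma>_def e_def mult_ac)
    also have "\<dots> = (\<Sum>b\<in>UNIV. \<Sum>c\<in>UNIV. \<Sum>k\<in>UNIV. e b \<mu> * e c \<nu> * (\<gamma> b $ i $ k * \<gamma> c $ k $ j))"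
      unfolding sum.cartesian_product by (rule sum.reindex_bij_witness[of _
        "\<lambda>(b, c, k). (k, b, c)" "\<lambda>(k, b, c). (b, c, k)"]) auto
    finally show ?thesis
      unfolding matrix_matrix_mult_def by (simp add: sum_distrib_left)
  qed
  have swap: "(\<Sum>b\<in>UNIV. \<Sum>c\<in>UNIV. e b \<nu> * e c \<mu> * z b c) = (\<Sum>b\<in>UNIV. \<Sum>c\<in>UNIV. e b \<mu> * e c \<nu> * z c b)" for z
    by (subst sum.swap) (simp add: mult_ac)
  have str: "(\<Sum>c\<in>UNIV. dE \<mu> y $ c $ \<nu> * \<gamma> c $ i $ j) - (\<Sum>c\<in>UNIV. dE \<nu> y $ c $ \<mu> * \<gamma> c $ i $ j)
      = (\<Sum>b\<in>UNIV. \<Sum>c\<in>UNIV. e b \<mu> * e c \<nu> * (struct1 a (A (y $ 2) (cos (y $ 3))) b c * \<gamma> 1 $ i $ j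
          + struct4 a (B (y $ 2) (cos (y $ 3))) b c * \<gamma> 4 $ i $ j))"
  proof -
    have "(\<Sum>c\<in>UNIV. dE \<mu> y $ c $ \<nu> * \<gamma> c $ i $ j) - (\<Sum>c\<in>UNIV. dE \<nu> y $ c $ \<mu> * \<gamma> c $ i $ j)
        = (\<Sum>d\<in>UNIV. (\<Sum>b\<in>UNIV. \<Sum>c\<in>UNIV. e b \<mu> * e c \<nu> * struct y d b c) * \<gamma> d $ i $ j)"
      unfolding sum_subtractf[symmetric] left_diff_distrib[symmetric] structure_equation[OF assms] e_def ..
    also have "\<dots> = (\<Sum>b\<in>UNIV. \<Sum>c\<in>UNIV. \<Sum>d\<in>UNIV. e b \<mu> * e c \<nu> * (struct y d b c * \<gamma> d $ i $ j))"
      unfolding sum_distrib_right sum.cartesian_product by (rule sum.reindex_bij_witness[of _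
        "\<lambda>(b, c, k). (k, b, c)" "\<lambda>(k, b, c). (b, c, k)"]) auto
    also have "\<dots> = (\<Sum>b\<in>UNIV. \<Sum>c\<in>UNIV. e b \<mu> * e c \<nu> * (struct1 a (A (y $ 2) (cos (y $ 3))) b c * \<gamma> 1 $ i $ j
          + struct4 a (B (y $ 2) (cos (y $ 3))) b c * \<gamma> 4 $ i $ j))"
    proof -
      have "(\<Sum>d\<in>UNIV. struct y d b c * \<gamma> d $ i $ j) = struct1 a (A (y $ 2) (cos (y $ 3))) b c * \<gamma> 1 $ i $ j
          + struct4 a (B (y $ 2) (cos (y $ 3))) b c * \<gamma> 4 $ i $ j" for b c
        by (simp add: sum_4 struct_def)
      then show ?thesis
        unfolding sum_distrib_left[symmetric] by (simp only:)
    qed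
    finally show ?thesis .
  qed
  have "curv \<mu> \<nu> y $ i $ j = d\<omega> \<mu> \<nu> y $ i $ j - d\<omega> \<nu> \<mu> y $ i $ j
      + ((\<omega> \<mu> y ** \<omega> \<nu> y) $ i $ j - (\<omega> \<nu> y ** \<omega> \<mu> y) $ i $ j)"
    by (simp add: curv_def)
  also have "\<dots> = ((\<Sum>c\<in>UNIV. dE \<mu> y $ c $ \<nu> * \<gamma> c $ i $ j) - (\<Sum>c\<in>UNIV. dE \<nu> y $ c $ \<mu> * \<gamma> c $ i $ j))
      + ((\<Sum>b\<in>UNIV. \<Sum>c\<in>UNIV. e b \<mu> * e c \<nu> * D b c $ i $ j) - (\<Sum>b\<in>UNIV. \<Sum>c\<in>UNIV. e b \<mu> * e c \<nu> * D c b $ i $ j))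
      + ((\<Sum>b\<in>UNIV. \<Sum>c\<in>UNIV. e b \<mu> * e c \<nu> * (\<gamma> b ** \<gamma> c) $ i $ j) - (\<Sum>b\<in>UNIV. \<Sum>c\<in>UNIV. e b \<mu> * e c \<nu> * (\<gamma> c ** \<gamma> b) $ i $ j))"
    unfolding d\<omega> \<omega>\<omega> swap by simp
  also have "\<dots> = (\<Sum>b\<in>UNIV. \<Sum>c\<in>UNIV. e b \<mu> * e c \<nu> * K (y $ 2) (cos (y $ 3)) b c $ i $ j)"
    unfolding str unfolding sum.distrib[symmetric] sum_subtractf[symmetric]
    by (simp add: K_def frame_curv_def \<gamma>_def[symmetric] D_def[symmetric] algebra_simps)
  finally show ?thesis
    unfolding e_def .
qed

lemma weyl_type_D:
  assumes "y \<in> dom"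
  shows "weyl (acc_kerr_ds a \<Lambda> \<alpha> m) \<kappa> \<beta> \<mu> \<nu> y = TE y (\<lambda>i. TE y (\<lambda>j. TE y (\<lambda>b. TE y
    (type_D_weyl (\<lambda>i. h i y) (w (y $ 2) (cos (y $ 3))) (\<Xi> (y $ 2) (cos (y $ 3))) (Y (y $ 2) (cos (y $ 3))) i j b) \<nu>) \<mu>) \<beta>) \<kappa>"
  by (rule weyl_frame[OF assms curv_K[OF assms] K_type_D[OF assms] type_D_trace[OF h_nz[OF assms]]])

lemma I1_eq:
  assumes "y \<in> dom"
  shows "I1 (acc_kerr_ds a \<Lambda> \<alpha> m) y = 48 * ((\<Xi> (y $ 2) (cos (y $ 3)))^2 - (Y (y $ 2) (cos (y $ 3)))^2)"
  unfolding I1_frame[OF assms weyl_type_D[OF assms]] h_def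
  using type_D_product[OF domD(7,8,3,6)[OF assms], of "\<Xi> (y $ 2) (cos (y $ 3))" "Y (y $ 2) (cos (y $ 3))"
    "\<Xi> (y $ 2) (cos (y $ 3))" "Y (y $ 2) (cos (y $ 3))"]
  by (simp add: power2_eq_square)

lemma det_E: "det (E y) = sin (y $ 3) * ((y $ 2)^2 + a^2 * (cos (y $ 3))^2)"
  by (simp add: E_def det_4) (use sin_cos_squared_add[of "y $ 3"] in algebra)

text \<open>By \<open>det_E\<close> the frame is oriented relative to the chart by the sign of sin
  \<theta>, which multiplies \<open>ori\<close>. Dualising replaces (\<open>\<Xi>\<close>,
  \<open>Y\<close>) by (\<open>Y\<close>, - \<open>\<Xi>\<close>), so the two products add up to 48
  * 2.\<close>

lemma I2_eq:
  assumes y: "y \<in> dom"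
  shows "I2 ori (acc_kerr_ds a \<Lambda> \<alpha> m) y
    = ori * sgn (sin (y $ 3)) * 96 * \<Xi> (y $ 2) (cos (y $ 3)) * Y (y $ 2) (cos (y $ 3))"
proof -
  define r X where "r = y $ 2" and "X = cos (y $ 3)"
  note nz = domD[OF y, folded r_def X_def]
  have "(\<Prod>c\<in>UNIV. h c y) = h 1 y * h 2 y * h 3 y * h 4 y"
    unfolding UNIV_4 by (simp add: mult.assoc)
  also have "\<dots> = - ((w r X ^ 4)^2)"
    unfolding h_def r_def[symmetric] X_def[symmetric]
    by (subst frame_norm_product[OF nz(7,8,3,6)]) (simp_all add: levi_civita_symbol_explicit)
  finally have vol: "(\<Prod>c\<in>UNIV. h c y) = - ((w r X ^ 4)^2)" .
  have "r^2 + a^2 * X^2 > 0"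
    using nz(2) by (simp add: order_less_le)
  then have sgn: "sgn (det (E y)) = sgn (sin (y $ 3))"
    by (simp add: det_E sgn_mult r_def X_def)
  have "w r X ^ 4 > 0"
    using nz(8) by simp
  note lc = levi_civita_frame[OF y vol this, of ori, unfolded sgn]
  let ?\<eta> = "ori * sgn (sin (y $ 3))" and ?T = "type_D_weyl (\<lambda>i. h i y) (w r X)"
  have "1/2 * (\<Sum>b\<in>UNIV. \<Sum>c\<in>UNIV. ?\<eta> * w r X ^ 4 * levi_civita_symbol i j b c / (h b y * h c y) * ?T (\<Xi> r X) (Y r X) b c k l)
      = ?\<eta> * ?T (Y r X) (- \<Xi> r X) i j k l" for i j k l
    unfolding h_def r_def[symmetric] X_def[symmetric] by (rule type_D_dual[OF nz(7,8,3,6)])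
  from I2_frame[OF y weyl_type_D[OF y, folded r_def X_def] lc this]
  have "I2 ori (acc_kerr_ds a \<Lambda> \<alpha> m) y = ?\<eta> * (\<Sum>i\<in>UNIV. \<Sum>j\<in>UNIV. \<Sum>k\<in>UNIV. \<Sum>l\<in>UNIV.
      ?T (Y r X) (- \<Xi> r X) i j k l * ?T (\<Xi> r X) (Y r X) i j k l / (h i y * h j y * h k y * h l y))"
    unfolding sum_distrib_left by (simp add: mult.assoc)
  also have "\<dots> = ?\<eta> * (48 * (Y r X * \<Xi> r X - - \<Xi> r X * Y r X))"
    unfolding h_def r_def[symmetric] X_def[symmetric] by (subst type_D_product[OF nz(7,8,3,6)]) (rule refl)
  finally show ?thesis
    by (simp add: r_def X_def)
qed

section \<open>Gradients of the invariants\<close>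

definition \<zeta> :: "real \<Rightarrow> real \<Rightarrow> complex"
  where "\<zeta> r X = of_real r + \<i> * of_real (a * X)"

definition \<kappa> :: complex
  where "\<kappa> = of_real m * (1 - \<i> * of_real (\<alpha> * a))"

definition \<Phi> :: "real \<Rightarrow> real \<Rightarrow> complex"
  where "\<Phi> r X = 48 * \<kappa>^2 * (of_real (1 - \<alpha> * r * X) / \<zeta> r X)^6"

text \<open>288 = 6 * 48. In the quotient rule for \<Omega> / \<open>\<zeta>\<close> the terms with
  \<alpha> r X cancel, here and in \<open>\<Phi>_X\<close>, which leaves these short
  numerators.\<close>

definition \<Phi>_r :: "real \<Rightarrow> real \<Rightarrow> complex"
  where "\<Phi>_r r X = - 288 * \<kappa>^2 * (of_real (1 - \<alpha> * r * X) / \<zeta> r X)^5 * (1 + \<i> * of_real (a * \<alpha> * X^2)) / (\<zeta> r X)^2"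

definition \<Phi>_X :: "real \<Rightarrow> real \<Rightarrow> complex"
  where "\<Phi>_X r X = - 288 * \<kappa>^2 * (of_real (1 - \<alpha> * r * X) / \<zeta> r X)^5 * (of_real (\<alpha> * r^2) + \<i> * of_real a) / (\<zeta> r X)^2"

lemma cmod_\<zeta>: "(cmod (\<zeta> r X))^2 = r^2 + a^2 * X^2"
  by (simp add: \<zeta>_def cmod_power2 power_mult_distrib)

lemma \<zeta>_nz: "r^2 + a^2 * X^2 \<noteq> 0 \<Longrightarrow> \<zeta> r X \<noteq> 0"
  using cmod_\<zeta>[of r X] by auto

lemma cmod_\<kappa>: "(cmod \<kappa>)^2 = m^2 * (1 + a^2 * \<alpha>^2)"
  by (simp add: \<kappa>_def cmod_power2 norm_mult power_mult_distrib mult.commute)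

lemma \<Phi>_eq:
  assumes "r^2 + a^2 * X^2 \<noteq> 0"
  shows "\<Phi> r X = Complex (48 * ((\<Xi> r X)^2 - (Y r X)^2)) (96 * \<Xi> r X * Y r X)"
proof -
  have "\<zeta> r X * Complex (r * n r X) (- (a * X * n r X)) = 1"
    using assms by (simp add: \<zeta>_def complex_eq_iff n_def divide_simps) algebra
  then have inv: "1 / \<zeta> r X = Complex (r * n r X) (- (a * X * n r X))"
    using \<zeta>_nz[OF assms] by (simp add: field_simps)
  have "Complex (\<Xi> r X) (Y r X) = - (\<kappa> * (of_real (1 - \<alpha> * r * X) * Complex (r * n r X) (- (a * X * n r X)))^3)"
    by (simp add: \<kappa>_def complex_eq_iff \<Xi>_def Y_def power3_eq_cube) algebra
  then have "48 * (Complex (\<Xi> r X) (Y r X))^2 = \<Phi> r X"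
    unfolding \<Phi>_def inv[symmetric] by (simp add: power_mult_distrib flip: power_mult)
  moreover have "48 * (Complex (\<Xi> r X) (Y r X))^2 = Complex (48 * ((\<Xi> r X)^2 - (Y r X)^2)) (96 * \<Xi> r X * Y r X)"
    by (simp add: complex_eq_iff power2_eq_square algebra_simps)
  ultimately show ?thesis
    by simp
qed

lemma \<Phi>_derivatives:
  assumes nz: "r^2 + a^2 * X^2 \<noteq> 0"
  shows "((\<lambda>r. \<Phi> r X) has_vector_derivative \<Phi>_r r X) (at r)"
    and "((\<lambda>X. \<Phi> r X) has_vector_derivative \<Phi>_X r X) (at X)"
proof -
  note z = \<zeta>_nz[OF nz, unfolded \<zeta>_def]
  \<comment> \<open>The variable is taken complex, where the function is a rational expression, and
    the derivative is then restricted to the real line.\<close>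
  have "((\<lambda>r. 48 * \<kappa>^2 * ((1 - of_real \<alpha> * r * of_real X) / (r + \<i> * of_real (a * X)))^6)
      has_field_derivative \<Phi>_r r X) (at (of_real r))"
    unfolding \<Phi>_r_def \<zeta>_def
    by (rule derivative_eq_intros refl z)+ (use z in \<open>simp add: field_simps eval_nat_numeral\<close>)
  then show "((\<lambda>r. \<Phi> r X) has_vector_derivative \<Phi>_r r X) (at r)"
    unfolding \<Phi>_def \<zeta>_def by (drule_tac has_vector_derivative_real_field) simp
  have "((\<lambda>X. 48 * \<kappa>^2 * ((1 - of_real \<alpha> * of_real r * X) / (of_real r + \<i> * (of_real a * X)))^6)
      has_field_derivative \<Phi>_X r X) (at (of_real X))"
    unfolding \<Phi>_X_def \<zeta>_def
    by (rule derivative_eq_intros refl z[unfolded of_real_mult])+ (use z in \<open>simp add: field_simps eval_nat_numeral\<close>)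
  then show "((\<lambda>X. \<Phi> r X) has_vector_derivative \<Phi>_X r X) (at X)"
    unfolding \<Phi>_def \<zeta>_def by (drule_tac has_vector_derivative_real_field) simp
qed

text \<open>Both derivatives are multiples of one complex factor \<open>b\<close>, of which only the
  squared modulus remains. The cofactors contribute a times the difference of 1 and the square of
  \<alpha> r X; this is the origin of the factor \<open>1 + \<alpha> * r * X\<close>.\<close>

lemma Im_\<Phi>_derivatives:
  assumes nz: "r^2 + a^2 * X^2 \<noteq> 0"
  shows "Im (cnj (\<Phi>_r r X) * \<Phi>_X r X) = 288^2 * m^4 * (1 + a^2 * \<alpha>^2)^2 * (1 - \<alpha> * r * X)^11 * n r X ^ 7
    * a * (1 + \<alpha> * r * X)"
proof -
  define b where "b = 288 * \<kappa>^2 * (of_real (1 - \<alpha> * r * X) / \<zeta> r X)^5 / (\<zeta> r X)^2"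
  define v1 v2 where "v1 = 1 + \<i> * complex_of_real (a * \<alpha> * X^2)" and "v2 = complex_of_real (\<alpha> * r^2) + \<i> * of_real a"
  have "\<Phi>_r r X = - (b * v1)" "\<Phi>_X r X = - (b * v2)"
    by (simp_all add: \<Phi>_r_def \<Phi>_X_def b_def v1_def v2_def)
  then have "cnj (\<Phi>_r r X) * \<Phi>_X r X = (b * cnj b) * (cnj v1 * v2)"
    by (simp add: mult_ac)
  also have "b * cnj b = of_real ((cmod b)^2)"
    by (simp only: complex_norm_square)
  finally have "Im (cnj (\<Phi>_r r X) * \<Phi>_X r X) = (cmod b)^2 * Im (cnj v1 * v2)"
    by simp
  moreover have "Im (cnj v1 * v2) = a * (1 - \<alpha> * r * X) * (1 + \<alpha> * r * X)"
    by (simp add: v1_def v2_def) algebra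
  moreover have "(cmod b)^2 = 288^2 * m^4 * (1 + a^2 * \<alpha>^2)^2 * (1 - \<alpha> * r * X)^10 * n r X ^ 7"
  proof -
    have "(cmod b)^2 = 288^2 * ((cmod \<kappa>)^2)^2 * (1 - \<alpha> * r * X)^10 / ((cmod (\<zeta> r X))^2)^7"
      unfolding b_def norm_mult norm_divide norm_power norm_of_real power_mult_distrib power_divide
      by (simp add: power_mult[symmetric] power_even_abs)
    then show ?thesis
      unfolding cmod_\<kappa> cmod_\<zeta> by (simp add: n_def power_mult_distrib power_divide flip: power_mult)
  qed
  ultimately show ?thesis
    by (simp add: eval_nat_numeral)
qed

lemma cmod_\<Phi>: "(Re (\<Phi> r X))^2 + (Im (\<Phi> r X))^2 = (48 * m^2 * (1 + a^2 * \<alpha>^2) * (1 - \<alpha> * r * X)^6 * n r X ^ 3)^2"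
proof -
  have "(cmod (\<Phi> r X))^2 = (48 * (cmod \<kappa>)^2 * (1 - \<alpha> * r * X)^6 / ((cmod (\<zeta> r X))^2)^3)^2"
    unfolding \<Phi>_def norm_mult norm_divide norm_power norm_of_real power_mult_distrib power_divide
    by (simp add: power_mult[symmetric] power_even_abs)
  then show ?thesis
    unfolding cmod_\<kappa> cmod_\<zeta> by (simp add: cmod_power2 n_def power_mult_distrib power_divide mult.assoc)
qed

text \<open>A general linear \<open>f\<close> serves both gradients: the real part for
  \<open>k_form\<close>, a signed imaginary part for \<open>l_form\<close>.\<close>

lemma has_pd_\<Phi>:
  assumes "y \<in> dom" and f: "bounded_linear f"
  shows "has_pd (\<lambda>y. f (\<Phi> (y $ 2) (cos (y $ 3)))) (if \<mu> = 2 then f (\<Phi>_r (y $ 2) (cos (y $ 3)))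
    else if \<mu> = 3 then - sin (y $ 3) * f (\<Phi>_X (y $ 2) (cos (y $ 3))) else 0) \<mu> y"
  by (rule has_pd_r_cos; unfold has_real_derivative_iff_has_vector_derivative;
    intro bounded_linear.has_vector_derivative[OF f] \<Phi>_derivatives domD(2)[OF assms(1)])

lemma k_form_eq:
  assumes "y \<in> dom"
  shows "k_form (acc_kerr_ds a \<Lambda> \<alpha> m) \<mu> y = - (if \<mu> = 2 then Re (\<Phi>_r (y $ 2) (cos (y $ 3)))
    else if \<mu> = 3 then - sin (y $ 3) * Re (\<Phi>_X (y $ 2) (cos (y $ 3))) else 0)"
  unfolding k_form_def
  by (subst pderiv_at_eq[OF has_pd_cong_open[OF has_pd_\<Phi>[OF assms bounded_linear_Re] open_dom assms]])
    (simp_all add: I1_eq \<Phi>_eq domD)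

lemma l_form_eq:
  assumes y: "y \<in> dom"
  shows "l_form ori (acc_kerr_ds a \<Lambda> \<alpha> m) \<mu> y = - (ori * sgn (sin (y $ 3)) * (if \<mu> = 2 then Im (\<Phi>_r (y $ 2) (cos (y $ 3)))
    else if \<mu> = 3 then - sin (y $ 3) * Im (\<Phi>_X (y $ 2) (cos (y $ 3))) else 0))"
proof -
  let ?\<eta> = "ori * sgn (sin (y $ 3))"
  \<comment> \<open>The sign of \<open>sin \<theta>\<close> is constant near \<open>y\<close>.\<close>
  define U where "U = dom \<inter> {z. sin (y $ 3) * sin (z $ 3) > 0}"
  have "open U"
    unfolding U_def by (intro open_Int open_dom open_Collect_less continuous_intros)
  moreover have "y \<in> U"
    using y domD(5)[OF y] by (auto simp: U_def zero_less_mult_iff)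
  ultimately have U: "open U" "y \<in> U" .
  have sgn: "sgn (sin (z $ 3)) = sgn (sin (y $ 3))" if "z \<in> U" for z
    using that by (auto simp: U_def zero_less_mult_iff)
  have "bounded_linear (\<lambda>z. ?\<eta> * Im z)"
    by (intro bounded_linear_intros bounded_linear_Im)
  from has_pd_cong_open[OF has_pd_\<Phi>[OF y this] U, of "I2 ori (acc_kerr_ds a \<Lambda> \<alpha> m)"]
  have "has_pd (I2 ori (acc_kerr_ds a \<Lambda> \<alpha> m)) (if \<mu> = 2 then ?\<eta> * Im (\<Phi>_r (y $ 2) (cos (y $ 3)))
    else if \<mu> = 3 then - sin (y $ 3) * (?\<eta> * Im (\<Phi>_X (y $ 2) (cos (y $ 3)))) else 0) \<mu> y" for \<mu>
    using sgn by (simp add: U_def I2_eq \<Phi>_eq domD)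
  from pderiv_at_eq[OF this] show ?thesis
    unfolding l_form_def by (auto simp: mult_ac)
qed

lemma inv_metric_r_theta:
  assumes y: "y \<in> dom"
  shows "inv_metric (acc_kerr_ds a \<Lambda> \<alpha> m) y $ 2 $ 2 = 1 / h 2 y"
    "inv_metric (acc_kerr_ds a \<Lambda> \<alpha> m) y $ 3 $ 2 = 0"
    "inv_metric (acc_kerr_ds a \<Lambda> \<alpha> m) y $ 2 $ 3 = 0"
    "inv_metric (acc_kerr_ds a \<Lambda> \<alpha> m) y $ 3 $ 3 = 1 / ((sin (y $ 3))^2 * h 3 y)"
  using inv_metric_E[OF y, of 2 2] inv_metric_E[OF y, of 3 2] inv_metric_E[OF y, of 2 3] inv_metric_E[OF y, of 3 3]
    domD(5)[OF y] h_nz[OF y, of 2] h_nz[OF y, of 3]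
  by (simp_all add: sum_4 E_def F_def Let_def field_simps power2_eq_square)

text \<open>Lagrange's identity for the diagonal (r, X) block: the Gram determinant of two covectors
  is the square of their 2 x 2 minor over \<open>h 2 y * h 3 y\<close>. With real and imaginary
  parts as entries the minor is the imaginary part of \<open>cnj\<close> of one derivative times the
  other; squaring removes the orientation sign.\<close>

lemma gram_determinant:
  assumes y: "y \<in> dom" and "ori^2 = 1"
  shows "I5 (acc_kerr_ds a \<Lambda> \<alpha> m) y * I6 ori (acc_kerr_ds a \<Lambda> \<alpha> m) y - (I7 ori (acc_kerr_ds a \<Lambda> \<alpha> m) y)^2
    = (Im (cnj (\<Phi>_r (y $ 2) (cos (y $ 3))) * \<Phi>_X (y $ 2) (cos (y $ 3))))^2 / (h 2 y * h 3 y)"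
proof -
  define \<eta> s f1 f2 where "\<eta> = ori * sgn (sin (y $ 3))" and "s = sin (y $ 3)"
    and "f1 = \<Phi>_r (y $ 2) (cos (y $ 3))" and "f2 = \<Phi>_X (y $ 2) (cos (y $ 3))"
  have nz: "h 2 y \<noteq> 0" "h 3 y \<noteq> 0" "s \<noteq> 0"
    using h_nz[OF y] domD(5)[OF y] by (auto simp: s_def)
  have \<eta>: "\<eta>^2 = 1"
    using assms(2) nz(3) by (simp add: \<eta>_def s_def power_mult_distrib sgn_if)
  note forms = k_form_eq[OF y] l_form_eq[OF y] inv_metric_r_theta[OF y]
  have 5: "I5 (acc_kerr_ds a \<Lambda> \<alpha> m) y = (Re f1)^2 / h 2 y + (Re f2)^2 / h 3 y"
    unfolding I5_def forms(1) using nz by (simp add: sum_4 forms f1_def f2_def s_def power2_eq_square)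
  have 6: "I6 ori (acc_kerr_ds a \<Lambda> \<alpha> m) y = \<eta>^2 * ((Im f1)^2 / h 2 y + (Im f2)^2 / h 3 y)"
    unfolding I6_def forms(2) \<eta>_def[symmetric] using nz by (simp add: sum_4 forms f1_def f2_def s_def power2_eq_square algebra_simps)
  have 7: "I7 ori (acc_kerr_ds a \<Lambda> \<alpha> m) y = \<eta> * (Re f1 * Im f1 / h 2 y + Re f2 * Im f2 / h 3 y)"
    unfolding I7_def forms(1,2) \<eta>_def[symmetric] using nz by (simp add: sum_4 forms f1_def f2_def s_def power2_eq_square algebra_simps)
  show ?thesis
    unfolding 5 6 7 f1_def[symmetric] f2_def[symmetric] power_mult_distrib \<eta>
    using nz by (simp add: field_simps power2_eq_square)
qed

lemma Q2_eq:
  assumes y: "y \<in> dom" and "ori^2 = 1" and "m \<noteq> 0" and pos: "1 - \<alpha> * y $ 2 * cos (y $ 3) > 0"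
  defines "r \<equiv> y $ 2" and "X \<equiv> cos (y $ 3)"
  shows "Q2 ori (acc_kerr_ds a \<Lambda> \<alpha> m) y = a^2 * (1 + \<alpha> * r * X)^2 * n r X * q r * p X
    / (m^2 * (1 + a^2 * \<alpha>^2) * (1 - \<alpha> * r * X)^4)"
proof -
  define Om N where "Om = 1 - \<alpha> * r * X" and "N = 1 + a^2 * \<alpha>^2"
  \<comment> \<open>This is the modulus of \<open>\<Phi> r X\<close>; as it is positive, the real
    power 5/2 of its square is \<open>z^5\<close>.\<close>
  define z where "z = 48 * m^2 * N * Om^6 * n r X ^ 3"
  note nz = domD[OF y, folded r_def X_def]
  have n: "n r X > 0"
    using nz(2) by (simp add: n_def order_less_le)
  have N: "N > 0"
    by (simp add: N_def add_pos_nonneg)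
  have Om: "Om > 0"
    using pos by (simp add: Om_def r_def X_def)
  have z: "z > 0"
    using n N Om \<open>m \<noteq> 0\<close> by (simp add: z_def)
  have "(I1 (acc_kerr_ds a \<Lambda> \<alpha> m) y)^2 + (I2 ori (acc_kerr_ds a \<Lambda> \<alpha> m) y)^2 = (Re (\<Phi> r X))^2 + (Im (\<Phi> r X))^2"
    unfolding I1_eq[OF y] I2_eq[OF y] \<Phi>_eq[OF nz(2)] r_def[symmetric] X_def[symmetric]
    using assms(2) domD(5)[OF y] by (simp add: power_mult_distrib sgn_if)
  also have "\<dots> = z^2"
    unfolding cmod_\<Phi> z_def N_def Om_def ..
  finally have "((I1 (acc_kerr_ds a \<Lambda> \<alpha> m) y)^2 + (I2 ori (acc_kerr_ds a \<Lambda> \<alpha> m) y)^2) powr (5/2) = (z powr 2) powr (5/2)"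
    using powr_realpow[OF z, of 2] by simp
  also have "\<dots> = z^5"
    unfolding powr_powr using z powr_realpow[of z 5] by simp
  finally have den: "((I1 (acc_kerr_ds a \<Lambda> \<alpha> m) y)^2 + (I2 ori (acc_kerr_ds a \<Lambda> \<alpha> m) y)^2) powr (5/2) = z^5" .
  have "h 2 y * h 3 y = 1 / (n r X ^ 2 * q r * p X * Om^4)"
    using nz by (simp add: h_def frame_norm_def r_def[symmetric] X_def[symmetric] w_def Om_def field_simps power2_eq_square power4_eq_xxxx)
  then have "Q2 ori (acc_kerr_ds a \<Lambda> \<alpha> m) y = 1/27 * ((288^2 * m^4 * N^2 * Om^11 * n r X ^ 7 * a * (1 + \<alpha> * r * X))^2
      * (n r X ^ 2 * q r * p X * Om^4) / z^5)"
    unfolding Q2_def den gram_determinant[OF y assms(2)] r_def[symmetric] X_def[symmetric] Im_\<Phi>_derivatives[OF nz(2)]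
    by (simp add: N_def Om_def)
  \<comment> \<open>All numerical constants cancel because 288^4 = 27 * 48^5, which accounts for the
    factor 1/27 in \<open>Q2\<close>.\<close>
  also have "\<dots> = a^2 * (1 + \<alpha> * r * X)^2 * n r X * q r * p X / (m^2 * N * Om^4)"
    unfolding z_def using n N Om \<open>m \<noteq> 0\<close> by (simp add: field_simps eval_nat_numeral)
  finally show ?thesis
    unfolding N_def Om_def .
qed

end

theorem theorem47:
  fixes a \<Lambda> \<alpha> m :: real
    and ori :: real
    and t r \<theta> \<phi> :: real
  assumes "m \<noteq> 0"
    and "ori = 1 \<or> ori = - 1"
    and "conf_factor \<alpha> r \<theta> > 0"
    and "rho_sq a r \<theta> \<noteq> 0"
    and "Q_fun a \<Lambda> \<alpha> m r \<noteq> 0"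
    and "P_fun a \<Lambda> \<alpha> m \<theta> > 0"
    and "sin \<theta> \<noteq> 0"
  shows "Q2 ori (acc_kerr_ds a \<Lambda> \<alpha> m) (vector [t, r, \<theta>, \<phi>]) =
    - (a\<^sup>2 * (\<alpha> * r * cos \<theta> + 1)\<^sup>2 * (sin \<theta>)\<^sup>2
       / ((\<alpha> * r * cos \<theta> - 1)^4 * (r\<^sup>2 + a\<^sup>2 * (cos \<theta>)\<^sup>2) * m\<^sup>2 * (a\<^sup>2 * \<alpha>\<^sup>2 + 1)))
    * ((\<Lambda> / 3 + \<alpha>\<^sup>2) * r^4 - 2 * m * \<alpha>\<^sup>2 * r^3
       + (a\<^sup>2 * \<alpha>\<^sup>2 + 1/3 * a\<^sup>2 * \<Lambda> - 1) * r\<^sup>2 + 2 * m * r - a\<^sup>2)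
    * (1 + a\<^sup>2 * (\<Lambda> / 3 + \<alpha>\<^sup>2) * (cos \<theta>)\<^sup>2 - 2 * \<alpha> * m * cos \<theta>)"
proof -
  interpret acc_kerr a \<Lambda> \<alpha> m .
  define X where "X = cos \<theta>"
  have P: "P_fun a \<Lambda> \<alpha> m \<theta> = P X" and p: "p X = (sin \<theta>)^2 * P X"
    by (simp_all add: P_fun_def P_def p_def X_def sin_squared_eq)
  have y: "vector [t, r, \<theta>, \<phi>] \<in> dom"
    using assms P by (auto simp: dom_def conf_factor_def rho_sq_def q_def X_def)
  have ori: "ori^2 = 1"
    using assms(2) by auto
  have "Q2 ori (acc_kerr_ds a \<Lambda> \<alpha> m) (vector [t, r, \<theta>, \<phi>])
    = a^2 * (1 + \<alpha> * r * X)^2 * n r X * q r * p X / (m^2 * (1 + a^2 * \<alpha>^2) * (1 - \<alpha> * r * X)^4)"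
    using Q2_eq[OF y ori assms(1), unfolded vector_4] assms(3) by (simp only: conf_factor_def X_def)
  moreover have "(\<Lambda> / 3 + \<alpha>\<^sup>2) * r^4 - 2 * m * \<alpha>\<^sup>2 * r^3
       + (a\<^sup>2 * \<alpha>\<^sup>2 + 1/3 * a\<^sup>2 * \<Lambda> - 1) * r\<^sup>2 + 2 * m * r - a\<^sup>2 = - q r"
    by (simp add: q_def Q_fun_def algebra_simps power2_eq_square power3_eq_cube power4_eq_xxxx)
  moreover have "1 + a\<^sup>2 * (\<Lambda> / 3 + \<alpha>\<^sup>2) * (cos \<theta>)\<^sup>2 - 2 * \<alpha> * m * cos \<theta> = P X"
    by (simp add: P_def X_def algebra_simps)
  moreover have "(\<alpha> * r * X - 1)^4 = (1 - \<alpha> * r * X)^4"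
    by algebra
  ultimately show ?thesis
    unfolding X_def[symmetric] p n_def by (simp add: add.commute mult_ac)
qed

end
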